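(* Let $n>3$ be odd and consider the planar Newtonian $n$-body problem with $n$ equal masses. Let $\sigma_1,\sigma_2$ be the permutations of $\{1,\dots,n\}$ given by $\sigma_1(i)\equiv n-i$ and $\sigma_2(i)\equiv n-i+1 \pmod n$ (with $0\equiv n$). Let $G=D_L$ be the dihedral group of order $2L$ with generators $h_1,h_2$, acting with $\sigma(h_1)=\sigma_1$, $\sigma(h_2)=\sigma_2$ and with one of the following actions on the plane: (i) $L=n$ and $\rho(h_1)=\rho(h_2)$ is the rotation of angle $\pi$; (ii) $L=2n$, $\rho(h_1)$ is the rotation of angle $\pi$ and $\rho(h_2)$ is a reflection along a line through the origin. Assume that all local minima of $\mathcal{A}^G$ in $\Lambda^G$ are collision-free. Then in each of the two cases $\mathcal{A}^G$ is coercive and attains its minimum on $\Lambda^G$, and a minimizer is a collision-free $T$-periodic solution which is a choreography and is not homographic.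
   Context: Let $T>0$, $T^1=\mathbb{R}/T\mathbb{Z}$, let $\mu>0$ be the common mass, $\mathcal{X}=\{x\in(\mathbb{R}^2)^n:\sum_ix_i=0\}$, $\Lambda=H^1(T^1,\mathcal{X})$. The generators act on time by $h_1t=-t$ and $h_2t=\frac TL-t$; $\rho\colon G\to O(2)$ is the action on the plane and $\sigma\colon G\to\Sigma_n$ the action on the indices. $G$ acts on $\mathcal{X}$ by $(gx)_i=\rho(g)x_{\sigma(g)^{-1}(i)}$ and on $\Lambda$ by $(g\cdot x)(t)=g\,x(g^{-1}t)$; $\Lambda^G$ is the set of loops fixed by $G$. $\mathcal{A}(x)=\int_0^T\big(\sum_i\frac\mu2|\dot x_i|^2+\sum_{i<j}\frac{\mu^2}{|x_i-x_j|}\big)dt$, $\mathcal{A}^G=\mathcal{A}|_{\Lambda^G}$; coercive means $\mathcal{A}^G(x)\to\infty$ as the $H^1$-norm of $x\in\Lambda^G$ tends to infinity. A loop is collision-free if $x_i(t)\neq x_j(t)$ for all $t$ and $i\ne j$. A solution is a solution of Newton's equations. It is a choreography if the bodies follow one and the same closed curve with equal time shifts, i.e. up to relabeling the bodies $x_{i+1}(t)=x_i(t+T/n)$ (indices mod $n$). It is homographic if, identifying the plane with $\mathbb{C}$, $x(t)=s(t)x(0)$ for a $\mathbb{C}$-valued function $s$. *)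

theory Defs
  imports
    "HOL-Analysis.Analysis"
    "HOL-Library.Real_Mod"
    "HOL-Combinatorics.Permutations"
    "HOL-Number_Theory.Cong"
    "HOL-Algebra.Group_Action"
    "HOL-Algebra.Generated_Groups"
begin

section \<open>Groups and actions\<close>

text \<open>A quotient of the infinite dihedral group (free product of two groups of order 2), so for
  \<open>L \<ge> 2\<close> the order forces it to be \<open>D_L\<close> on its two standard reflections.\<close>

definition dihedral_group :: "nat \<Rightarrow> 'g monoid \<Rightarrow> 'g \<Rightarrow> 'g \<Rightarrow> bool" where
  "dihedral_group L G h1 h2 \<longleftrightarrow>
     group G \<and> order G = 2 * L \<and>
     h1 \<in> carrier G \<and> h2 \<in> carrier G \<and> generate G {h1, h2} = carrier G \<and>
     h1 \<otimes>\<^bsub>G\<^esub> h1 = \<one>\<^bsub>G\<^esub> \<and> h2 \<otimes>\<^bsub>G\<^esub> h2 = \<one>\<^bsub>G\<^esub> \<and>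
     (h1 \<otimes>\<^bsub>G\<^esub> h2) [^]\<^bsub>G\<^esub> L = \<one>\<^bsub>G\<^esub>"

text \<open>The Euclidean plane is the type \<^typ>\<open>complex\<close>, so \<open>orthogonal_group\<close> is \<open>O(2)\<close>.\<close>

definition orthogonal_group :: "(complex \<Rightarrow> complex) monoid" where
  "orthogonal_group =
     \<lparr>carrier = {f. orthogonal_transformation f}, mult = (\<circ>), one = id\<rparr>"

definition rotation :: "real \<Rightarrow> complex \<Rightarrow> complex" where
  "rotation \<theta> z = cis \<theta> * z"

definition reflection_along_line :: "complex \<Rightarrow> complex \<Rightarrow> complex" where
  "reflection_along_line u z = (2 * (z \<bullet> u)) *\<^sub>R u - z"

definition is_reflection :: "(complex \<Rightarrow> complex) \<Rightarrow> bool" where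
  "is_reflection f \<longleftrightarrow> (\<exists>u. norm u = 1 \<and> f = reflection_along_line u)"

section \<open>Loops\<close>

text \<open>A configuration is a function on indices, only the indices \<open>1, \<dots>, n\<close> being significant;
  the value \<open>0\<close> elsewhere makes the representation unique.\<close>

definition config_space :: "nat \<Rightarrow> (nat \<Rightarrow> complex) set" where
  "config_space n = {q. (\<forall>i. i \<notin> {1..n} \<longrightarrow> q i = 0) \<and> (\<Sum>i=1..n. q i) = 0}"

text \<open>Sobolev functions on an interval are identified with their continuous representatives.
  The weak derivative is only determined almost everywhere; every use below is under an
  integral.\<close>

definition has_L2_derivative :: "real \<Rightarrow> (real \<Rightarrow> complex) \<Rightarrow> (real \<Rightarrow> complex) \<Rightarrow> bool" where
  "has_L2_derivative T f v \<longleftrightarrow>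
     set_integrable lborel {0..T} v \<and>
     set_integrable lborel {0..T} (\<lambda>t. (norm (v t))\<^sup>2) \<and>
     (\<forall>t\<in>{0..T}. f t = f 0 + (LINT s:{0..t}|lborel. v s))"

definition weak_derivative :: "real \<Rightarrow> (real \<Rightarrow> complex) \<Rightarrow> real \<Rightarrow> complex" where
  "weak_derivative T f = (SOME v. has_L2_derivative T f v)"

text \<open>\<open>H\<^sup>1(T\<^sup>1, \<X>)\<close>, a loop on \<open>T\<^sup>1 = \<real>/T\<int>\<close> being a \<open>T\<close>-periodic function on the line.\<close>

definition loop_space :: "nat \<Rightarrow> real \<Rightarrow> (real \<Rightarrow> nat \<Rightarrow> complex) set" where
  "loop_space n T =
     {x. (\<forall>t. x t \<in> config_space n) \<and> (\<forall>t. x (t + T) = x t) \<and>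
         (\<forall>i\<in>{1..n}. \<exists>v. has_L2_derivative T (\<lambda>t. x t i) v)}"

definition H1_norm :: "nat \<Rightarrow> real \<Rightarrow> (real \<Rightarrow> nat \<Rightarrow> complex) \<Rightarrow> real" where
  "H1_norm n T x =
     sqrt (LINT t:{0..T}|lborel.
       (\<Sum>i=1..n. (norm (x t i))\<^sup>2 + (norm (weak_derivative T (\<lambda>s. x s i) t))\<^sup>2))"

text \<open>The action of \<open>G\<close> on time is an action \<open>\<tau>\<close> on the fundamental domain \<open>{0..<T}\<close> of \<open>T\<^sup>1\<close>,
  which is why time arguments are reduced modulo \<open>T\<close>.\<close>

definition loop_action ::
    "'g monoid \<Rightarrow> ('g \<Rightarrow> real \<Rightarrow> real) \<Rightarrow> ('g \<Rightarrow> complex \<Rightarrow> complex) \<Rightarrow> ('g \<Rightarrow> nat \<Rightarrow> nat) \<Rightarrow>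
     nat \<Rightarrow> real \<Rightarrow> 'g \<Rightarrow> (real \<Rightarrow> nat \<Rightarrow> complex) \<Rightarrow> real \<Rightarrow> nat \<Rightarrow> complex" where
  "loop_action G \<tau> \<rho> \<sigma> n T g x =
     (\<lambda>t i. if i \<in> {1..n}
            then \<rho> g (x (\<tau> (inv\<^bsub>G\<^esub> g) (t rmod T)) (inv_into {1..n} (\<sigma> g) i))
            else 0)"

definition invariant_loops ::
    "'g monoid \<Rightarrow> ('g \<Rightarrow> real \<Rightarrow> real) \<Rightarrow> ('g \<Rightarrow> complex \<Rightarrow> complex) \<Rightarrow> ('g \<Rightarrow> nat \<Rightarrow> nat) \<Rightarrow>
     nat \<Rightarrow> real \<Rightarrow> (real \<Rightarrow> nat \<Rightarrow> complex) set" where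
  "invariant_loops G \<tau> \<rho> \<sigma> n T =
     {x \<in> loop_space n T. \<forall>g\<in>carrier G. loop_action G \<tau> \<rho> \<sigma> n T g x = x}"

section \<open>The action functional\<close>

text \<open>The values are in \<^typ>\<open>ennreal\<close>, where \<open>c / 0 = \<infinity>\<close> for \<open>c > 0\<close>: the potential is infinite at
  collisions.\<close>

definition Lagrangian_action ::
    "nat \<Rightarrow> real \<Rightarrow> real \<Rightarrow> (real \<Rightarrow> nat \<Rightarrow> complex) \<Rightarrow> ennreal" where
  "Lagrangian_action n T \<mu> x =
     (\<integral>\<^sup>+t\<in>{0..T}.
        ((\<Sum>i=1..n. ennreal (\<mu> / 2 * (norm (weak_derivative T (\<lambda>s. x s i) t))\<^sup>2)) +
         (\<Sum>i=1..n. \<Sum>j=i+1..n. ennreal (\<mu>\<^sup>2) / ennreal (norm (x t i - x t j)))) \<partial>lborel)"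

definition coercive_on ::
    "nat \<Rightarrow> real \<Rightarrow> ((real \<Rightarrow> nat \<Rightarrow> complex) \<Rightarrow> ennreal) \<Rightarrow> (real \<Rightarrow> nat \<Rightarrow> complex) set \<Rightarrow> bool" where
  "coercive_on n T A S \<longleftrightarrow>
     (\<forall>M::real. \<exists>R. \<forall>x\<in>S. H1_norm n T x > R \<longrightarrow> A x > ennreal M)"

definition minimizer_on :: "('x \<Rightarrow> ennreal) \<Rightarrow> 'x set \<Rightarrow> 'x \<Rightarrow> bool" where
  "minimizer_on A S x \<longleftrightarrow> x \<in> S \<and> (\<forall>y\<in>S. A x \<le> A y)"

definition local_minimizer_on ::
    "nat \<Rightarrow> real \<Rightarrow> ((real \<Rightarrow> nat \<Rightarrow> complex) \<Rightarrow> ennreal) \<Rightarrow> (real \<Rightarrow> nat \<Rightarrow> complex) set \<Rightarrow>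
     (real \<Rightarrow> nat \<Rightarrow> complex) \<Rightarrow> bool" where
  "local_minimizer_on n T A S x \<longleftrightarrow>
     x \<in> S \<and> (\<exists>\<epsilon>>0. \<forall>y\<in>S. H1_norm n T (\<lambda>t i. y t i - x t i) < \<epsilon> \<longrightarrow> A x \<le> A y)"

section \<open>Motions of the bodies\<close>

definition collision_free :: "nat \<Rightarrow> (real \<Rightarrow> nat \<Rightarrow> complex) \<Rightarrow> bool" where
  "collision_free n x \<longleftrightarrow> (\<forall>t. \<forall>i\<in>{1..n}. \<forall>j\<in>{1..n}. i \<noteq> j \<longrightarrow> x t i \<noteq> x t j)"

text \<open>Because \<open>c / 0 = 0\<close> on the reals, the next definition is meaningful for collision-free
  motions only.\<close>

definition newton_solution :: "nat \<Rightarrow> real \<Rightarrow> (real \<Rightarrow> nat \<Rightarrow> complex) \<Rightarrow> bool" where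
  "newton_solution n \<mu> x \<longleftrightarrow>
     (\<exists>v a. \<forall>t. \<forall>i\<in>{1..n}.
        ((\<lambda>s. x s i) has_vector_derivative v t i) (at t) \<and>
        ((\<lambda>s. v s i) has_vector_derivative a t i) (at t) \<and>
        \<mu> *\<^sub>R a t i =
          (\<Sum>j\<in>{1..n} - {i}. (\<mu>\<^sup>2 / (norm (x t j - x t i)) ^ 3) *\<^sub>R (x t j - x t i)))"

definition choreography :: "nat \<Rightarrow> real \<Rightarrow> (real \<Rightarrow> nat \<Rightarrow> complex) \<Rightarrow> bool" where
  "choreography n T x \<longleftrightarrow>
     (\<exists>\<pi>. \<pi> permutes {1..n} \<and>
        (\<forall>i\<in>{1..n}. \<forall>t. x t (\<pi> (i mod n + 1)) = x (t + T / real n) (\<pi> i)))"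

definition homographic :: "nat \<Rightarrow> (real \<Rightarrow> nat \<Rightarrow> complex) \<Rightarrow> bool" where
  "homographic n x \<longleftrightarrow> (\<exists>s :: real \<Rightarrow> complex. \<forall>t. \<forall>i\<in>{1..n}. x t i = s t * x 0 i)"

end

theory Submission
  imports Defs "HOL-Complex_Analysis.Great_Picard"
begin

text \<open>Composing the two time reflections gives \<open>x\<^sub>i(t) = - R x\<^bsub>i+1\<^esub>(t + T/L)\<close> with \<open>R = \<rho>(h\<^sub>2)\<close>, and
  \<open>h\<^sub>1\<close> forces \<open>x\<^sub>n(0) = 0\<close>. Hence every body passes through the origin, so the kinetic energy controls
  the \<open>H\<^sup>1\<close> norm. The same relation gives the choreography (directly, or after squaring when \<open>R\<close> is a
  reflection, \<open>n\<close> being odd), and a homographic symmetric loop would have \<open>x\<^sub>n = 0\<close>, then \<open>x = 0\<close>.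

  A minimizing sequence has a uniform limit by Arzela-Ascoli. The kinetic energy is lower semicontinuous
  by the parallelogram law, the potential by Fatou's lemma.

  For Newton's equations, the forces along a minimizer \<open>x\<close> have mean zero by symmetry. Integrating them
  twice yields a symmetric loop \<open>z\<close> with the accelerations that \<open>x\<close> ought to have, and the first variation
  of the action at \<open>x\<close> in the direction \<open>x - z\<close> is \<open>\<mu> \<integral> |x' - z'|\<^sup>2\<close>.\<close>

section \<open>Square-integrable functions on an interval\<close>

text \<open>A minimizer is known only to have a weak derivative and to be minimal among symmetric
  loops, so it can neither be differentiated twice nor be compared with arbitrary loops. The
  direction \<open>x - z\<close> meets both obstacles. The loop \<open>z\<close> is symmetric
  because the forces are equivariant under the same reflections as \<open>x\<close>, and it is C^2
  by construction, so the forces can be integrated by parts against the weak derivative of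
  \<open>x - z\<close>. Regularity comes last: \<open>x - z\<close> has zero energy, hence is
  constant, and \<open>x\<close> inherits the two derivatives of \<open>z\<close>. Zero mean of the
  forces is exactly the condition for a periodic primitive; body \<open>n\<close> gets it from the
  half turn, the other bodies from the cyclic relation.

  For lower semicontinuity the obstacle is that the derivatives of a minimizing sequence need not
  converge, only the loops do. The limit derivative is therefore selected by a minimization of its
  own in L2.

  The group enters only through its two involutive generators, each giving one condition x_i(t) = A
  x_{s(i)}(a - t). Such conditions are linear and survive pointwise limits, which serves the
  variation and the compactness argument alike.\<close>

definition square_integrable :: "real \<Rightarrow> (real \<Rightarrow> complex) \<Rightarrow> bool" where
  "square_integrable T v \<longleftrightarrow>
     set_integrable lborel {0..T} v \<and> set_integrable lborel {0..T} (\<lambda>t. (norm (v t))\<^sup>2)"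

definition energy :: "real \<Rightarrow> (real \<Rightarrow> complex) \<Rightarrow> real" where
  "energy T v = (LINT t:{0..T}|lborel. (norm (v t))\<^sup>2)"

lemma has_L2_derivative_iff:
  "has_L2_derivative T f v \<longleftrightarrow>
     square_integrable T v \<and> (\<forall>t\<in>{0..T}. f t = f 0 + (LINT s:{0..t}|lborel. v s))"
  by (auto simp: has_L2_derivative_def square_integrable_def)

lemma set_integrable_norm_sq_bound:
  fixes f :: "real \<Rightarrow> complex"
  assumes "set_integrable lborel S f" "set_integrable lborel S g"
    and "\<And>t. t \<in> S \<Longrightarrow> (norm (f t))\<^sup>2 \<le> g t"
  shows "set_integrable lborel S (\<lambda>t. (norm (f t))\<^sup>2)"
  unfolding set_integrable_def
proof (rule Bochner_Integration.integrable_bound)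
  show "integrable lborel (\<lambda>t. indicator S t *\<^sub>R g t)"
    using assms(2) by (simp add: set_integrable_def)
  have [measurable]: "(\<lambda>t. indicator S t *\<^sub>R f t) \<in> borel_measurable lborel"
    using assms(1) unfolding set_integrable_def by (rule borel_measurable_integrable)
  have "(\<lambda>t. indicator S t *\<^sub>R (norm (f t))\<^sup>2) = (\<lambda>t. (norm (indicator S t *\<^sub>R f t))\<^sup>2)"
    by (auto simp: indicator_def)
  moreover have "(\<lambda>t. (norm (indicator S t *\<^sub>R f t))\<^sup>2) \<in> borel_measurable lborel"
    by measurable
  ultimately show "(\<lambda>t. indicator S t *\<^sub>R (norm (f t))\<^sup>2) \<in> borel_measurable lborel"
    by (simp only:)
  show "AE t in lborel. norm (indicator S t *\<^sub>R (norm (f t))\<^sup>2) \<le> norm (indicator S t *\<^sub>R g t)"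
    using assms(3) by (force simp: indicator_def)
qed

lemma norm_add_sq_le: "(norm (a + b :: complex))\<^sup>2 \<le> 2 * (norm a)\<^sup>2 + 2 * (norm b)\<^sup>2"
proof -
  have "(norm (a + b))\<^sup>2 \<le> (norm a + norm b)\<^sup>2"
    by (simp add: norm_triangle_ineq power_mono)
  also have "\<dots> \<le> 2 * (norm a)\<^sup>2 + 2 * (norm b)\<^sup>2"
    using zero_le_power2[of "norm a - norm b"] by (simp add: power2_eq_square algebra_simps)
  finally show ?thesis .
qed

lemma square_integrable_add:
  assumes "square_integrable T v" "square_integrable T w"
  shows "square_integrable T (\<lambda>t. v t + w t)"
proof -
  have "set_integrable lborel {0..T} (\<lambda>t. (norm (v t + w t))\<^sup>2)"
    by (rule set_integrable_norm_sq_bound[where g = "\<lambda>t. 2 * (norm (v t))\<^sup>2 + 2 * (norm (w t))\<^sup>2"])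
      (use assms norm_add_sq_le in \<open>auto simp: square_integrable_def intro!: set_integral_add\<close>)
  then show ?thesis using assms by (auto simp: square_integrable_def intro!: set_integral_add)
qed

lemma square_integrable_scaleR:
  assumes "square_integrable T v"
  shows "square_integrable T (\<lambda>t. c *\<^sub>R v t)"
  using assms by (auto simp: square_integrable_def power_mult_distrib)

lemma square_integrable_diff:
  assumes "square_integrable T v" "square_integrable T w"
  shows "square_integrable T (\<lambda>t. v t - w t)"
  using square_integrable_add[OF assms(1) square_integrable_scaleR[OF assms(2), of "-1"]] by simp

lemma square_integrable_continuous:
  assumes "continuous_on {0..T} v"
  shows "square_integrable T v"
  using assms by (auto simp: square_integrable_def intro!: borel_integrable_atLeastAtMost' continuous_intros)

text \<open>Polarization: the inner product is a combination of two squares whose integrability is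
  already known.\<close>

lemma square_integrable_inner:
  assumes "square_integrable T v" "square_integrable T w"
  shows "set_integrable lborel {0..T} (\<lambda>t. v t \<bullet> w t)"
proof -
  have "(\<lambda>t. v t \<bullet> w t) = (\<lambda>t. (1/4) * ((norm (v t + w t))\<^sup>2 - (norm (v t - w t))\<^sup>2))"
    by (auto simp: power2_norm_eq_inner inner_add inner_diff inner_commute)
  then show ?thesis
    using square_integrable_add[OF assms] square_integrable_diff[OF assms]
    by (auto simp: square_integrable_def)
qed

lemma energy_nonneg: "energy T v \<ge> 0"
  unfolding energy_def set_lebesgue_integral_def by (rule integral_nonneg_AE) (auto simp: indicator_def)

text \<open>The integrated parallelogram law: if two functions and their midpoint all have nearly
  the same energy, the two functions are close. This is the source of the Cauchy property in the
  semicontinuity theorem below.\<close>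

lemma energy_parallelogram:
  assumes "square_integrable T v" "square_integrable T w"
  shows "energy T (\<lambda>t. v t - w t) = 2 * energy T v + 2 * energy T w - 4 * energy T (\<lambda>t. (1/2) *\<^sub>R (v t + w t))"
proof -
  have *: "(norm (v t - w t))\<^sup>2 = 2 * (norm (v t))\<^sup>2 + 2 * (norm (w t))\<^sup>2 - 4 * (norm ((1/2) *\<^sub>R (v t + w t)))\<^sup>2" for t
    by (simp add: power_mult_distrib power2_norm_eq_inner inner_add inner_diff inner_commute field_simps del: norm_scaleR)
  have m: "square_integrable T (\<lambda>t. (1/2) *\<^sub>R (v t + w t))"
    by (intro square_integrable_scaleR square_integrable_add assms)
  show ?thesis
    unfolding energy_def *
    using assms m unfolding square_integrable_def
    by (subst set_integral_diff set_integral_add; auto simp del: norm_scaleR)+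
qed

lemma square_integrable_subset:
  assumes "square_integrable T v" "0 \<le> a" "b \<le> T"
  shows "set_integrable lborel {a..b} v" "set_integrable lborel {a..b} (\<lambda>t. (norm (v t))\<^sup>2)"
  using assms by (auto simp: square_integrable_def intro: set_integrable_subset)

lemma set_integral_inner_left:
  fixes v :: "real \<Rightarrow> complex"
  assumes "set_integrable lborel S v"
  shows "(LINT t:S|lborel. c \<bullet> v t) = c \<bullet> (LINT t:S|lborel. v t)"
    "set_integrable lborel S (\<lambda>t. c \<bullet> v t)"
proof -
  have *: "(\<lambda>t. indicator S t *\<^sub>R (c \<bullet> v t)) = (\<lambda>t. c \<bullet> (indicator S t *\<^sub>R v t))"
    by auto
  have "integrable lborel (\<lambda>t. indicator S t *\<^sub>R v t)"
    using assms by (simp add: set_integrable_def)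
  then show "(LINT t:S|lborel. c \<bullet> v t) = c \<bullet> (LINT t:S|lborel. v t)"
    "set_integrable lborel S (\<lambda>t. c \<bullet> v t)"
    unfolding set_lebesgue_integral_def set_integrable_def *
    by (rule integral_inner_right integrable_inner_right)+
qed

text \<open>Cauchy-Schwarz against the constant 1, obtained by expanding \<integral> |v - m|^2 \<ge>
  0 for the mean value \<open>m\<close> of \<open>v\<close>. It yields the Holder estimate for loops
  and the continuity of primitives with respect to the energy.\<close>

lemma norm_integral_sq_le:
  assumes v: "square_integrable T v" and ab: "0 \<le> a" "a \<le> b" "b \<le> T"
  shows "(norm (LINT t:{a..b}|lborel. v t))\<^sup>2 \<le> (b - a) * energy T v"
proof (cases "a = b")
  case True
  have "AE t in lborel. indicator {a..b} t *\<^sub>R v t = 0"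
    using AE_lborel_singleton[of b] by eventually_elim (simp add: True)
  then have "(LINT t:{a..b}|lborel. v t) = 0"
    unfolding set_lebesgue_integral_def by (rule integral_eq_zero_AE)
  then show ?thesis using True by simp
next
  case False
  define I where "I = (LINT t:{a..b}|lborel. v t)"
  define m where "m = (1 / (b - a)) *\<^sub>R I"
  note s = square_integrable_subset[OF v ab(1,3)]
  have c: "set_integrable lborel {a..b} (\<lambda>t. (norm m)\<^sup>2)"
    by (simp add: borel_integrable_atLeastAtMost')
  have "0 \<le> (LINT t:{a..b}|lborel. (norm (v t - m))\<^sup>2)"
    unfolding set_lebesgue_integral_def by (rule integral_nonneg_AE) (auto simp: indicator_def)
  also have "\<dots> = (LINT t:{a..b}|lborel. (norm (v t))\<^sup>2 - 2 * (m \<bullet> v t) + (norm m)\<^sup>2)"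
    by (intro arg_cong[where f = "set_lebesgue_integral lborel {a..b}"] ext)
      (simp add: power2_norm_eq_inner inner_diff inner_commute)
  also have "\<dots> = (LINT t:{a..b}|lborel. (norm (v t))\<^sup>2) - 2 * (m \<bullet> I) + (b - a) * (norm m)\<^sup>2"
    using s c set_integral_inner_left[OF s(1), of m] ab
    by (simp add: set_integral_add set_integral_diff I_def set_integral_const) 
  also have "2 * (m \<bullet> I) = 2 * (norm I)\<^sup>2 / (b - a)"
    by (simp add: m_def power2_norm_eq_inner)
  also have "(b - a) * (norm m)\<^sup>2 = (norm I)\<^sup>2 / (b - a)"
    using False ab by (simp add: m_def power_divide power2_eq_square)
  finally have "(norm I)\<^sup>2 / (b - a) \<le> (LINT t:{a..b}|lborel. (norm (v t))\<^sup>2)"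
    by (simp add: field_simps)
  also have "\<dots> \<le> energy T v"
    unfolding energy_def set_lebesgue_integral_def
    by (rule integral_mono) (use s(2) v ab in \<open>auto simp: square_integrable_def set_integrable_def indicator_def\<close>)
  finally show ?thesis
    using False ab by (simp add: I_def field_simps)
qed

section \<open>Completeness of L2 and energies of limits\<close>

lemma L1_sq_le_energy:
  assumes v: "square_integrable T v" and "0 \<le> T"
  shows "(LINT t:{0..T}|lborel. norm (v t))\<^sup>2 \<le> T * energy T v"
proof -
  have si: "set_integrable lborel {0..T} (\<lambda>t. norm (v t))"
    using v by (auto simp: square_integrable_def intro: set_integrable_norm)
  then have "square_integrable T (\<lambda>t. complex_of_real (norm (v t)))"
    using v by (simp add: square_integrable_def set_integrable_def scaleR_conv_of_real flip: of_real_mult)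
  from norm_integral_sq_le[OF this, of 0 T] assms(2) si
  have "(norm (LINT t:{0..T}|lborel. complex_of_real (norm (v t))))\<^sup>2 \<le> T * energy T v"
    by (simp add: energy_def)
  also have "(LINT t:{0..T}|lborel. complex_of_real (norm (v t))) = of_real (LINT t:{0..T}|lborel. norm (v t))"
    by (rule set_integral_complex_of_real)
  finally show ?thesis by simp
qed

text \<open>Riesz-Fischer: on a bounded interval a sequence that is Cauchy in energy is Cauchy in
  L1, so a subsequence converges almost everywhere. Fatou's lemma along that subsequence, with the
  other index fixed, then bounds the distance of every late term to the limit.\<close>

lemma square_integrable_complete:
  assumes T: "0 \<le> T" and w: "\<And>k. square_integrable T (w k)"
    and Cauchy: "\<And>e. e > 0 \<Longrightarrow> \<exists>N. \<forall>i\<ge>N. \<forall>j\<ge>N. energy T (\<lambda>t. w i t - w j t) < e"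
  shows "\<exists>u. square_integrable T u \<and> (\<lambda>k. energy T (\<lambda>t. w k t - u t)) \<longlonglongrightarrow> 0"
proof -
  define s where "s = (\<lambda>k t. indicator {0..T} t *\<^sub>R w k t)"
  have int_s: "integrable lborel (s k)" for k
    using w unfolding square_integrable_def set_integrable_def s_def by blast
  have [measurable]: "s k \<in> borel_measurable lborel" for k
    using int_s by (rule borel_measurable_integrable)
  have diff: "square_integrable T (\<lambda>t. w i t - w j t)" for i j
    by (intro square_integrable_diff w)
  have s_diff: "s i t - s j t = indicator {0..T} t *\<^sub>R (w i t - w j t)" for i j t
    by (simp add: s_def scaleR_right_diff_distrib)
  have "\<exists>N. \<forall>i\<ge>N. \<forall>j\<ge>N. (LINT t|lborel. norm (s i t - s j t)) < e" if "e > 0" for e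
  proof -
    \<comment> \<open>The denominator \<open>T + 1\<close> in place of \<open>T\<close> keeps the
      bound positive when \<open>T = 0\<close>.\<close>
    have "e\<^sup>2 / (T + 1) > 0" using that T by simp
    from Cauchy[OF this] obtain N where N: "\<forall>i\<ge>N. \<forall>j\<ge>N. energy T (\<lambda>t. w i t - w j t) < e\<^sup>2 / (T + 1)"
      by blast
    have "(LINT t|lborel. norm (s i t - s j t)) < e" if "i \<ge> N" "j \<ge> N" for i j
    proof -
      have eq: "(LINT t|lborel. norm (s i t - s j t)) = (LINT t:{0..T}|lborel. norm (w i t - w j t))"
        by (simp add: set_lebesgue_integral_def s_diff)
      have "(LINT t:{0..T}|lborel. norm (w i t - w j t))\<^sup>2 \<le> T * energy T (\<lambda>t. w i t - w j t)"
        by (rule L1_sq_le_energy[OF diff T])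
      moreover have "T * energy T (\<lambda>t. w i t - w j t) \<le> (T + 1) * energy T (\<lambda>t. w i t - w j t)"
        by (intro mult_right_mono energy_nonneg) simp
      moreover have "(T + 1) * energy T (\<lambda>t. w i t - w j t) < e\<^sup>2"
        using N that T by (simp add: field_simps)
      ultimately have "(LINT t|lborel. norm (s i t - s j t))\<^sup>2 < e\<^sup>2"
        unfolding eq by linarith
      then show ?thesis using \<open>e > 0\<close> by (simp add: power_less_imp_less_base)
    qed
    then show ?thesis by blast
  qed
  then obtain r where r: "strict_mono r" "AE t in lborel. Cauchy (\<lambda>i. s (r i) t)"
    using cauchy_L1_AE_cauchy_subseq[of lborel s, OF int_s] by blast
  define u where "u = (\<lambda>t. lim (\<lambda>i. s (r i) t))"
  have [measurable]: "u \<in> borel_measurable lborel"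
    unfolding u_def by (rule borel_measurable_lim_metric) measurable
  have conv: "AE t in lborel. (\<lambda>i. s (r i) t) \<longlonglongrightarrow> u t"
    using r(2) by eventually_elim (auto simp: u_def Cauchy_convergent_iff convergent_LIMSEQ_iff)
  have u_out: "u t = 0" if "t \<notin> {0..T}" for t
    using that by (simp add: u_def s_def)
  have fatou: "(\<integral>\<^sup>+t. ennreal ((norm (s i t - u t))\<^sup>2) \<partial>lborel) \<le> ennreal e"
    if e: "\<And>j. j \<ge> N \<Longrightarrow> energy T (\<lambda>t. w i t - w j t) \<le> e" for i N e
  proof -
    have "(\<integral>\<^sup>+t. ennreal ((norm (s i t - u t))\<^sup>2) \<partial>lborel)
        = (\<integral>\<^sup>+t. liminf (\<lambda>j. ennreal ((norm (s i t - s (r j) t))\<^sup>2)) \<partial>lborel)"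
    proof (rule nn_integral_cong_AE)
      show "AE t in lborel. ennreal ((norm (s i t - u t))\<^sup>2) = liminf (\<lambda>j. ennreal ((norm (s i t - s (r j) t))\<^sup>2))"
        using conv
      proof eventually_elim
        case (elim t)
        then have "(\<lambda>j. ennreal ((norm (s i t - s (r j) t))\<^sup>2)) \<longlonglongrightarrow> ennreal ((norm (s i t - u t))\<^sup>2)"
          by (intro tendsto_ennrealI tendsto_intros)
        then show ?case by (rule lim_imp_Liminf[symmetric, rotated]) simp
      qed
    qed
    also have "\<dots> \<le> liminf (\<lambda>j. \<integral>\<^sup>+t. ennreal ((norm (s i t - s (r j) t))\<^sup>2) \<partial>lborel)"
      by (rule nn_integral_liminf) measurable
    also have "\<dots> \<le> ennreal e"
    proof (rule Liminf_le)
      have "(\<integral>\<^sup>+t. ennreal ((norm (s i t - s (r j) t))\<^sup>2) \<partial>lborel) \<le> ennreal e" if "j \<ge> N" for j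
      proof -
        have "r j \<ge> N" using seq_suble[OF r(1), of j] that by simp
        have eq: "(norm (s i t - s (r j) t))\<^sup>2 = indicator {0..T} t *\<^sub>R (norm (w i t - w (r j) t))\<^sup>2" for t
          by (simp add: s_diff indicator_def)
        have "(\<integral>\<^sup>+t. ennreal ((norm (s i t - s (r j) t))\<^sup>2) \<partial>lborel) = ennreal (energy T (\<lambda>t. w i t - w (r j) t))"
          unfolding energy_def set_lebesgue_integral_def eq
          using diff[of i "r j"] unfolding square_integrable_def set_integrable_def
          by (intro nn_integral_eq_integral) auto
        then show ?thesis using e[OF \<open>r j \<ge> N\<close>] by (simp add: ennreal_leI)
      qed
      then show "\<forall>\<^sub>F j in sequentially. (\<integral>\<^sup>+t. ennreal ((norm (s i t - s (r j) t))\<^sup>2) \<partial>lborel) \<le> ennreal e"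
        unfolding eventually_sequentially by blast
    qed simp
    finally show ?thesis .
  qed
  have en_eq: "energy T (\<lambda>t. w i t - u t) = (LINT t|lborel. (norm (s i t - u t))\<^sup>2)" for i
    unfolding energy_def set_lebesgue_integral_def
    by (rule Bochner_Integration.integral_cong) (auto simp: s_def u_out indicator_def)
  have en_le: "integrable lborel (\<lambda>t. (norm (s i t - u t))\<^sup>2) \<and> energy T (\<lambda>t. w i t - u t) \<le> e"
    if "\<And>j. j \<ge> N \<Longrightarrow> energy T (\<lambda>t. w i t - w j t) \<le> e" "e \<ge> 0" for i N e
  proof -
    note f = fatou[of N i e, OF that(1)]
    have int: "integrable lborel (\<lambda>t. (norm (s i t - u t))\<^sup>2)"
      by (rule integrableI_bounded) (use le_less_trans[OF f ennreal_less_top] in simp_all)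
    have "ennreal (LINT t|lborel. (norm (s i t - u t))\<^sup>2) \<le> ennreal e"
      using f nn_integral_eq_integral[OF int] by simp
    then show ?thesis using int en_eq that(2) by simp
  qed
  have sq_u: "square_integrable T u"
  proof -
    from Cauchy[of 1] obtain N where N: "\<forall>i\<ge>N. \<forall>j\<ge>N. energy T (\<lambda>t. w i t - w j t) < 1" by auto
    then have "integrable lborel (\<lambda>t. (norm (s N t - u t))\<^sup>2)"
      using en_le[of N N 1] by (simp add: less_imp_le)
    moreover have "(norm (s N t - u t))\<^sup>2 = indicator {0..T} t *\<^sub>R (norm (w N t - u t))\<^sup>2" for t
      by (auto simp: s_def u_out indicator_def)
    ultimately have i2: "set_integrable lborel {0..T} (\<lambda>t. (norm (w N t - u t))\<^sup>2)"
      by (simp add: set_integrable_def)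
    have one: "set_integrable lborel {0..T} (\<lambda>t. 1::real)"
      by (simp add: borel_integrable_atLeastAtMost')
    have "set_integrable lborel {0..T} (\<lambda>t. w N t - u t)"
      unfolding set_integrable_def
    proof (rule Bochner_Integration.integrable_bound)
      show "integrable lborel (\<lambda>t. indicator {0..T} t *\<^sub>R (1 + (norm (w N t - u t))\<^sup>2))"
        using set_integral_add(1)[OF one i2] by (simp add: set_integrable_def)
      have "(\<lambda>t. indicator {0..T} t *\<^sub>R (w N t - u t)) = (\<lambda>t. s N t - u t)"
        by (auto simp: s_def u_out indicator_def)
      moreover have "(\<lambda>t. s N t - u t) \<in> borel_measurable lborel" by measurable
      ultimately show "(\<lambda>t. indicator {0..T} t *\<^sub>R (w N t - u t)) \<in> borel_measurable lborel" by simp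
      \<comment> \<open>On a bounded interval integrability of the square gives that of the
        function, through \<open>|z| \<le> 1 + |z|^2\<close>, a consequence of
        \<open>(|z| - 1)^2 \<ge> 0\<close>.\<close>
      have le: "norm z \<le> norm (1 + (norm z)\<^sup>2)" for z :: complex
      proof -
        have "0 \<le> (norm z)\<^sup>2 - 2 * norm z + 1"
          using zero_le_power2[of "norm z - 1"] by (simp add: power2_diff)
        moreover have "0 \<le> (norm z)\<^sup>2" by simp
        ultimately have "norm z \<le> 1 + (norm z)\<^sup>2" by linarith
        also have "\<dots> \<le> norm (1 + (norm z)\<^sup>2)" unfolding real_norm_def by (rule abs_ge_self)
        finally show ?thesis .
      qed
      have "norm (indicator {0..T} t *\<^sub>R (w N t - u t)) \<le> norm (indicator {0..T} t *\<^sub>R (1 + (norm (w N t - u t))\<^sup>2))" for t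
        using le[of "w N t - u t"] by (cases "t \<in> {0..T}") simp_all
      then show "AE t in lborel. norm (indicator {0..T} t *\<^sub>R (w N t - u t))
          \<le> norm (indicator {0..T} t *\<^sub>R (1 + (norm (w N t - u t))\<^sup>2))"
        by simp
    qed
    then have "square_integrable T (\<lambda>t. w N t - u t)"
      using i2 by (simp add: square_integrable_def)
    from square_integrable_diff[OF w[of N] this] show ?thesis by simp
  qed
  have "(\<lambda>k. energy T (\<lambda>t. w k t - u t)) \<longlonglongrightarrow> 0"
  proof (rule LIMSEQ_I)
    fix e :: real assume "e > 0"
    then obtain N where N: "\<forall>i\<ge>N. \<forall>j\<ge>N. energy T (\<lambda>t. w i t - w j t) < e / 2"
      using Cauchy[of "e / 2"] by auto
    have "norm (energy T (\<lambda>t. w k t - u t) - 0) < e" if "k \<ge> N" for k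
    proof -
      have "energy T (\<lambda>t. w k t - u t) \<le> e / 2"
        using en_le[of N k "e / 2"] N that \<open>e > 0\<close> by (simp add: less_imp_le)
      then show ?thesis using \<open>e > 0\<close> energy_nonneg[of T "\<lambda>t. w k t - u t"] by simp
    qed
    then show "\<exists>N. \<forall>k\<ge>N. norm (energy T (\<lambda>t. w k t - u t) - 0) < e" by blast
  qed
  with sq_u show ?thesis by blast
qed

text \<open>A weighted Young inequality, |u|^2 \<le> (1 + a)|w|^2 + (1 + 1/a)|w - u|^2, separates
  two limits: for fixed \<open>a\<close> the error term vanishes as the index grows, and only
  afterwards does \<open>a\<close> tend to 0.\<close>

lemma energy_le_limit:
  assumes w: "\<And>k. square_integrable T (w k)" and u: "square_integrable T u"
    and lim: "(\<lambda>k. energy T (\<lambda>t. w k t - u t)) \<longlonglongrightarrow> 0"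
    and le: "\<And>k. energy T (w k) \<le> c k" and c: "c \<longlonglongrightarrow> l"
  shows "energy T u \<le> l"
proof -
  define e where "e = (\<lambda>k. energy T (\<lambda>t. w k t - u t))"
  have bound: "energy T u \<le> (1 + a) * c k + (1 + 1 / a) * e k" if a: "a > 0" for a k
  proof -
    have d: "square_integrable T (\<lambda>t. w k t - u t)" by (intro square_integrable_diff w u)
    have pt: "(norm (u t))\<^sup>2 \<le> (1 + a) * (norm (w k t))\<^sup>2 + (1 + 1 / a) * (norm (w k t - u t))\<^sup>2" for t
    proof -
      have "norm (u t) \<le> norm (w k t) + norm (w k t - u t)"
        using norm_triangle_ineq4[of "w k t" "w k t - u t"] by simp
      then have "(norm (u t))\<^sup>2 \<le> (norm (w k t) + norm (w k t - u t))\<^sup>2"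
        by (simp add: power_mono)
      then have A: "(norm (u t))\<^sup>2 \<le> (norm (w k t))\<^sup>2 + (norm (w k t - u t))\<^sup>2 + 2 * norm (w k t) * norm (w k t - u t)"
        by (simp only: power2_sum)
      have "(a * x - y)\<^sup>2 / a = a * x\<^sup>2 - 2 * x * y + (1 / a) * y\<^sup>2" for x y :: real
        using a by (simp add: power2_eq_square field_simps)
      moreover have "0 \<le> (a * x - y)\<^sup>2 / a" for x y :: real using a by simp
      ultimately have "0 \<le> a * x\<^sup>2 - 2 * x * y + (1 / a) * y\<^sup>2" for x y :: real by metis
      from this[of "norm (w k t)" "norm (w k t - u t)"] A show ?thesis
        unfolding distrib_right by linarith
    qed
    have "energy T u \<le> (LINT t:{0..T}|lborel. (1 + a) * (norm (w k t))\<^sup>2 + (1 + 1 / a) * (norm (w k t - u t))\<^sup>2)"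
      unfolding energy_def
      by (rule set_integral_mono) (use u w d pt in \<open>auto simp: square_integrable_def intro!: set_integral_add\<close>)
    also have "\<dots> = (1 + a) * energy T (w k) + (1 + 1 / a) * e k"
      unfolding energy_def e_def
      by (subst set_integral_add) (use u w d in \<open>auto simp: square_integrable_def\<close>)
    also have "\<dots> \<le> (1 + a) * c k + (1 + 1 / a) * e k"
      using le[of k] a by (intro add_right_mono mult_left_mono) auto
    finally show ?thesis .
  qed
  have bound2: "energy T u \<le> (1 + a) * l" if a: "a > 0" for a
  proof -
    have "(\<lambda>k. (1 + a) * c k + (1 + 1 / a) * e k) \<longlonglongrightarrow> (1 + a) * l + (1 + 1 / a) * 0"
      using lim unfolding e_def by (intro tendsto_intros c)
    then show ?thesis using LIMSEQ_le_const[of _ _ "energy T u"] bound[OF a] by auto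
  qed
  have "((\<lambda>a. (1 + a) * l) \<longlongrightarrow> (1 + 0) * l) (at_right 0)" by (intro tendsto_intros)
  then have "energy T u \<le> (1 + 0) * l"
    by (rule tendsto_lowerbound) (auto intro!: eventually_at_rightI[of 0 1] bound2)
  then show ?thesis by simp
qed

section \<open>Weak derivatives\<close>

lemma L2_derivative_square_integrable: "has_L2_derivative T f v \<Longrightarrow> square_integrable T v"
  by (simp add: has_L2_derivative_iff)

lemma L2_derivative_eq:
  "has_L2_derivative T f v \<Longrightarrow> t \<in> {0..T} \<Longrightarrow> f t = f 0 + (LINT s:{0..t}|lborel. v s)"
  by (simp only: has_L2_derivative_iff Ball_def)

lemma L2_derivative_diff:
  assumes f: "has_L2_derivative T f v" and ab: "0 \<le> a" "a \<le> b" "b \<le> T"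
  shows "f b - f a = (LINT t:{a..b}|lborel. v t)"
proof -
  have v: "square_integrable T v" using f by (rule L2_derivative_square_integrable)
  have i: "v integrable_on {0..b}"
    "(LINT t:{0..b}|lborel. v t) = integral {0..b} v"
    "(LINT t:{0..a}|lborel. v t) = integral {0..a} v"
    "(LINT t:{a..b}|lborel. v t) = integral {a..b} v"
    using v ab by (auto intro!: set_borel_integral_eq_integral square_integrable_subset)
  have "f b = f 0 + integral {0..b} v" "f a = f 0 + integral {0..a} v"
    unfolding i(2,3)[symmetric] using L2_derivative_eq[OF f, of a] L2_derivative_eq[OF f, of b] ab by auto
  then have "f b - f a = integral {0..b} v - integral {0..a} v" by simp
  also have "\<dots> = integral {a..b} v"
    using Henstock_Kurzweil_Integration.integral_combine[OF ab(1,2) i(1)] by (metis add_diff_cancel_left')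
  finally show ?thesis by (simp only: i)
qed

text \<open>Loops in H^1 are Holder continuous with exponent 1/2, with a constant that depends only
  on the energy; this gives equicontinuity along a minimizing sequence.\<close>

lemma L2_derivative_Holder:
  assumes f: "has_L2_derivative T f v" and ab: "0 \<le> a" "a \<le> b" "b \<le> T"
  shows "(norm (f b - f a))\<^sup>2 \<le> (b - a) * energy T v"
  using norm_integral_sq_le[OF L2_derivative_square_integrable[OF f] ab]
  by (simp only: L2_derivative_diff[OF assms])

lemma L2_derivative_Holder':
  assumes f: "has_L2_derivative T f v" and "a \<in> {0..T}" "b \<in> {0..T}"
  shows "(norm (f b - f a))\<^sup>2 \<le> \<bar>b - a\<bar> * energy T v"
  using L2_derivative_Holder[OF f, of a b] L2_derivative_Holder[OF f, of b a] assms(2,3)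
  by (cases "a \<le> b") (auto simp: norm_minus_commute)

lemma L2_derivative_continuous:
  assumes "has_L2_derivative T f v"
  shows "continuous_on {0..T} f"
proof -
  have v: "square_integrable T v" using assms by (rule L2_derivative_square_integrable)
  then have "v integrable_on {0..T}"
    by (intro set_borel_integral_eq_integral) (simp add: square_integrable_def)
  then have "continuous_on {0..T} (\<lambda>t. f 0 + integral {0..t} v)"
    by (intro continuous_intros indefinite_integral_continuous_1)
  moreover have "f 0 + integral {0..t} v = f t" if "t \<in> {0..T}" for t
    using L2_derivative_eq[OF assms that] square_integrable_subset(1)[OF v, of 0 t] that
      set_borel_integral_eq_integral(2)[of "{0..t}" v] by simp
  ultimately show ?thesis
    by (rule continuous_on_eq)
qed

lemma L2_derivative_energy_zero:
  assumes f: "has_L2_derivative T f v" and "energy T v \<le> 0" "t \<in> {0..T}"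
  shows "f t = f 0"
proof -
  have "(norm (f t - f 0))\<^sup>2 \<le> t * energy T v"
    using L2_derivative_Holder[OF f, of 0 t] assms(3) by simp
  also have "\<dots> \<le> 0" using assms(2,3) by (simp add: mult_nonneg_nonpos)
  finally show ?thesis by simp
qed

lemma has_L2_derivative_add:
  assumes "has_L2_derivative T f v" "has_L2_derivative T g w"
  shows "has_L2_derivative T (\<lambda>t. f t + c *\<^sub>R g t) (\<lambda>t. v t + c *\<^sub>R w t)"
proof -
  have v: "square_integrable T v" and w: "square_integrable T w"
    using assms by (auto intro: L2_derivative_square_integrable)
  have "f t + c *\<^sub>R g t = f 0 + c *\<^sub>R g 0 + (LINT s:{0..t}|lborel. v s + c *\<^sub>R w s)" if "t \<in> {0..T}" for t
  proof -
    have "set_integrable lborel {0..t} v" "set_integrable lborel {0..t} w"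
      using that v w by (auto intro: square_integrable_subset)
    then have "(LINT s:{0..t}|lborel. v s + c *\<^sub>R w s) = (LINT s:{0..t}|lborel. v s) + c *\<^sub>R (LINT s:{0..t}|lborel. w s)"
      by (simp add: set_integral_add)
    moreover have "f t = f 0 + (LINT s:{0..t}|lborel. v s)" "g t = g 0 + (LINT s:{0..t}|lborel. w s)"
      using assms that by (auto intro: L2_derivative_eq)
    ultimately show ?thesis by (simp add: scaleR_add_right)
  qed
  moreover have "square_integrable T (\<lambda>t. v t + c *\<^sub>R w t)"
    by (intro square_integrable_add square_integrable_scaleR v w)
  ultimately show ?thesis unfolding has_L2_derivative_iff by blast
qed

lemma has_L2_derivative_C1:
  assumes f: "\<And>t. (f has_vector_derivative g t) (at t)" and g: "continuous_on UNIV g"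
  shows "has_L2_derivative T f g"
proof -
  have "(LINT s:{0..t}|lborel. g s) = f t - f 0" if "0 \<le> t" for t
    unfolding set_lebesgue_integral_def
    by (rule integral_FTC_atLeastAtMost[OF that])
      (auto intro!: has_vector_derivative_at_within f continuous_on_subset[OF g])
  moreover have "square_integrable T g"
    by (intro square_integrable_continuous continuous_on_subset[OF g]) simp
  ultimately show ?thesis
    by (simp add: has_L2_derivative_iff)
qed

text \<open>The difference of two weak derivatives, extended by zero, has integral zero over every
  half-line. Half-lines form an intersection-stable generator of the Borel sets, so by a Dynkin
  argument its integrals over all Borel sets vanish, and a density of the zero measure is zero
  almost everywhere.\<close>

lemma L2_derivative_unique:
  assumes f: "has_L2_derivative T f v" "has_L2_derivative T f w"
  shows "AE t in lborel. t \<in> {0..T} \<longrightarrow> v t = w t"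
proof (cases "0 \<le> T")
  case T: True
  define u where "u = (\<lambda>t. v t - w t)"
  define g where "g = (\<lambda>t. indicator {0..T} t *\<^sub>R u t)"
  have u: "square_integrable T u"
    unfolding u_def by (intro square_integrable_diff f[THEN L2_derivative_square_integrable])
  have g_int: "integrable lborel g"
    using u by (simp add: g_def square_integrable_def set_integrable_def)
  have u0: "(LINT s:{0..t}|lborel. u s) = 0" if "t \<in> {0..T}" for t
  proof -
    have "set_integrable lborel {0..t} v" "set_integrable lborel {0..t} w"
      using that f[THEN L2_derivative_square_integrable] by (auto intro: square_integrable_subset)
    then have "(LINT s:{0..t}|lborel. u s) = (LINT s:{0..t}|lborel. v s) - (LINT s:{0..t}|lborel. w s)"
      by (simp add: u_def)
    then show ?thesis using f[THEN L2_derivative_eq, OF that] by simp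
  qed
  have gA: "set_lebesgue_integral lborel {..a} g = 0" for a
  proof (cases "a < 0")
    case True
    then have "(\<lambda>t. indicator {..a} t *\<^sub>R g t) = (\<lambda>t. 0)"
      by (auto simp: g_def indicator_def)
    then show ?thesis by (simp add: set_lebesgue_integral_def)
  next
    case False
    then have "(\<lambda>t. indicator {..a} t *\<^sub>R g t) = (\<lambda>t. indicator {0..min a T} t *\<^sub>R u t)"
      by (auto simp: g_def indicator_def)
    then show ?thesis using u0[of "min a T"] False T by (simp add: set_lebesgue_integral_def)
  qed
  have gU: "integral\<^sup>L lborel g = 0"
    using u0[of T] T by (simp add: g_def set_lebesgue_integral_def)
  have zero: "set_lebesgue_integral lborel A g = 0" if "A \<in> sets lborel" for A
  proof -
    have "Int_stable (range (\<lambda>a::real. {..a}))" "range (\<lambda>a::real. {..a}) \<subseteq> Pow UNIV"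
      "A \<in> sigma_sets UNIV (range (\<lambda>a::real. {..a}))"
      using that by (auto simp: borel_eq_atMost Int_stable_def)
    then show ?thesis
    proof (induction rule: sigma_sets_induct_disjoint)
      case (basic A) then show ?case using gA by auto
    next
      case (compl A)
      then have A: "A \<in> sets lborel" by (simp add: borel_eq_atMost)
      have "(LINT t|lborel. indicator (UNIV - A) t *\<^sub>R g t) = (LINT t|lborel. g t - indicator A t *\<^sub>R g t)"
        by (rule Bochner_Integration.integral_cong) (auto simp: indicator_def)
      also have "\<dots> = 0"
        using compl gU A g_int integrable_mult_indicator[OF A g_int]
        by (simp add: set_lebesgue_integral_def)
      finally show ?case by (simp add: set_lebesgue_integral_def)
    next
      case (union A)
      then have A: "A i \<in> sets lborel" for i by (auto simp: borel_eq_atMost)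
      have "set_integrable lborel (\<Union>i. A i) g"
        unfolding set_integrable_def using A by (intro integrable_mult_indicator g_int) auto
      then have "set_lebesgue_integral lborel (\<Union>i. A i) g = (\<Sum>i. set_lebesgue_integral lborel (A i) g)"
        using A union(1) by (intro lebesgue_integral_countable_add) (auto simp: disjoint_family_on_def)
      then show ?case using union by simp
    qed (simp add: set_lebesgue_integral_def)
  qed
  have "AE t in lborel. g t = 0"
    by (rule sigma_finite_measure.density_zero[OF lborel.sigma_finite_measure_axioms g_int zero])
  then show ?thesis
    by eventually_elim (auto simp: g_def u_def)
qed auto

text \<open>The sets \<open>C N\<close> of candidate derivatives are convex and decreasing, and the minimal energies
  \<open>m N\<close> on them converge; by the parallelogram law almost minimal elements form a Cauchy sequence.\<close>

theorem L2_derivative_lower_semicontinuous: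
  assumes T: "0 \<le> T" and fk: "\<And>k. has_L2_derivative T (f k) (v k)"
    and le: "\<And>k. energy T (v k) \<le> c"
    and lim: "uniform_limit {0..T} f g sequentially"
  shows "\<exists>w. has_L2_derivative T g w \<and> energy T w \<le> c"
proof -
  define P where "P = (\<lambda>(v :: real \<Rightarrow> complex) t. LINT s:{0..t}|lborel. v s)"
  define C where "C = (\<lambda>N. {v. square_integrable T v \<and>
    (\<forall>t\<in>{0..T}. norm (P v t - (g t - g 0)) \<le> 1 / real (Suc N))})"
  define m where "m = (\<lambda>N. Inf (energy T ` C N))"
  have sq: "square_integrable T (v k)" for k
    using fk by (rule L2_derivative_square_integrable)
  have bdd: "bdd_below (energy T ` C N)" for N
    using energy_nonneg by (auto intro!: bdd_belowI)
  have C_ex: "\<exists>k. v k \<in> C N" for N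
  proof -
    define d where "d = 1 / real (Suc N)"
    \<comment> \<open>Half the tolerance, because the increment over \<open>[0,t]\<close> inherits
      the error at \<open>t\<close> and the error at \<open>0\<close>.\<close>
    have "d / 2 > 0" by (simp add: d_def)
    then have "\<forall>\<^sub>F k in sequentially. \<forall>t\<in>{0..T}. dist (f k t) (g t) < d / 2"
      using lim unfolding uniform_limit_iff by blast
    then obtain k where k: "\<And>t. t \<in> {0..T} \<Longrightarrow> dist (f k t) (g t) < d / 2"
      unfolding eventually_sequentially by blast
    have "norm (P (v k) t - (g t - g 0)) \<le> 1 / real (Suc N)" if t: "t \<in> {0..T}" for t
    proof -
      have "P (v k) t - (g t - g 0) = (f k t - g t) - (f k 0 - g 0)"
        using L2_derivative_eq[OF fk t, of k] by (simp add: P_def)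
      then have "norm (P (v k) t - (g t - g 0)) \<le> norm (f k t - g t) + norm (f k 0 - g 0)"
        by (metis norm_triangle_ineq4)
      then show ?thesis using k[OF t, unfolded dist_norm] k[of 0, unfolded dist_norm] T unfolding d_def[symmetric] by simp
    qed
    then show ?thesis using sq unfolding C_def by blast
  qed
  have C_mono: "C M \<subseteq> C N" if "N \<le> M" for M N
  proof -
    have "1 / real (Suc M) \<le> 1 / real (Suc N)" using that by (simp add: frac_le)
    then show ?thesis unfolding C_def by (auto simp del: of_nat_Suc intro: order_trans)
  qed
  have m_le: "m N \<le> energy T u" if "u \<in> C N" for u N
    unfolding m_def using that bdd by (auto intro: cInf_lower)
  have m_mono: "m N \<le> m M" if "N \<le> M" for M N
    unfolding m_def using C_ex C_mono[OF that] bdd by (intro cInf_superset_mono) auto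
  have m_c: "m N \<le> c" for N
    using C_ex[of N] m_le le order_trans by blast
  have "incseq m" using m_mono by (auto simp: incseq_def)
  then obtain l where l: "m \<longlonglongrightarrow> l" 
    using incseq_convergent[of m c] m_c by blast
  have "\<exists>u. u \<in> C N \<and> energy T u < m N + 1 / real (Suc N)" for N
  proof -
    have "Inf (energy T ` C N) < m N + 1 / real (Suc N)" by (simp add: m_def)
    then show ?thesis
      using C_ex[of N] bdd by (subst (asm) cInf_less_iff) auto
  qed
  then obtain w where wC: "\<And>N. w N \<in> C N" and wE: "\<And>N. energy T (w N) < m N + 1 / real (Suc N)"
    by metis
  have wsq: "square_integrable T (w N)" for N using wC by (simp add: C_def)
  have mid: "(\<lambda>t. (1/2) *\<^sub>R (u t + u' t)) \<in> C N" if "u \<in> C N" "u' \<in> C N" for u u' N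
  proof -
    have su: "square_integrable T u" "square_integrable T u'" using that by (auto simp: C_def)
    have "norm (P (\<lambda>t. (1/2) *\<^sub>R (u t + u' t)) t - (g t - g 0)) \<le> 1 / real (Suc N)" if t: "t \<in> {0..T}" for t
    proof -
      have "set_integrable lborel {0..t} u" "set_integrable lborel {0..t} u'"
        using su t by (auto intro: square_integrable_subset)
      then have Pm: "P (\<lambda>t. (1/2) *\<^sub>R (u t + u' t)) t = (1/2) *\<^sub>R (P u t + P u' t)"
        unfolding P_def set_integral_scaleR_right by (simp add: set_integral_add)
      have "P (\<lambda>t. (1/2) *\<^sub>R (u t + u' t)) t - (g t - g 0) =
          (1/2) *\<^sub>R (P u t - (g t - g 0)) + (1/2) *\<^sub>R (P u' t - (g t - g 0))"
        unfolding Pm by (simp add: scaleR_conv_of_real field_simps)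
      then have "norm (P (\<lambda>t. (1/2) *\<^sub>R (u t + u' t)) t - (g t - g 0)) \<le>
          (1/2) * norm (P u t - (g t - g 0)) + (1/2) * norm (P u' t - (g t - g 0))"
        using norm_triangle_ineq[of "(1/2) *\<^sub>R (P u t - (g t - g 0))" "(1/2) *\<^sub>R (P u' t - (g t - g 0))"]
        by simp
      moreover have "norm (P u t - (g t - g 0)) \<le> 1 / real (Suc N)" "norm (P u' t - (g t - g 0)) \<le> 1 / real (Suc N)"
        using \<open>u \<in> C N\<close> \<open>u' \<in> C N\<close> t by (auto simp: C_def)
      ultimately show ?thesis by linarith
    qed
    then show ?thesis
      using su by (auto simp: C_def intro!: square_integrable_scaleR square_integrable_add)
  qed
  \<comment> \<open>The midpoint stays in \<open>C N\<close>, so its energy is at least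
    \<open>m N\<close>; each of \<open>w i\<close> and \<open>w j\<close> has energy at most
    \<open>l + 1 / (N + 1)\<close>. The parallelogram law turns this into the stated gap.\<close>
  have near: "energy T (\<lambda>t. w i t - w j t) \<le> 4 * (l - m N) + 4 / real (Suc N)"
    if "N \<le> i" "N \<le> j" for i j N
  proof -
    have "w i \<in> C N" "w j \<in> C N" using wC C_mono that by blast+
    then have "m N \<le> energy T (\<lambda>t. (1/2) *\<^sub>R (w i t + w j t))" by (intro m_le mid)
    moreover have "m i \<le> l" "m j \<le> l" using incseq_le[OF \<open>incseq m\<close> l] by auto
    moreover have "1 / real (Suc i) \<le> 1 / real (Suc N)" "1 / real (Suc j) \<le> 1 / real (Suc N)"
      using that by (auto simp: frac_le)
    ultimately show ?thesis
      using wE[of i] wE[of j] unfolding energy_parallelogram[OF wsq wsq] by argo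
  qed
  have "(\<lambda>N. 4 * (l - m N) + 4 * (1 / real (Suc N))) \<longlonglongrightarrow> 4 * (l - l) + 4 * 0"
    by (intro tendsto_intros l lim_1_over_n LIMSEQ_Suc[OF lim_1_over_n])
  then have near0: "(\<lambda>N. 4 * (l - m N) + 4 / real (Suc N)) \<longlonglongrightarrow> 0" by simp
  have "\<exists>N. \<forall>i\<ge>N. \<forall>j\<ge>N. energy T (\<lambda>t. w i t - w j t) < e" if "e > 0" for e
    using order_tendstoD(2)[OF near0 that] near unfolding eventually_sequentially
    by (meson le_less_trans order_refl)
  from square_integrable_complete[OF T wsq this] obtain u where
    u: "square_integrable T u" "(\<lambda>k. energy T (\<lambda>t. w k t - u t)) \<longlonglongrightarrow> 0" by blast
  have "energy T u \<le> c"
  proof -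
    have "energy T (w k) \<le> c + 1 / real (Suc k)" for k
      using wE[of k] m_c[of k] by linarith
    moreover have "(\<lambda>k. c + 1 / real (Suc k)) \<longlonglongrightarrow> c + 0"
      by (intro tendsto_intros LIMSEQ_Suc[OF lim_1_over_n])
    ultimately show ?thesis
      using energy_le_limit[OF wsq u, of "\<lambda>k. c + 1 / real (Suc k)" c] by simp
  qed
  \<comment> \<open>Two limits of the same primitives: closeness in energy leads to the primitive of
    \<open>u\<close>, membership in \<open>C k\<close> leads to the increment of
    \<open>g\<close>.\<close>
  moreover have "g t = g 0 + P u t" if t: "t \<in> {0..T}" for t
  proof -
    have "(\<lambda>k. P (w k) t) \<longlonglongrightarrow> P u t"
    proof (rule Lim_null[THEN iffD2], rule Lim_null_comparison)
      have eq: "P (w k) t - P u t = (LINT s:{0..t}|lborel. w k s - u s)" for k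
        using square_integrable_subset(1)[OF wsq, of 0 t] square_integrable_subset(1)[OF u(1), of 0 t] t
        by (simp add: P_def)
      have "norm (P (w k) t - P u t) \<le> sqrt (t * energy T (\<lambda>t. w k t - u t))" for k
        unfolding eq using norm_integral_sq_le[OF square_integrable_diff[OF wsq u(1)], of 0 t k] t
        by (intro real_le_rsqrt) auto
      then show "\<forall>\<^sub>F k in sequentially. norm (P (w k) t - P u t) \<le> sqrt (t * energy T (\<lambda>t. w k t - u t))"
        by simp
      have "(\<lambda>k. sqrt (t * energy T (\<lambda>t. w k t - u t))) \<longlonglongrightarrow> sqrt (t * 0)"
        by (intro tendsto_intros u(2))
      then show "(\<lambda>k. sqrt (t * energy T (\<lambda>t. w k t - u t))) \<longlonglongrightarrow> 0" by simp
    qed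
    moreover have "(\<lambda>k. P (w k) t) \<longlonglongrightarrow> g t - g 0"
    proof (rule Lim_null[THEN iffD2], rule Lim_null_comparison)
      show "\<forall>\<^sub>F k in sequentially. norm (P (w k) t - (g t - g 0)) \<le> 1 / real (Suc k)"
        using wC t by (simp add: C_def)
      show "(\<lambda>k. 1 / real (Suc k)) \<longlonglongrightarrow> 0" by (rule LIMSEQ_Suc[OF lim_1_over_n])
    qed
    ultimately show ?thesis using LIMSEQ_unique by fastforce
  qed
  ultimately show ?thesis
    using u(1) unfolding has_L2_derivative_iff P_def by blast
qed

section \<open>Periodic functions\<close>

text \<open>Since \<open>w\<close> is merely square integrable, \<open>h\<close> need not have a
  pointwise derivative to which a product rule could apply. Instead Fubini's theorem is applied to
  the kernel f(t) \<bullet> w(s) on the triangle s \<le> t: one order of integration produces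
  increments of \<open>h\<close>, the other increments of \<open>q\<close>. Periodicity of
  \<open>q\<close> and of \<open>h\<close> removes the boundary terms.\<close>

lemma L2_derivative_by_parts:
  assumes T: "0 \<le> T" and h: "has_L2_derivative T h w" "h 0 = h T"
    and q: "\<And>t. (q has_vector_derivative f t) (at t)" and f: "continuous_on UNIV f" and qT: "q 0 = q T"
  shows "(LINT t:{0..T}|lborel. f t \<bullet> h t) = - (LINT t:{0..T}|lborel. q t \<bullet> w t)"
proof -
  define F where "F = (\<lambda>t. indicator {0..T} t *\<^sub>R f t)"
  define W where "W = (\<lambda>t. indicator {0..T} t *\<^sub>R w t)"
  define K where "K = (\<lambda>t s. indicator {..t} s *\<^sub>R (F t \<bullet> W s))"
  have w: "square_integrable T w" using h(1) by (rule L2_derivative_square_integrable)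
  have fsq: "square_integrable T f"
    by (intro square_integrable_continuous continuous_on_subset[OF f]) simp
  have F_int: "integrable lborel F" using fsq by (simp add: F_def square_integrable_def set_integrable_def)
  have W_int: "integrable lborel W" using w by (simp add: W_def square_integrable_def set_integrable_def)
  have [measurable]: "F \<in> borel_measurable lborel" "W \<in> borel_measurable lborel"
    using F_int W_int by auto
  have K_meas [measurable]: "(\<lambda>(t, s). K t s) \<in> borel_measurable (lborel \<Otimes>\<^sub>M lborel)"
  proof -
    have "(\<lambda>(t, s). K t s) = (\<lambda>p. if snd p \<le> fst p then F (fst p) \<bullet> W (snd p) else 0)"
      by (auto simp: K_def indicator_def)
    moreover have "(\<lambda>p. if snd p \<le> fst p then F (fst p) \<bullet> W (snd p) else 0) \<in> borel_measurable (lborel \<Otimes>\<^sub>M lborel)"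
      by measurable
    ultimately show ?thesis by simp
  qed
  have K_bound: "norm (K t s) \<le> norm (F t) * norm (W s)" for t s
    by (auto simp: K_def indicator_def Cauchy_Schwarz_ineq2)
  have K_int1: "integrable lborel (\<lambda>s. K t s)" for t
  proof (rule Bochner_Integration.integrable_bound)
    show "integrable lborel (\<lambda>s. norm (F t) * norm (W s))" using W_int by simp
    show "K t \<in> borel_measurable lborel" unfolding K_def by measurable
    show "AE s in lborel. norm (K t s) \<le> norm (norm (F t) * norm (W s))" using K_bound by simp
  qed
  have "integrable (lborel \<Otimes>\<^sub>M lborel) (\<lambda>(t, s). K t s)"
  proof (rule lborel_pair.Fubini_integrable)
    show "integrable lborel (\<lambda>t. LINT s|lborel. norm (case (t, s) of (t, s) \<Rightarrow> K t s))"
    proof (rule Bochner_Integration.integrable_bound)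
      show "integrable lborel (\<lambda>t. norm (F t) * (LINT s|lborel. norm (W s)))" using F_int by simp
      show "(\<lambda>t. LINT s|lborel. norm (case (t, s) of (t, s) \<Rightarrow> K t s)) \<in> borel_measurable lborel"
        by measurable
      have "(LINT s|lborel. norm (K t s)) \<le> (LINT s|lborel. norm (F t) * norm (W s))" for t
        using K_int1[of t] W_int K_bound by (intro integral_mono) auto
      moreover have "0 \<le> (LINT s|lborel. norm (K t s))" for t
        by simp
      ultimately show "AE t in lborel. norm (LINT s|lborel. norm (case (t, s) of (t, s) \<Rightarrow> K t s))
          \<le> norm (norm (F t) * (LINT s|lborel. norm (W s)))"
        by (auto simp: abs_of_nonneg)
    qed
  qed (use K_int1 in auto)
  then have Fub: "(LINT s|lborel. LINT t|lborel. K t s) = (LINT t|lborel. LINT s|lborel. K t s)"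
    by (rule lborel_pair.Fubini_integral)
  have in1: "(LINT s|lborel. K t s) = indicator {0..T} t *\<^sub>R (f t \<bullet> (h t - h 0))" for t
  proof (cases "t \<in> {0..T}")
    case True
    have i: "integrable lborel (\<lambda>s. indicator {0..t} s *\<^sub>R w s)"
      using square_integrable_subset(1)[OF w, of 0 t] True by (simp add: set_integrable_def)
    have "(LINT s|lborel. K t s) = (LINT s|lborel. f t \<bullet> (indicator {0..t} s *\<^sub>R w s))"
      using True by (intro Bochner_Integration.integral_cong) (auto simp: K_def F_def W_def indicator_def)
    also have "\<dots> = f t \<bullet> (LINT s:{0..t}|lborel. w s)"
      unfolding set_lebesgue_integral_def using i by (rule integral_inner_right)
    also have "(LINT s:{0..t}|lborel. w s) = h t - h 0"
      using L2_derivative_eq[OF h(1) True] by simp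
    finally show ?thesis using True by simp
  next
    case False
    then show ?thesis by (simp add: K_def F_def)
  qed
  have in2: "(LINT t|lborel. K t s) = indicator {0..T} s *\<^sub>R ((q T - q s) \<bullet> w s)" for s
  proof (cases "s \<in> {0..T}")
    case True
    have "set_integrable lborel {s..T} f"
      by (intro borel_integrable_atLeastAtMost' continuous_on_subset[OF f]) simp
    then have i: "integrable lborel (\<lambda>t. indicator {s..T} t *\<^sub>R f t)"
      by (simp add: set_integrable_def)
    have "(LINT t|lborel. K t s) = (LINT t|lborel. (indicator {s..T} t *\<^sub>R f t) \<bullet> w s)"
      using True by (intro Bochner_Integration.integral_cong) (auto simp: K_def F_def W_def indicator_def)
    also have "\<dots> = (LINT t|lborel. indicator {s..T} t *\<^sub>R f t) \<bullet> w s"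
      using i by (rule integral_inner_left)
    also have "(LINT t|lborel. indicator {s..T} t *\<^sub>R f t) = q T - q s"
      using True by (intro integral_FTC_atLeastAtMost has_vector_derivative_at_within[OF q] continuous_on_subset[OF f]) auto
    finally show ?thesis using True by simp
  next
    case False
    then show ?thesis by (simp add: K_def W_def)
  qed
  have q_cont: "continuous_on S q" for S
    using q by (meson continuous_at_imp_continuous_on has_vector_derivative_continuous)
  have qsq: "square_integrable T q" by (intro square_integrable_continuous q_cont)
  have hc: "continuous_on {0..T} h" using h(1) by (rule L2_derivative_continuous)
  have fc: "continuous_on {0..T} f" using f by (rule continuous_on_subset) simp
  have s1: "set_integrable lborel {0..T} (\<lambda>t. f t \<bullet> h t)" "set_integrable lborel {0..T} (\<lambda>t. f t \<bullet> h 0)"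
    by (auto intro!: borel_integrable_atLeastAtMost' continuous_intros hc fc)
  have s2: "set_integrable lborel {0..T} (\<lambda>t. q T \<bullet> w t)" "set_integrable lborel {0..T} (\<lambda>t. q t \<bullet> w t)"
    using set_integral_inner_left(2)[of "{0..T}" w "q T"] square_integrable_subset(1)[OF w, of 0 T]
      square_integrable_inner[OF qsq w] by auto
  have "(LINT t:{0..T}|lborel. f t \<bullet> (h t - h 0)) = (LINT s:{0..T}|lborel. (q T - q s) \<bullet> w s)"
    using Fub unfolding in1 in2 set_lebesgue_integral_def by simp
  moreover have "(LINT t:{0..T}|lborel. f t \<bullet> (h t - h 0)) = (LINT t:{0..T}|lborel. f t \<bullet> h t)"
  proof -
    have "(LINT t:{0..T}|lborel. f t \<bullet> h 0) = (LINT t:{0..T}|lborel. f t) \<bullet> h 0"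
      using set_integral_inner_left(1)[of "{0..T}" f "h 0"] square_integrable_subset(1)[OF fsq, of 0 T]
      by (simp add: inner_commute)
    also have "(LINT t:{0..T}|lborel. f t) = q T - q 0"
      unfolding set_lebesgue_integral_def
      using T by (intro integral_FTC_atLeastAtMost has_vector_derivative_at_within[OF q] fc) auto
    finally show ?thesis
      using s1 qT by (simp add: inner_diff_right set_integral_diff)
  qed
  moreover have "(LINT s:{0..T}|lborel. (q T - q s) \<bullet> w s) = - (LINT t:{0..T}|lborel. q t \<bullet> w t)"
  proof -
    have "(LINT t:{0..T}|lborel. q T \<bullet> w t) = q T \<bullet> (LINT t:{0..T}|lborel. w t)"
      using square_integrable_subset(1)[OF w, of 0 T] by (simp add: set_integral_inner_left)
    also have "(LINT t:{0..T}|lborel. w t) = h T - h 0"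
      using L2_derivative_eq[OF h(1), of T] T by simp
    finally show ?thesis
      using s2 h(2) by (simp add: inner_diff_left set_integral_diff)
  qed
  ultimately show ?thesis by simp
qed

section \<open>Primitives and uniqueness for periodic functions\<close>

lemma vector_derivative_zero_constant:
  assumes "\<And>t. (f has_vector_derivative 0) (at (t::real))"
  shows "f a = f b"
  using has_vector_derivative_zero_constant[of UNIV f] assms by (metis UNIV_I convex_UNIV)

lemma vector_derivative_shift:
  assumes "\<And>t. (f has_vector_derivative g t) (at t)"
  shows "((\<lambda>t. f (t + T)) has_vector_derivative g (t + T)) (at (t::real))"
proof -
  have "((\<lambda>t. t + T) has_vector_derivative 1) (at t)"
    by (auto intro!: derivative_eq_intros)
  from vector_diff_chain_at[OF this assms] show ?thesis by (simp add: o_def)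
qed

lemma vector_derivative_reflect:
  assumes "\<And>t. (f has_vector_derivative g t) (at t)"
  shows "((\<lambda>t. f (a - t)) has_vector_derivative - g (a - t)) (at (t::real))"
proof -
  have "((\<lambda>t. a - t) has_vector_derivative - 1) (at t)"
    by (auto intro!: derivative_eq_intros)
  from vector_diff_chain_at[OF this assms] show ?thesis by (simp add: o_def)
qed

lemma antiderivative_exists:
  fixes f :: "real \<Rightarrow> complex"
  assumes "continuous_on UNIV f"
  shows "\<exists>F. \<forall>t. (F has_vector_derivative f t) (at t)"
  using einterval_antiderivative[of "-\<infinity>" "\<infinity>" f] assms
  by (auto simp: continuous_on_eq_continuous_at)

lemma integral_eq_antiderivative:
  fixes F :: "real \<Rightarrow> complex"
  assumes "\<And>t. (F has_vector_derivative f t) (at t)" "0 \<le> T"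
  shows "integral {0..T} f = F T - F 0"
  by (rule integral_unique, rule fundamental_theorem_of_calculus)
    (use assms in \<open>simp_all add: has_vector_derivative_at_within\<close>)

text \<open>Substitution via a primitive \<open>F\<close>: the increment F(t + T) - F(t) is
  constant, so every interval of length \<open>T\<close> gives the same integral.\<close>

lemma integral_periodic_reflect:
  fixes f :: "real \<Rightarrow> complex"
  assumes T: "0 \<le> T" and f: "continuous_on UNIV f" "\<And>t. f (t + T) = f t"
  shows "integral {0..T} (\<lambda>t. f (a - t)) = integral {0..T} f"
proof -
  obtain F where F: "\<And>t. (F has_vector_derivative f t) (at t)"
    using antiderivative_exists[OF f(1)] by blast
  have "((\<lambda>t. F (t + T) - F t) has_vector_derivative 0) (at t)" for t
    using has_vector_derivative_diff[OF vector_derivative_shift[OF F, of T] F] f(2) by simp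
  from vector_derivative_zero_constant[OF this, of "a - T" 0]
  have "F a - F (a - T) = F T - F 0" by simp
  moreover have "((\<lambda>t. - F (a - t)) has_vector_derivative f (a - t)) (at t)" for t
    using has_vector_derivative_minus[OF vector_derivative_reflect[OF F, of a t]] by simp
  from integral_eq_antiderivative[OF this T] have "integral {0..T} (\<lambda>t. f (a - t)) = F a - F (a - T)"
    by simp
  ultimately show ?thesis using integral_eq_antiderivative[OF F T] by simp
qed

text \<open>Subtracting the mean value from the primitive makes the lemma applicable to its own
  result, so the forces can be integrated twice.\<close>

lemma periodic_primitive_exists:
  fixes f :: "real \<Rightarrow> complex"
  assumes T: "0 < T" and f: "continuous_on UNIV f" "\<And>t. f (t + T) = f t" "integral {0..T} f = 0"
  shows "\<exists>p. (\<forall>t. (p has_vector_derivative f t) (at t)) \<and> (\<forall>t. p (t + T) = p t) \<and> integral {0..T} p = 0"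
proof -
  obtain F where F: "\<And>t. (F has_vector_derivative f t) (at t)"
    using antiderivative_exists[OF f(1)] by blast
  have "((\<lambda>t. F (t + T) - F t) has_vector_derivative 0) (at t)" for t
    using has_vector_derivative_diff[OF vector_derivative_shift[OF F, of T] F] f(2) by simp
  from vector_derivative_zero_constant[OF this]
  have per: "F (t + T) = F t" for t
    using integral_eq_antiderivative[OF F] T f(3) by (metis add_0 diff_eq_eq eq_iff_diff_eq_0 less_imp_le)
  define c where "c = (1 / T) *\<^sub>R integral {0..T} F"
  have "continuous_on {0..T} F"
    using F by (meson continuous_at_imp_continuous_on has_vector_derivative_continuous)
  then have "integral {0..T} (\<lambda>t. F t - c) = integral {0..T} F - integral {0..T} (\<lambda>t. c)"
    by (intro Henstock_Kurzweil_Integration.integral_diff integrable_continuous_real) auto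
  also have "\<dots> = 0" using T by (simp add: c_def)
  finally have "integral {0..T} (\<lambda>t. F t - c) = 0" .
  moreover have "((\<lambda>t. F t - c) has_vector_derivative f t) (at t)" for t
    using has_vector_derivative_diff[OF F has_vector_derivative_const[of c]] by simp
  ultimately show ?thesis using per by (intro exI[of _ "\<lambda>t. F t - c"]) simp
qed

lemma vector_derivative_continuous:
  fixes f :: "real \<Rightarrow> 'a::real_normed_vector"
  assumes "\<And>t. (f has_vector_derivative g t) (at t)"
  shows "continuous_on S f"
  using assms by (meson continuous_at_imp_continuous_on has_vector_derivative_continuous)

text \<open>Vanishing second derivative makes \<open>D\<close> affine, periodicity removes the slope
  and the mean removes the constant. It serves as a uniqueness principle: an identity between
  periodic functions of mean zero may be checked on their accelerations.\<close>

lemma periodic_second_derivative_zero: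
  fixes D :: "real \<Rightarrow> complex"
  assumes T: "0 < T" and D: "\<And>t. (D has_vector_derivative E t) (at t)"
    and E: "\<And>t. (E has_vector_derivative 0) (at t)"
    and per: "\<And>t. D (t + T) = D t" and mean: "integral {0..T} D = 0"
  shows "D t = 0"
proof -
  have E0: "E t = E 0" for t using vector_derivative_zero_constant[OF E] .
  have "((\<lambda>t. D t - t *\<^sub>R E 0) has_vector_derivative 0) (at t)" for t
  proof -
    have "((\<lambda>t. t *\<^sub>R E 0) has_vector_derivative E 0) (at t)"
      by (auto intro!: derivative_eq_intros)
    from has_vector_derivative_diff[OF D this] show ?thesis using E0[of t] by simp
  qed
  from vector_derivative_zero_constant[OF this] have lin: "D t - t *\<^sub>R E 0 = D 0" for t
    by (metis diff_zero scaleR_zero_left)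
  have "D T = D 0" using per[of 0] by simp
  then have "E 0 = 0" using lin[of T] T by simp
  then have const: "D t = D 0" for t using lin[of t] by simp
  have "integral {0..T} D = integral {0..T} (\<lambda>t. D 0)"
    using const by (intro arg_cong[where f = "integral {0..T}"] ext)
  then have "D 0 = 0" using mean T by simp
  then show ?thesis using const by simp
qed

lemma periodic_int_shift:
  fixes f :: "real \<Rightarrow> 'a"
  assumes per: "\<And>t. f (t + T) = f t"
  shows "f (t + of_int k * T) = f t"
proof -
  have per_nat: "f (t + real k * T) = f t" for t k
  proof (induction k)
    case (Suc k)
    have "f (t + real (Suc k) * T) = f ((t + real k * T) + T)" by (simp add: algebra_simps)
    then show ?case using Suc per by simp
  qed simp
  show ?thesis
  proof (cases "k \<ge> 0")
    case True then show ?thesis using per_nat[of t "nat k"] by simp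
  next
    case False
    then show ?thesis using per_nat[of "t + of_int k * T" "nat (-k)"] by simp
  qed
qed

text \<open>At \<open>0\<close> and \<open>T\<close> the hypothesis gives only one-sided continuity.
  Gluing a copy shifted by one period makes all of \<open>[0,T)\<close> interior, and a shift by
  \<open>floor (t / T)\<close> periods carries any other time there.\<close>

lemma periodic_continuous:
  fixes f :: "real \<Rightarrow> 'a::topological_space"
  assumes T: "0 < T" and f: "continuous_on {0..T} f" and per: "\<And>t. f (t + T) = f t"
  shows "continuous_on UNIV f"
proof -
  have "continuous_on {-T..0} (\<lambda>t. f (t + T))"
    by (rule continuous_on_compose2[OF f]) (auto intro: continuous_intros)
  then have "continuous_on {-T..0} f" using per by simp
  then have "continuous_on ({-T..0} \<union> {0..T}) f"
    using f by (intro continuous_on_closed_Un) auto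
  moreover have "{-T..0} \<union> {0..T} = {-T..T}" using T by auto
  ultimately have c: "continuous_on {-T..T} f" by simp
  have iso: "isCont f t" if "0 \<le> t" "t < T" for t
    using c that T by (intro continuous_on_interior) auto
  have "isCont f t" for t
  proof -
    define k where "k = \<lfloor>t / T\<rfloor>"
    have "isCont f (t - of_int k * T)"
    proof (rule iso)
      show "0 \<le> t - of_int k * T" using T floor_divide_lower[OF T, of t] by (simp add: k_def)
      show "t - of_int k * T < T" using T floor_divide_upper[OF T, of t] by (simp add: k_def algebra_simps)
    qed
    then have "isCont (\<lambda>s. f (s - of_int k * T)) t"
      by (rule isCont_o2[rotated]) (auto intro: continuous_intros)
    moreover have "(\<lambda>s. f (s - of_int k * T)) = f"
      using periodic_int_shift[of f T _ "-k"] per by auto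
    ultimately show ?thesis by simp
  qed
  then show ?thesis by (simp add: continuous_on_eq_continuous_at)
qed

section \<open>The action and its first variation\<close>

definition potential :: "nat \<Rightarrow> real \<Rightarrow> (nat \<Rightarrow> complex) \<Rightarrow> real" where
  "potential n \<mu> q = (\<Sum>i=1..n. \<Sum>j=i+1..n. \<mu>\<^sup>2 / norm (q i - q j))"

text \<open>The potential as it stands in the action, infinite at collisions; the real-valued
  version silently drops colliding pairs because \<open>c / 0 = 0\<close>.\<close>

definition ennreal_potential :: "nat \<Rightarrow> real \<Rightarrow> (nat \<Rightarrow> complex) \<Rightarrow> ennreal" where
  "ennreal_potential n \<mu> q = (\<Sum>i=1..n. \<Sum>j=i+1..n. ennreal (\<mu>\<^sup>2) / ennreal (norm (q i - q j)))"

definition force :: "nat \<Rightarrow> real \<Rightarrow> (nat \<Rightarrow> complex) \<Rightarrow> nat \<Rightarrow> complex" where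
  "force n \<mu> q i = (\<Sum>j\<in>{1..n} - {i}. (\<mu>\<^sup>2 / (norm (q j - q i)) ^ 3) *\<^sub>R (q j - q i))"

lemma ennreal_potential_eq:
  assumes "\<And>i j. i \<in> {1..n} \<Longrightarrow> j \<in> {1..n} \<Longrightarrow> i \<noteq> j \<Longrightarrow> q i \<noteq> q j"
  shows "ennreal_potential n \<mu> q = ennreal (potential n \<mu> q)"
proof -
  have "ennreal (\<mu>\<^sup>2) / ennreal (norm (q i - q j)) = ennreal (\<mu>\<^sup>2 / norm (q i - q j))"
    if "i \<in> {1..n}" "j \<in> {i+1..n}" for i j
    using assms[of i j] that by (intro divide_ennreal) auto
  then have "ennreal_potential n \<mu> q = (\<Sum>i=1..n. \<Sum>j=i+1..n. ennreal (\<mu>\<^sup>2 / norm (q i - q j)))"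
    unfolding ennreal_potential_def by (intro sum.cong refl) auto
  then show ?thesis
    by (simp add: potential_def sum_ennreal sum_nonneg)
qed

lemma sum_off_diagonal:
  fixes G :: "nat \<Rightarrow> nat \<Rightarrow> 'a::comm_monoid_add"
  shows "(\<Sum>i=1..n. \<Sum>j\<in>{1..n} - {i}. G i j) = (\<Sum>i=1..n. \<Sum>j=i+1..n. G i j + G j i)"
proof -
  have "(\<Sum>j\<in>{1..n} - {i}. G i j) = (\<Sum>j | j \<in> {1..n} \<and> i < j. G i j) + (\<Sum>j | j \<in> {1..n} \<and> j < i. G i j)" for i
    by (subst sum.union_disjoint[symmetric]) (auto intro!: sum.cong)
  then have "(\<Sum>i=1..n. \<Sum>j\<in>{1..n} - {i}. G i j) =
      (\<Sum>i=1..n. \<Sum>j | j \<in> {1..n} \<and> i < j. G i j) + (\<Sum>i=1..n. \<Sum>j | j \<in> {1..n} \<and> j < i. G i j)"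
    by (simp add: sum.distrib)
  also have "(\<Sum>i=1..n. \<Sum>j | j \<in> {1..n} \<and> j < i. G i j) = (\<Sum>j=1..n. \<Sum>i | i \<in> {1..n} \<and> j < i. G i j)"
    by (rule sum.swap_restrict) auto
  also have "(\<Sum>i=1..n. \<Sum>j | j \<in> {1..n} \<and> i < j. G i j) + \<dots> =
      (\<Sum>i=1..n. \<Sum>j | j \<in> {1..n} \<and> i < j. G i j + G j i)"
    by (simp add: sum.distrib)
  also have "\<dots> = (\<Sum>i=1..n. \<Sum>j=i+1..n. G i j + G j i)"
    by (intro sum.cong refl) auto
  finally show ?thesis .
qed

text \<open>The right-hand side is the derivative of the potential in the direction
  \<open>h\<close>: the forces are its gradient. Grouping the ordered pairs (i,j) and (j,i) turns
  \<open>h i\<close> into the difference \<open>h i - h j\<close>.\<close>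

lemma sum_force_inner:
  "(\<Sum>i=1..n. force n \<mu> q i \<bullet> h i) =
     - (\<Sum>i=1..n. \<Sum>j=i+1..n. \<mu>\<^sup>2 * ((q i - q j) \<bullet> (h i - h j)) / (norm (q i - q j)) ^ 3)"
proof -
  define G where "G = (\<lambda>i j. \<mu>\<^sup>2 / (norm (q j - q i)) ^ 3 * ((q j - q i) \<bullet> h i))"
  have Gs: "G i j + G j i = - (\<mu>\<^sup>2 * ((q i - q j) \<bullet> (h i - h j)) / (norm (q i - q j)) ^ 3)" for i j
  proof -
    define K where "K = \<mu>\<^sup>2 / (norm (q i - q j)) ^ 3"
    have KX: "\<mu>\<^sup>2 * X / (norm (q i - q j)) ^ 3 = K * X" for X by (simp add: K_def)
    show ?thesis
      unfolding G_def norm_minus_commute[of "q j" "q i"] K_def[symmetric] KX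
      by (simp add: inner_diff algebra_simps)
  qed
  have "(\<Sum>i=1..n. force n \<mu> q i \<bullet> h i) = (\<Sum>i=1..n. \<Sum>j\<in>{1..n} - {i}. G i j)"
    by (simp add: force_def G_def inner_sum_left)
  also have "\<dots> = (\<Sum>i=1..n. \<Sum>j=i+1..n. G i j + G j i)"
    by (rule sum_off_diagonal)
  finally show ?thesis by (simp only: Gs sum_negf)
qed

lemma sum_force: "(\<Sum>i=1..n. force n \<mu> q i) = 0"
proof -
  have "(\<Sum>i=1..n. force n \<mu> q i) = (\<Sum>i=1..n. \<Sum>j=i+1..n.
      (\<mu>\<^sup>2 / (norm (q j - q i)) ^ 3) *\<^sub>R (q j - q i) + (\<mu>\<^sup>2 / (norm (q i - q j)) ^ 3) *\<^sub>R (q i - q j))"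
    unfolding force_def by (rule sum_off_diagonal)
  also have "\<dots> = 0"
    by (intro sum.neutral ballI) (simp add: norm_minus_commute flip: scaleR_add_right)
  finally show ?thesis .
qed

text \<open>A second-order Taylor estimate from above. With r = |a| and u = |a - s b| / r, the
  smallness assumption gives u \<ge> 1/2, where 1/u is bounded by a quadratic polynomial in u^2 - 1
  = d / r^2. Since |d| \<le> (5/2) s |b| r, the quadratic term is at most 2 (25/4) = 12.5 times s^2
  |b|^2 / r^3, rounded up to 13; the second-order part of the linear term has a favourable sign and
  is dropped.\<close>

lemma inverse_distance_upper:
  fixes a b :: complex
  assumes a: "a \<noteq> 0" and s: "0 \<le> s" "s * norm b \<le> norm a / 2"
  shows "1 / norm (a - s *\<^sub>R b) \<le> 1 / norm a + s * (a \<bullet> b) / (norm a) ^ 3 + 13 * s\<^sup>2 * (norm b)\<^sup>2 / (norm a) ^ 3"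
proof -
  define r where "r = norm a"
  define u where "u = norm (a - s *\<^sub>R b) / r"
  have r: "r > 0" using a by (simp add: r_def)
  have "r / 2 \<le> norm (a - s *\<^sub>R b)"
    using norm_triangle_ineq2[of a "s *\<^sub>R b"] s by (simp add: r_def)
  then have u: "u \<ge> 1/2" using r by (simp add: u_def field_simps)
  \<comment> \<open>Multiplied by \<open>2 u\<close>, the right-hand side minus the left is
    \<open>(u - 1)^2 (4 u (u + 1)^2 - (u + 2))\<close>.\<close>
  have poly: "1 / u \<le> 1 - (u\<^sup>2 - 1) / 2 + 2 * (u\<^sup>2 - 1)\<^sup>2"
  proof -
    have "u * u \<ge> 1/2 * (1/2)" using u by (intro mult_mono) auto
    then have "u + 2 \<le> 8 * (u * u) + 4 * u" using u by simp
    also have "\<dots> \<le> 4 * u * (u + 1)\<^sup>2"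
      using u by (simp add: power2_eq_square algebra_simps)
    finally have "(u - 1)\<^sup>2 * (u + 2) \<le> (u - 1)\<^sup>2 * (4 * u * (u + 1)\<^sup>2)"
      by (rule mult_left_mono) simp
    then show ?thesis using u by (simp add: field_simps power2_eq_square)
  qed
  define d where "d = s\<^sup>2 * (norm b)\<^sup>2 - 2 * s * (a \<bullet> b)"
  have "(norm (a - s *\<^sub>R b))\<^sup>2 = r\<^sup>2 + d"
    unfolding d_def r_def power2_norm_eq_inner by (simp add: inner_diff inner_commute power2_eq_square)
  then have ud: "u\<^sup>2 - 1 = d / r\<^sup>2" using r by (simp add: u_def power_divide field_simps)
  have "\<bar>d\<bar> \<le> s\<^sup>2 * (norm b)\<^sup>2 + 2 * s * (r * norm b)"
  proof -
    have "\<bar>2 * s * (a \<bullet> b)\<bar> \<le> 2 * s * (r * norm b)"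
      using s Cauchy_Schwarz_ineq2[of a b] by (simp add: abs_mult r_def mult_left_mono)
    moreover have "\<bar>s\<^sup>2 * (norm b)\<^sup>2\<bar> = s\<^sup>2 * (norm b)\<^sup>2" by simp
    ultimately show ?thesis unfolding d_def by linarith
  qed
  also have "\<dots> = (s * norm b) * (s * norm b + 2 * r)"
    by (simp add: power2_eq_square algebra_simps)
  also have "\<dots> \<le> (s * norm b) * (r / 2 + 2 * r)"
    using s by (intro mult_left_mono) (auto simp: r_def)
  finally have "\<bar>d\<bar> \<le> (5/2) * (s * norm b) * r" by simp
  then have "d\<^sup>2 \<le> ((5/2) * (s * norm b) * r)\<^sup>2"
    using s r by (subst power2_le_iff_abs_le) auto
  also have "\<dots> = 25/4 * (s\<^sup>2 * (norm b)\<^sup>2 * r\<^sup>2)"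
    by (simp add: power_mult_distrib power_divide)
  finally have "d\<^sup>2 \<le> 25/4 * (s\<^sup>2 * (norm b)\<^sup>2 * r\<^sup>2)" .
  moreover have "0 \<le> s\<^sup>2 * (norm b)\<^sup>2 * r\<^sup>2" by simp
  ultimately have d2: "2 * d\<^sup>2 \<le> 13 * s\<^sup>2 * (norm b)\<^sup>2 * r\<^sup>2"
    unfolding mult.assoc by linarith
  have "1 / norm (a - s *\<^sub>R b) = (1 / u) / r" using r by (simp add: u_def)
  also have "\<dots> \<le> (1 - d / r\<^sup>2 / 2 + 2 * (d / r\<^sup>2)\<^sup>2) / r"
    using poly r unfolding ud by (intro divide_right_mono) auto
  also have "\<dots> = 1 / r - d / (2 * r ^ 3) + 2 * d\<^sup>2 / r ^ 5"
    using r by (simp add: field_simps power2_eq_square eval_nat_numeral)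
  also have "\<dots> \<le> 1 / r + s * (a \<bullet> b) / r ^ 3 + 13 * s\<^sup>2 * (norm b)\<^sup>2 * r\<^sup>2 / r ^ 5"
  proof -
    have "2 * d\<^sup>2 / r ^ 5 \<le> 13 * s\<^sup>2 * (norm b)\<^sup>2 * r\<^sup>2 / r ^ 5"
      using d2 r by (intro divide_right_mono) auto
    moreover have "- (s * (a \<bullet> b) / r ^ 3) \<le> d / (2 * r ^ 3)"
      using r by (simp add: d_def field_simps)
    ultimately show ?thesis by linarith
  qed
  also have "13 * s\<^sup>2 * (norm b)\<^sup>2 * r\<^sup>2 / r ^ 5 = 13 * s\<^sup>2 * (norm b)\<^sup>2 / r ^ 3"
    using r by (simp add: field_simps eval_nat_numeral)
  finally show ?thesis by (simp add: r_def)
qed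

text \<open>\<open>weak_derivative\<close> is a choice; by uniqueness almost everywhere any
  available derivative yields the same action, so explicit ones may be used. The measurability
  statement is what Fatou's lemma and the splitting of the integral ask for.\<close>

lemma action_eq:
  assumes \<mu>: "\<mu> > 0" and x: "\<And>i. i \<in> {1..n} \<Longrightarrow> has_L2_derivative T (\<lambda>t. x t i) (v i)"
  shows "Lagrangian_action n T \<mu> x =
    (\<Sum>i=1..n. ennreal (\<mu> / 2 * energy T (v i))) + (\<integral>\<^sup>+t\<in>{0..T}. ennreal_potential n \<mu> (x t) \<partial>lborel)"
    "(\<lambda>t. ennreal_potential n \<mu> (x t) * indicator {0..T} t) \<in> borel_measurable lborel"
proof -
  \<comment> \<open>Truncation to \<open>[0,T]\<close>: \<open>x\<close> is known to be continuous
    only there, while measurability is required on the whole line.\<close>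
  define xx where "xx = (\<lambda>i t. indicator {0..T} t *\<^sub>R x t i)"
  have xm [measurable]: "xx i \<in> borel_measurable lborel" if "i \<in> {1..n}" for i
    using borel_measurable_continuous_on_indicator[OF _ L2_derivative_continuous[OF x[OF that]]]
    by (simp add: xx_def)
  define d where "d = (\<lambda>t. \<Sum>i=1..n. \<Sum>j=i+1..n. ennreal (\<mu>\<^sup>2) / ennreal (norm (xx i t - xx j t)))"
  have dm: "d \<in> borel_measurable lborel"
    unfolding d_def
  proof (intro borel_measurable_sum)
    fix i j assume "i \<in> {1..n}" "j \<in> {i+1..n}"
    then have [measurable]: "xx i \<in> borel_measurable lborel" "xx j \<in> borel_measurable lborel"
      by (auto intro: xm)
    show "(\<lambda>t. ennreal (\<mu>\<^sup>2) / ennreal (norm (xx i t - xx j t))) \<in> borel_measurable lborel"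
      by measurable
  qed
  have "(\<lambda>t. ennreal_potential n \<mu> (x t) * indicator {0..T} t) = (\<lambda>t. d t * indicator {0..T} t)"
    by (auto simp: d_def ennreal_potential_def xx_def indicator_def fun_eq_iff)
  with dm show Um: "(\<lambda>t. ennreal_potential n \<mu> (x t) * indicator {0..T} t) \<in> borel_measurable lborel"
    by simp
  have vi: "integrable lborel (\<lambda>t. indicator {0..T} t *\<^sub>R (norm (v i t))\<^sup>2)" if "i \<in> {1..n}" for i
    using L2_derivative_square_integrable[OF x[OF that]] by (simp add: square_integrable_def set_integrable_def)
  have "AE t in lborel. \<forall>i\<in>{1..n}. t \<in> {0..T} \<longrightarrow> weak_derivative T (\<lambda>s. x s i) t = v i t"
  proof (rule AE_finite_allI)
    fix i assume i: "i \<in> {1..n}"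
    have "has_L2_derivative T (\<lambda>s. x s i) (weak_derivative T (\<lambda>s. x s i))"
      unfolding weak_derivative_def by (rule someI[of "has_L2_derivative T (\<lambda>s. x s i)", OF x[OF i]])
    from L2_derivative_unique[OF this x[OF i]]
    show "AE t in lborel. t \<in> {0..T} \<longrightarrow> weak_derivative T (\<lambda>s. x s i) t = v i t" .
  qed simp
  then have "Lagrangian_action n T \<mu> x =
      (\<integral>\<^sup>+t. (\<Sum>i=1..n. ennreal (\<mu> / 2 * (indicator {0..T} t *\<^sub>R (norm (v i t))\<^sup>2)))
        + ennreal_potential n \<mu> (x t) * indicator {0..T} t \<partial>lborel)"
    unfolding Lagrangian_action_def ennreal_potential_def[symmetric]
  proof (intro nn_integral_cong_AE, eventually_elim)
    case (elim t)
    then have "(\<Sum>i=1..n. ennreal (\<mu> / 2 * (norm (weak_derivative T (\<lambda>s. x s i) t))\<^sup>2)) =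
        (\<Sum>i=1..n. ennreal (\<mu> / 2 * (norm (v i t))\<^sup>2))" if "t \<in> {0..T}"
      using that by (intro sum.cong) auto
    then show ?case by (cases "t \<in> {0..T}") auto
  qed
  also have "\<dots> = (\<integral>\<^sup>+t. (\<Sum>i=1..n. ennreal (\<mu> / 2 * (indicator {0..T} t *\<^sub>R (norm (v i t))\<^sup>2))) \<partial>lborel)
        + (\<integral>\<^sup>+t\<in>{0..T}. ennreal_potential n \<mu> (x t) \<partial>lborel)"
    using Um vi by (intro nn_integral_add borel_measurable_sum measurable_compose[OF _ measurable_ennreal]
        borel_measurable_times borel_measurable_const borel_measurable_integrable) auto
  also have "(\<integral>\<^sup>+t. (\<Sum>i=1..n. ennreal (\<mu> / 2 * (indicator {0..T} t *\<^sub>R (norm (v i t))\<^sup>2))) \<partial>lborel)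
      = (\<Sum>i=1..n. \<integral>\<^sup>+t. ennreal (\<mu> / 2 * (indicator {0..T} t *\<^sub>R (norm (v i t))\<^sup>2)) \<partial>lborel)"
    using vi by (intro nn_integral_sum measurable_compose[OF _ measurable_ennreal]
        borel_measurable_times borel_measurable_const borel_measurable_integrable) auto
  also have "\<dots> = (\<Sum>i=1..n. ennreal (\<mu> / 2 * energy T (v i)))"
  proof (intro sum.cong refl)
    fix i assume i: "i \<in> {1..n}"
    have "(\<integral>\<^sup>+t. ennreal (\<mu> / 2 * (indicator {0..T} t *\<^sub>R (norm (v i t))\<^sup>2)) \<partial>lborel)
        = ennreal (LINT t|lborel. \<mu> / 2 * (indicator {0..T} t *\<^sub>R (norm (v i t))\<^sup>2))"
      using vi[OF i] \<mu> by (intro nn_integral_eq_integral) (auto simp: indicator_def)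
    also have "(LINT t|lborel. \<mu> / 2 * (indicator {0..T} t *\<^sub>R (norm (v i t))\<^sup>2)) = \<mu> / 2 * energy T (v i)"
      unfolding energy_def set_lebesgue_integral_def by (rule integral_mult_right_zero)
    finally show "(\<integral>\<^sup>+t. ennreal (\<mu> / 2 * (indicator {0..T} t *\<^sub>R (norm (v i t))\<^sup>2)) \<partial>lborel)
        = ennreal (\<mu> / 2 * energy T (v i))" .
  qed
  finally show "Lagrangian_action n T \<mu> x =
    (\<Sum>i=1..n. ennreal (\<mu> / 2 * energy T (v i))) + (\<integral>\<^sup>+t\<in>{0..T}. ennreal_potential n \<mu> (x t) \<partial>lborel)" .
qed

lemma action_eq_real:
  assumes \<mu>: "\<mu> > 0" and x: "\<And>i. i \<in> {1..n} \<Longrightarrow> has_L2_derivative T (\<lambda>t. x t i) (v i)"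
    and nc: "\<And>t i j. t \<in> {0..T} \<Longrightarrow> i \<in> {1..n} \<Longrightarrow> j \<in> {1..n} \<Longrightarrow> i \<noteq> j \<Longrightarrow> x t i \<noteq> x t j"
  shows "Lagrangian_action n T \<mu> x =
    ennreal (\<mu> / 2 * (\<Sum>i=1..n. energy T (v i)) + (LINT t:{0..T}|lborel. potential n \<mu> (x t)))"
    "continuous_on {0..T} (\<lambda>t. potential n \<mu> (x t))"
proof -
  note xc = L2_derivative_continuous[OF x]
  show c: "continuous_on {0..T} (\<lambda>t. potential n \<mu> (x t))"
    unfolding potential_def using nc by (intro continuous_intros xc) auto
  have i: "integrable lborel (\<lambda>t. indicator {0..T} t *\<^sub>R potential n \<mu> (x t))"
    using borel_integrable_atLeastAtMost'[OF c] by (simp add: set_integrable_def)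
  have p0: "0 \<le> potential n \<mu> q" for q by (simp add: potential_def sum_nonneg)
  have "(\<integral>\<^sup>+t\<in>{0..T}. ennreal_potential n \<mu> (x t) \<partial>lborel)
      = (\<integral>\<^sup>+t. ennreal (indicator {0..T} t *\<^sub>R potential n \<mu> (x t)) \<partial>lborel)"
    using ennreal_potential_eq nc by (intro nn_integral_cong) (auto simp: indicator_def)
  also have "\<dots> = ennreal (LINT t:{0..T}|lborel. potential n \<mu> (x t))"
    unfolding set_lebesgue_integral_def using i p0 by (intro nn_integral_eq_integral) auto
  finally have P: "(\<integral>\<^sup>+t\<in>{0..T}. ennreal_potential n \<mu> (x t) \<partial>lborel) = ennreal (LINT t:{0..T}|lborel. potential n \<mu> (x t))" .
  have P0: "0 \<le> (LINT t:{0..T}|lborel. potential n \<mu> (x t))"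
    unfolding set_lebesgue_integral_def using p0 by (intro integral_nonneg_AE) auto
  have "(\<Sum>i=1..n. ennreal (\<mu> / 2 * energy T (v i))) = ennreal (\<mu> / 2 * (\<Sum>i=1..n. energy T (v i)))"
    using \<mu> energy_nonneg by (simp add: sum_ennreal sum_distrib_left)
  then show "Lagrangian_action n T \<mu> x =
    ennreal (\<mu> / 2 * (\<Sum>i=1..n. energy T (v i)) + (LINT t:{0..T}|lborel. potential n \<mu> (x t)))"
    using action_eq(1)[OF \<mu> x] P P0 \<mu> energy_nonneg by (simp add: ennreal_plus sum_nonneg)
qed

lemma energy_diff_scaleR:
  assumes "square_integrable T v" "square_integrable T w"
  shows "energy T (\<lambda>t. v t + (- s) *\<^sub>R w t) =
    energy T v - 2 * s * (LINT t:{0..T}|lborel. v t \<bullet> w t) + s\<^sup>2 * energy T w"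
proof -
  have "(norm (v t + (- s) *\<^sub>R w t))\<^sup>2 = (norm (v t))\<^sup>2 - (2 * s) * (v t \<bullet> w t) + s\<^sup>2 * (norm (w t))\<^sup>2" for t
    unfolding power2_norm_eq_inner by (simp add: inner_diff inner_commute power2_eq_square)
  then show ?thesis
    unfolding energy_def using assms square_integrable_inner[OF assms]
    by (simp add: square_integrable_def set_integral_add set_integral_diff)
qed

text \<open>Only variations in the direction \<open>- h\<close> are considered, so the first variation is merely
  bounded from above.\<close>

theorem first_variation_nonpos:
  assumes \<mu>: "\<mu> > 0" and T: "T > 0"
    and x: "\<And>i. i \<in> {1..n} \<Longrightarrow> has_L2_derivative T (\<lambda>t. x t i) (v i)"
    and h: "\<And>i. i \<in> {1..n} \<Longrightarrow> has_L2_derivative T (\<lambda>t. h t i) (w i)"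
    and nc: "\<And>t i j. t \<in> {0..T} \<Longrightarrow> i \<in> {1..n} \<Longrightarrow> j \<in> {1..n} \<Longrightarrow> i \<noteq> j \<Longrightarrow> x t i \<noteq> x t j"
    and min: "\<And>s. Lagrangian_action n T \<mu> x \<le> Lagrangian_action n T \<mu> (\<lambda>t i. x t i + (- s) *\<^sub>R h t i)"
  shows "\<mu> * (\<Sum>i=1..n. LINT t:{0..T}|lborel. v i t \<bullet> w i t)
    + (LINT t:{0..T}|lborel. (\<Sum>i=1..n. force n \<mu> (x t) i \<bullet> h t i)) \<le> 0" (is "?B \<le> 0")
proof -
  note xc = L2_derivative_continuous[OF x] and hc = L2_derivative_continuous[OF h]
  \<comment> \<open>Compactness for each pair and finiteness of the set of pairs give a separation
    of the bodies that is uniform in time.\<close>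
  have "\<exists>\<delta>>0. \<forall>i\<in>{1..n}. \<forall>j\<in>{1..n}. i \<noteq> j \<longrightarrow> (\<forall>t\<in>{0..T}. \<delta> \<le> norm (x t i - x t j))"
  proof -
    have "\<exists>\<delta>>0. i \<in> {1..n} \<and> j \<in> {1..n} \<and> i \<noteq> j \<longrightarrow> (\<forall>t\<in>{0..T}. \<delta> \<le> norm (x t i - x t j))" for i j
    proof (cases "i \<in> {1..n} \<and> j \<in> {1..n} \<and> i \<noteq> j")
      case True
      then have "continuous_on {0..T} (\<lambda>t. norm (x t i - x t j))"
        by (intro continuous_intros xc) auto
      from continuous_attains_inf[OF compact_Icc _ this] T obtain t0 where
        t0: "t0 \<in> {0..T}" "\<forall>t\<in>{0..T}. norm (x t0 i - x t0 j) \<le> norm (x t i - x t j)" by auto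
      moreover have "norm (x t0 i - x t0 j) > 0" using nc[OF t0(1)] True by simp
      ultimately show ?thesis by blast
    qed (auto intro: exI[of _ 1])
    then obtain \<delta> where \<delta>: "\<And>i j. \<delta> i j > (0::real)"
      "\<And>i j. i \<in> {1..n} \<and> j \<in> {1..n} \<and> i \<noteq> j \<longrightarrow> (\<forall>t\<in>{0..T}. \<delta> i j \<le> norm (x t i - x t j))" by metis
    \<comment> \<open>The extra 1 makes the set nonempty even when there are no bodies.\<close>
    define m where "m = Min (insert 1 ((\<lambda>(i, j). \<delta> i j) ` ({1..n} \<times> {1..n})))"
    have "m > 0" unfolding m_def using \<delta>(1) by (subst Min_gr_iff) auto
    moreover have "m \<le> \<delta> i j" if "i \<in> {1..n}" "j \<in> {1..n}" for i j
      unfolding m_def using that by (intro Min_le) (auto intro: rev_image_eqI)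
    ultimately show ?thesis using \<delta>(2) by (meson order_trans)
  qed
  then obtain \<delta> where \<delta>: "\<delta> > 0" "\<And>i j t. i \<in> {1..n} \<Longrightarrow> j \<in> {1..n} \<Longrightarrow> i \<noteq> j \<Longrightarrow> t \<in> {0..T} \<Longrightarrow> \<delta> \<le> norm (x t i - x t j)"
    by blast
  have "\<exists>M. \<forall>t\<in>{0..T}. (\<Sum>i=1..n. norm (h t i)) \<le> M"
  proof -
    have "continuous_on {0..T} (\<lambda>t. \<Sum>i=1..n. norm (h t i))"
      by (intro continuous_intros hc)
    from continuous_attains_sup[OF compact_Icc _ this] T show ?thesis by auto
  qed
  then obtain M where M: "\<And>t. t \<in> {0..T} \<Longrightarrow> (\<Sum>i=1..n. norm (h t i)) \<le> M" by blast
  have M0: "M \<ge> 0" using M[of 0] T by (smt (verit) atLeastAtMost_iff norm_ge_zero sum_nonneg)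
  have e: "norm (h t i - h t j) \<le> 2 * M" if "t \<in> {0..T}" "i \<in> {1..n}" "j \<in> {1..n}" for t i j
  proof -
    have "norm (h t k) \<le> M" if "k \<in> {1..n}" for k
      using M[OF \<open>t \<in> {0..T}\<close>] member_le_sum[of k "{1..n}" "\<lambda>i. norm (h t i)"] that by simp
    then show ?thesis using that norm_triangle_ineq4[of "h t i" "h t j"] by (smt (verit))
  qed
  \<comment> \<open>Chosen so that \<open>s0 * (4 * M + 1) = \<delta> / 2\<close>: since |h_i - h_j|
    \<le> 2 M, relative displacements stay below half the separation, as the Taylor estimate
    requires. The 1 covers \<open>M = 0\<close>.\<close>
  define s0 where "s0 = \<delta> / (4 * M + 1) / 2"
  have s0: "s0 > 0" using \<delta>(1) M0 by (simp add: s0_def)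
  define C where "C = (\<Sum>i=1..n. \<Sum>j=i+1..n. \<mu>\<^sup>2 * (13 * (2 * M)\<^sup>2 / \<delta> ^ 3))"
  define Fh where "Fh = (\<lambda>t. \<Sum>i=1..n. force n \<mu> (x t) i \<bullet> h t i)"
  define y where "y = (\<lambda>s t i. x t i + (- s) *\<^sub>R h t i)"
  have yd: "has_L2_derivative T (\<lambda>t. y s t i) (\<lambda>t. v i t + (- s) *\<^sub>R w i t)" if "i \<in> {1..n}" for s i
    unfolding y_def by (intro has_L2_derivative_add x h that)
  have small: "s * norm (h t i - h t j) \<le> norm (x t i - x t j) / 2"
    if "0 \<le> s" "s \<le> s0" "t \<in> {0..T}" "i \<in> {1..n}" "j \<in> {1..n}" "i \<noteq> j" for s t i j
  proof -
    have "s * norm (h t i - h t j) \<le> s0 * (4 * M + 1)"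
      using that e[of t i j] M0 s0 by (intro mult_mono) auto
    also have "\<dots> = \<delta> / 2"
    proof -
      have "k > 0 \<Longrightarrow> \<delta> / k / 2 * k = \<delta> / 2" for k :: real by simp
      then show ?thesis unfolding s0_def by this (use M0 in simp)
    qed
    also have "\<dots> \<le> norm (x t i - x t j) / 2" using \<delta>(2) that by simp
    finally show ?thesis .
  qed
  have y_diff: "y s t i - y s t j = (x t i - x t j) - s *\<^sub>R (h t i - h t j)" for s t i j
    by (simp add: y_def scaleR_diff_right)
  have y_nc: "y s t i \<noteq> y s t j"
    if s: "0 \<le> s" "s \<le> s0" and t: "t \<in> {0..T}" and ij: "i \<in> {1..n}" "j \<in> {1..n}" "i \<noteq> j" for s t i j
  proof
    assume "y s t i = y s t j"
    then have "x t i - x t j = s *\<^sub>R (h t i - h t j)" using y_diff[of s t i j] by simp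
    then have "norm (x t i - x t j) = s * norm (h t i - h t j)" using s by simp
    moreover have "norm (x t i - x t j) > 0" using nc[OF t ij] by simp
    ultimately show False using small[OF s t ij] by linarith
  qed
  \<comment> \<open>The Taylor estimate summed over all pairs; separation and the bound on
    \<open>h\<close> make the second-order coefficient uniform in \<open>t\<close>.\<close>
  have pot: "potential n \<mu> (y s t) \<le> potential n \<mu> (x t) - s * Fh t + s\<^sup>2 * C"
    if s: "0 \<le> s" "s \<le> s0" and t: "t \<in> {0..T}" for s t
  proof -
    have "\<mu>\<^sup>2 / norm (y s t i - y s t j) \<le> \<mu>\<^sup>2 / norm (x t i - x t j)
        + s * (\<mu>\<^sup>2 * ((x t i - x t j) \<bullet> (h t i - h t j)) / (norm (x t i - x t j)) ^ 3)
        + s\<^sup>2 * (\<mu>\<^sup>2 * (13 * (2 * M)\<^sup>2 / \<delta> ^ 3))"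
      if "i \<in> {1..n}" "j \<in> {i+1..n}" for i j
    proof -
      have ij: "i \<in> {1..n}" "j \<in> {1..n}" "i \<noteq> j" using that by auto
      define a where "a = x t i - x t j"
      define b where "b = h t i - h t j"
      have a: "a \<noteq> 0" "\<delta> \<le> norm a" using nc[OF t ij] \<delta>(2)[OF ij t] by (auto simp: a_def)
      have "1 / norm (a - s *\<^sub>R b) \<le> 1 / norm a + s * (a \<bullet> b) / (norm a) ^ 3 + 13 * s\<^sup>2 * (norm b)\<^sup>2 / (norm a) ^ 3"
        using a(1) s(1) small[OF s t ij] unfolding a_def b_def by (rule inverse_distance_upper)
      also have "13 * s\<^sup>2 * (norm b)\<^sup>2 / (norm a) ^ 3 \<le> 13 * s\<^sup>2 * (2 * M)\<^sup>2 / \<delta> ^ 3"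
        using e[OF t ij(1,2)] a \<delta>(1) by (intro frac_le mult_left_mono power_mono) (auto simp: b_def)
      finally have "\<mu>\<^sup>2 * (1 / norm (a - s *\<^sub>R b)) \<le>
          \<mu>\<^sup>2 * (1 / norm a + s * (a \<bullet> b) / (norm a) ^ 3 + 13 * s\<^sup>2 * (2 * M)\<^sup>2 / \<delta> ^ 3)"
        by (intro mult_left_mono) auto
      then show ?thesis
        unfolding y_diff a_def[symmetric] b_def[symmetric] by (simp add: algebra_simps)
    qed
    then have "potential n \<mu> (y s t) \<le> (\<Sum>i=1..n. \<Sum>j=i+1..n. \<mu>\<^sup>2 / norm (x t i - x t j)
        + s * (\<mu>\<^sup>2 * ((x t i - x t j) \<bullet> (h t i - h t j)) / (norm (x t i - x t j)) ^ 3)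
        + s\<^sup>2 * (\<mu>\<^sup>2 * (13 * (2 * M)\<^sup>2 / \<delta> ^ 3)))"
      unfolding potential_def by (intro sum_mono)
    also have "\<dots> = potential n \<mu> (x t) - s * Fh t + s\<^sup>2 * C"
      unfolding potential_def Fh_def sum_force_inner C_def sum.distrib sum_distrib_left[symmetric] by simp
    finally show ?thesis .
  qed
  note ax = action_eq_real[OF \<mu> x nc]
  have Fh_cont: "continuous_on {0..T} Fh"
    unfolding Fh_def force_def using nc by (intro continuous_intros xc hc) auto
  have si: "set_integrable lborel {0..T} f" if "continuous_on {0..T} f" for f :: "real \<Rightarrow> real"
    using that by (rule borel_integrable_atLeastAtMost')
  define D where "D = \<mu> / 2 * (\<Sum>i=1..n. energy T (w i)) + C * T"
  \<comment> \<open>Minimality is compared with the second-order upper bound and divided by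
    \<open>s\<close>; \<open>D\<close> collects the quadratic coefficients of the kinetic and the
    potential part.\<close>
  have main: "?B \<le> s * D" if s: "0 < s" "s \<le> s0" for s
  proof -
    have s': "0 \<le> s" using s by simp
    note ay = action_eq_real[OF \<mu> yd y_nc[OF s' s(2)]]
    define Px where "Px = (LINT t:{0..T}|lborel. potential n \<mu> (x t))"
    define Py where "Py = (LINT t:{0..T}|lborel. potential n \<mu> (y s t))"
    define Ph where "Ph = (LINT t:{0..T}|lborel. Fh t)"
    define Kx where "Kx = (\<Sum>i=1..n. energy T (v i))"
    define Kh where "Kh = (\<Sum>i=1..n. energy T (w i))"
    define Kxh where "Kxh = (\<Sum>i=1..n. LINT t:{0..T}|lborel. v i t \<bullet> w i t)"
    have Ky: "(\<Sum>i=1..n. energy T (\<lambda>t. v i t + (- s) *\<^sub>R w i t)) = Kx - 2 * s * Kxh + s\<^sup>2 * Kh"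
    proof -
      have "(\<Sum>i=1..n. energy T (\<lambda>t. v i t + (- s) *\<^sub>R w i t)) = (\<Sum>i=1..n. energy T (v i)
        - 2 * s * (LINT t:{0..T}|lborel. v i t \<bullet> w i t) + s\<^sup>2 * energy T (w i))"
        by (intro sum.cong refl energy_diff_scaleR L2_derivative_square_integrable[OF x]
            L2_derivative_square_integrable[OF h])
      then show ?thesis
        by (simp add: Kx_def Kh_def Kxh_def sum.distrib sum_subtractf sum_distrib_left)
    qed
    have py0: "0 \<le> Py"
      unfolding Py_def set_lebesgue_integral_def
      by (intro integral_nonneg_AE) (auto simp: potential_def sum_nonneg)
    have Ax: "Lagrangian_action n T \<mu> x = ennreal (\<mu> / 2 * Kx + Px)"
      unfolding Kx_def Px_def by (rule ax(1))
    have Ay: "Lagrangian_action n T \<mu> (y s) =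
        ennreal (\<mu> / 2 * (\<Sum>i=1..n. energy T (\<lambda>t. v i t + (- s) *\<^sub>R w i t)) + Py)"
      unfolding Py_def by (rule ay(1))
    have "ennreal (\<mu> / 2 * Kx + Px) \<le> ennreal (\<mu> / 2 * (\<Sum>i=1..n. energy T (\<lambda>t. v i t + (- s) *\<^sub>R w i t)) + Py)"
      using min[of s] unfolding Ax[symmetric] Ay[symmetric] by (simp only: y_def)
    moreover have "0 \<le> \<mu> / 2 * (\<Sum>i=1..n. energy T (\<lambda>t. v i t + (- s) *\<^sub>R w i t)) + Py"
      using \<mu> py0 by (intro add_nonneg_nonneg mult_nonneg_nonneg sum_nonneg energy_nonneg) auto
    ultimately have le: "\<mu> / 2 * Kx + Px \<le> \<mu> / 2 * (Kx - 2 * s * Kxh + s\<^sup>2 * Kh) + Py"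
      unfolding Ky by simp
    have "Py \<le> (LINT t:{0..T}|lborel. potential n \<mu> (x t) - s * Fh t + s\<^sup>2 * C)"
      unfolding Py_def by (rule set_integral_mono)
        (use pot[OF s' s(2)] in \<open>auto intro!: si continuous_intros ax(2) ay(2) Fh_cont\<close>)
    also have "\<dots> = Px - s * Ph + s\<^sup>2 * C * T"
      using T si[OF ax(2)] si[OF Fh_cont] si[OF continuous_on_const, of "s\<^sup>2 * C"]
      by (simp add: set_integral_add set_integral_diff Px_def Ph_def set_integral_const)
    finally have Py: "Py \<le> Px - s * Ph + s\<^sup>2 * C * T" .
    have "D = \<mu> / 2 * Kh + C * T" unfolding D_def Kh_def ..
    with Py have "s * (\<mu> * Kxh + Ph) \<le> s * (s * D)"
      using le by (simp add: power2_eq_square algebra_simps)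
    then show ?thesis using s by (simp add: Kxh_def Ph_def Fh_def)
  qed
  have "((\<lambda>s. s * D) \<longlongrightarrow> 0 * D) (at_right 0)" by (intro tendsto_intros)
  then have "?B \<le> 0 * D"
    by (rule tendsto_lowerbound) (use main s0 in \<open>auto intro!: eventually_at_rightI[of 0 s0]\<close>)
  then show ?thesis by simp
qed

section \<open>Coercivity and existence of minimizers\<close>

lemma loop_space_weak_derivative:
  assumes "x \<in> loop_space n T" "i \<in> {1..n}"
  shows "has_L2_derivative T (\<lambda>t. x t i) (weak_derivative T (\<lambda>t. x t i))"
proof -
  have "\<exists>v. has_L2_derivative T (\<lambda>t. x t i) v" using assms unfolding loop_space_def by blast
  then show ?thesis unfolding weak_derivative_def by (rule someI_ex)
qed

lemma loop_space_config: "x \<in> loop_space n T \<Longrightarrow> x t \<in> config_space n"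
  by (simp add: loop_space_def)

lemma loop_space_periodic: "x \<in> loop_space n T \<Longrightarrow> x (t + T) = x t"
  by (simp add: loop_space_def)

lemma energy_le_action:
  assumes "\<mu> > 0" "x \<in> loop_space n T"
  shows "ennreal (\<mu> / 2 * (\<Sum>i=1..n. energy T (weak_derivative T (\<lambda>t. x t i)))) \<le> Lagrangian_action n T \<mu> x"
proof -
  have "(\<Sum>i=1..n. ennreal (\<mu> / 2 * energy T (weak_derivative T (\<lambda>t. x t i))))
      = ennreal (\<mu> / 2 * (\<Sum>i=1..n. energy T (weak_derivative T (\<lambda>t. x t i))))"
    using assms(1) energy_nonneg by (simp add: sum_ennreal sum_distrib_left)
  then show ?thesis
    using action_eq(1)[OF assms(1) loop_space_weak_derivative[OF assms(2)]] by simp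
qed

text \<open>A zero of the component stands in for the mean value in a Poincare inequality: the
  energy then controls the values of the loop, not just its increments.\<close>

lemma loop_norm_sq_le:
  assumes "T > 0" "x \<in> loop_space n T" "i \<in> {1..n}" "t0 \<in> {0..T}" "x t0 i = 0" "t \<in> {0..T}"
  shows "(norm (x t i))\<^sup>2 \<le> T * energy T (weak_derivative T (\<lambda>t. x t i))"
proof -
  have "(norm (x t i - x t0 i))\<^sup>2 \<le> \<bar>t - t0\<bar> * energy T (weak_derivative T (\<lambda>t. x t i))"
    using assms by (intro L2_derivative_Holder' loop_space_weak_derivative)
  also have "\<dots> \<le> T * energy T (weak_derivative T (\<lambda>t. x t i))"
    using assms by (intro mult_right_mono energy_nonneg) auto
  finally show ?thesis using assms(5) by simp
qed

lemma H1_norm_sq_le: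
  assumes T: "T > 0" and x: "x \<in> loop_space n T" and z: "\<And>i. i \<in> {1..n} \<Longrightarrow> \<exists>t\<in>{0..T}. x t i = 0"
  shows "(H1_norm n T x)\<^sup>2 \<le> (T\<^sup>2 + 1) * (\<Sum>i=1..n. energy T (weak_derivative T (\<lambda>t. x t i)))"
proof -
  define E where "E = (\<lambda>i. energy T (weak_derivative T (\<lambda>t. x t i)))"
  have d: "has_L2_derivative T (\<lambda>t. x t i) (weak_derivative T (\<lambda>t. x t i))" if "i \<in> {1..n}" for i
    using loop_space_weak_derivative[OF x that] .
  have wi: "integrable lborel (\<lambda>t. indicator {0..T} t *\<^sub>R (norm (weak_derivative T (\<lambda>s. x s i) t))\<^sup>2)"
    if "i \<in> {1..n}" for i
    using L2_derivative_square_integrable[OF d[OF that]] by (simp add: square_integrable_def set_integrable_def)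
  have xs: "square_integrable T (\<lambda>t. x t i)" if "i \<in> {1..n}" for i
    by (intro square_integrable_continuous L2_derivative_continuous[OF d] that)
  then have xi: "integrable lborel (\<lambda>t. indicator {0..T} t *\<^sub>R (norm (x t i))\<^sup>2)" if "i \<in> {1..n}" for i
    using that by (simp add: square_integrable_def set_integrable_def)
  have "(LINT t:{0..T}|lborel. (\<Sum>i=1..n. (norm (x t i))\<^sup>2 + (norm (weak_derivative T (\<lambda>s. x s i) t))\<^sup>2))
      = (LINT t|lborel. (\<Sum>i=1..n. indicator {0..T} t *\<^sub>R (norm (x t i))\<^sup>2
            + indicator {0..T} t *\<^sub>R (norm (weak_derivative T (\<lambda>s. x s i) t))\<^sup>2))"
    unfolding set_lebesgue_integral_def scaleR_sum_right scaleR_add_right ..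
  also have "\<dots> = (\<Sum>i=1..n. energy T (\<lambda>t. x t i) + E i)"
    using xi wi by (simp add: E_def energy_def set_lebesgue_integral_def)
  also have "\<dots> \<le> (\<Sum>i=1..n. T\<^sup>2 * E i + E i)"
  proof (intro sum_mono add_right_mono)
    fix i assume i: "i \<in> {1..n}"
    obtain t0 where t0: "t0 \<in> {0..T}" "x t0 i = 0" using z[OF i] by blast
    have "energy T (\<lambda>t. x t i) \<le> (LINT t:{0..T}|lborel. T * E i)"
      unfolding energy_def
    proof (rule set_integral_mono)
      show "set_integrable lborel {0..T} (\<lambda>t. (norm (x t i))\<^sup>2)"
        using xs[OF i] by (simp add: square_integrable_def)
      show "set_integrable lborel {0..T} (\<lambda>t. T * E i)"
        by (simp add: borel_integrable_atLeastAtMost')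
      show "(norm (x t i))\<^sup>2 \<le> T * E i" if "t \<in> {0..T}" for t
        unfolding E_def by (rule loop_norm_sq_le[OF T x i t0 that])
    qed
    also have "\<dots> = T\<^sup>2 * E i" using T by (simp add: set_integral_const power2_eq_square)
    finally show "energy T (\<lambda>t. x t i) \<le> T\<^sup>2 * E i" .
  qed
  also have "\<dots> = (T\<^sup>2 + 1) * (\<Sum>i=1..n. E i)"
    by (simp add: sum.distrib sum_distrib_left algebra_simps)
  finally have le: "(LINT t:{0..T}|lborel. (\<Sum>i=1..n. (norm (x t i))\<^sup>2 + (norm (weak_derivative T (\<lambda>s. x s i) t))\<^sup>2))
      \<le> (T\<^sup>2 + 1) * (\<Sum>i=1..n. E i)" .
  have "0 \<le> (LINT t:{0..T}|lborel. (\<Sum>i=1..n. (norm (x t i))\<^sup>2 + (norm (weak_derivative T (\<lambda>s. x s i) t))\<^sup>2))"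
    unfolding set_lebesgue_integral_def by (intro integral_nonneg_AE) (auto simp: sum_nonneg)
  then show ?thesis
    using le unfolding H1_norm_def E_def by (simp del: sum.distrib)
qed

theorem coercive_on_if_zeros:
  assumes T: "T > 0" and \<mu>: "\<mu> > 0" and S: "S \<subseteq> loop_space n T"
    and z: "\<And>x i. x \<in> S \<Longrightarrow> i \<in> {1..n} \<Longrightarrow> \<exists>t\<in>{0..T}. x t i = 0"
  shows "coercive_on n T (Lagrangian_action n T \<mu>) S"
  unfolding coercive_on_def
proof (intro allI)
  fix M :: real
  \<comment> \<open>Read backwards from \<open>H1_norm^2 \<le> (T^2 + 1) K\<close> and
    \<open>\<mu> / 2 * K \<le> action\<close>, with \<open>K\<close> the sum of the energies;
    \<open>\<bar>M\<bar>\<close> lets \<open>R\<close> serve for negative \<open>M\<close>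
    too.\<close>
  define R where "R = sqrt ((T\<^sup>2 + 1) * (2 / \<mu> * \<bar>M\<bar>))"
  have "Lagrangian_action n T \<mu> x > ennreal M" if x: "x \<in> S" and R: "H1_norm n T x > R" for x
  proof -
    define K where "K = (\<Sum>i=1..n. energy T (weak_derivative T (\<lambda>t. x t i)))"
    have xl: "x \<in> loop_space n T" using x S by blast
    have T2: "T\<^sup>2 + 1 > 0" by (simp add: add_nonneg_pos)
    have R2: "R\<^sup>2 = (T\<^sup>2 + 1) * (2 / \<mu> * \<bar>M\<bar>)" using \<mu> by (simp add: R_def)
    have "R\<^sup>2 < (H1_norm n T x)\<^sup>2"
      using R \<mu> by (intro power_strict_mono) (auto simp: R_def)
    also have "\<dots> \<le> (T\<^sup>2 + 1) * K"
      unfolding K_def using z x by (intro H1_norm_sq_le[OF T xl]) auto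
    finally have "2 / \<mu> * \<bar>M\<bar> < K" unfolding R2 mult_less_cancel_left_pos[OF T2] .
    then have "\<bar>M\<bar> < \<mu> / 2 * K" using \<mu> by (simp add: field_simps)
    then have "ennreal M < ennreal (\<mu> / 2 * K)" by (intro ennreal_lessI) auto
    also have "\<dots> \<le> Lagrangian_action n T \<mu> x"
      unfolding K_def by (rule energy_le_action[OF \<mu> xl])
    finally show ?thesis .
  qed
  then show "\<exists>R. \<forall>x\<in>S. H1_norm n T x > R \<longrightarrow> Lagrangian_action n T \<mu> x > ennreal M" by blast
qed

section \<open>The direct method: compactness and semicontinuity\<close>

lemma periodic_rmod:
  assumes T: "T > 0" and per: "\<And>t. f (t + T) = f t"
  shows "f (t rmod T) = f t"
proof -
  have "t rmod T = t + of_int (- \<lfloor>t / T\<rfloor>) * T"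
    using T by (simp add: rmod_def)
  then show ?thesis using periodic_int_shift[of f T t "- \<lfloor>t / T\<rfloor>"] per by simp
qed

lemma energy_unique:
  assumes "has_L2_derivative T f v" "has_L2_derivative T f w"
  shows "energy T v = energy T w"
proof -
  have [measurable]: "(\<lambda>t. indicator {0..T} t *\<^sub>R (norm (u t))\<^sup>2) \<in> borel_measurable lborel"
    if "has_L2_derivative T f u" for u
    using L2_derivative_square_integrable[OF that]
    unfolding square_integrable_def set_integrable_def by blast
  show ?thesis
    unfolding energy_def set_lebesgue_integral_def
  proof (rule integral_cong_AE)
    show "AE t in lborel. indicator {0..T} t *\<^sub>R (norm (v t))\<^sup>2 = indicator {0..T} t *\<^sub>R (norm (w t))\<^sup>2"
      using L2_derivative_unique[OF assms] by eventually_elim (auto simp: indicator_def)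
  qed (use assms in measurable)
qed

text \<open>Fatou's lemma for the counting measure on a finite set.\<close>

lemma sum_liminf_le:
  fixes b :: "nat \<Rightarrow> 'a \<Rightarrow> ennreal"
  assumes "finite I"
  shows "(\<Sum>i\<in>I. liminf (\<lambda>k. b k i)) \<le> liminf (\<lambda>k. \<Sum>i\<in>I. b k i)"
  using nn_integral_liminf[of b "count_space I"] assms by (simp add: nn_integral_count_space_finite)

text \<open>In the extended reals inversion is continuous also at 0, so the limit configuration may
  have collisions.\<close>

lemma ennreal_potential_tendsto:
  assumes "\<And>i. (\<lambda>k. q k i) \<longlonglongrightarrow> p i"
  shows "(\<lambda>k. ennreal_potential n \<mu> (q k)) \<longlonglongrightarrow> ennreal_potential n \<mu> p"
  unfolding ennreal_potential_def
proof (intro tendsto_sum)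
  fix i j
  have "(\<lambda>k. ennreal (norm (q k i - q k j))) \<longlonglongrightarrow> ennreal (norm (p i - p j))"
    by (intro tendsto_ennrealI tendsto_intros assms)
  moreover have "isCont (inverse :: ennreal \<Rightarrow> ennreal) (ennreal (norm (p i - p j)))"
    using continuous_on_inverse_ennreal[OF continuous_on_id, of UNIV]
    by (simp add: continuous_on_eq_continuous_at)
  ultimately have "(\<lambda>k. inverse (ennreal (norm (q k i - q k j)))) \<longlonglongrightarrow> inverse (ennreal (norm (p i - p j)))"
    by (rule isCont_tendsto_compose[rotated])
  then show "(\<lambda>k. ennreal (\<mu>\<^sup>2) / ennreal (norm (q k i - q k j))) \<longlonglongrightarrow> ennreal (\<mu>\<^sup>2) / ennreal (norm (p i - p j))"
    unfolding divide_ennreal_def by (intro ennreal_tendsto_cmult) auto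
qed

text \<open>The direct method for any class of loops whose components all vanish somewhere.
  Closedness is required only for pointwise limits that have an L2 derivative, because that
  derivative is supplied by the semicontinuity theorem.\<close>

theorem action_minimizer_exists:
  assumes T: "T > 0" and \<mu>: "\<mu> > 0" and S: "S \<subseteq> loop_space n T" "S \<noteq> {}"
    and z: "\<And>x i. x \<in> S \<Longrightarrow> i \<in> {1..n} \<Longrightarrow> \<exists>t\<in>{0..T}. x t i = 0"
    and closed: "\<And>X y. (\<And>k. X k \<in> S) \<Longrightarrow> (\<And>t i. (\<lambda>k. X k t i) \<longlonglongrightarrow> y t i) \<Longrightarrow>
       (\<And>i. i \<in> {1..n} \<Longrightarrow> \<exists>v. has_L2_derivative T (\<lambda>t. y t i) v) \<Longrightarrow> y \<in> S"
  shows "\<exists>x. minimizer_on (Lagrangian_action n T \<mu>) S x"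
proof -
  define A where "A = Lagrangian_action n T \<mu>"
  define m where "m = (INF x\<in>S. A x)"
  have m_le: "m \<le> A x" if "x \<in> S" for x unfolding m_def using that by (rule INF_lower)
  show ?thesis
  proof (cases "m = \<infinity>")
    \<comment> \<open>An infinite infimum makes every element of \<open>S\<close> a minimizer, so
      that no loop of finite action has to be exhibited.\<close>
    case True
    then have "A x = \<infinity>" if "x \<in> S" for x using m_le[OF that] by (simp add: top_unique)
    then show ?thesis using S(2) unfolding minimizer_on_def A_def[symmetric] by auto
  next
    case False
    have "\<exists>x\<in>S. A x < m + ennreal (1 / real (Suc k))" for k
    proof -
      have "m < m + ennreal (1 / real (Suc k))"
        using False by (cases m) (auto simp: ennreal_less_iff simp flip: ennreal_plus)
      then show ?thesis unfolding m_def INF_less_iff .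
    qed
    then obtain X0 where X0: "\<And>k. X0 k \<in> S" "\<And>k. A (X0 k) < m + ennreal (1 / real (Suc k))" by metis
    define E where "E = (\<lambda>(x :: real \<Rightarrow> nat \<Rightarrow> complex) i. energy T (weak_derivative T (\<lambda>t. x t i)))"
    \<comment> \<open>Every member of the sequence has action at most \<open>m + 1\<close>, so
      \<open>c\<close> bounds each single energy.\<close>
    define c where "c = 2 / \<mu> * enn2real (m + 1)"
    have c0: "c \<ge> 0" using \<mu> by (simp add: c_def)
    have E_le: "E (X0 k) i \<le> c" if i: "i \<in> {1..n}" for k i
    proof -
      have "ennreal (\<mu> / 2 * E (X0 k) i) \<le> ennreal (\<mu> / 2 * (\<Sum>i=1..n. E (X0 k) i))"
        using i \<mu> energy_nonneg by (intro ennreal_leI mult_left_mono member_le_sum) (auto simp: E_def)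
      also have "\<dots> \<le> A (X0 k)"
        unfolding E_def A_def using X0(1) S(1) by (intro energy_le_action[OF \<mu>]) auto
      also have "\<dots> \<le> m + ennreal (1 / real (Suc k))" using X0(2)[of k] by (rule less_imp_le)
      also have "\<dots> \<le> m + 1" by (intro add_left_mono) simp
      also have "\<dots> = ennreal (enn2real (m + 1))" using False by (simp add: less_top)
      finally have "\<mu> / 2 * E (X0 k) i \<le> enn2real (m + 1)" by simp
      then show ?thesis using \<mu> by (simp add: c_def field_simps)
    qed
    have X0l: "X0 k \<in> loop_space n T" for k using X0(1) S(1) by blast
    \<comment> \<open>The index is encoded as a second real coordinate: one application of
      Arzela-Ascoli then yields a common subsequence for all bodies. Distinct indices lie at
      distance at least 1, so points closer than 1 belong to the same body.\<close>
    define D where "D = {0..T} \<times> real ` {1..n}"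
    define F where "F = (\<lambda>k p. X0 k (fst p) (nat \<lfloor>snd p :: real\<rfloor>))"
    have F_eq: "F k (t, real i) = X0 k t i" for k t i by (simp add: F_def)
    have "compact D" unfolding D_def by (rule compact_Times) (auto intro: finite_imp_compact)
    moreover have "norm (F k p) \<le> sqrt (T * c)" if "p \<in> D" for k p
    proof -
      obtain t i where p: "p = (t, real i)" "t \<in> {0..T}" "i \<in> {1..n}" using \<open>p \<in> D\<close> by (auto simp: D_def)
      obtain t0 where t0: "t0 \<in> {0..T}" "X0 k t0 i = 0" using z[OF X0(1) p(3)] by blast
      have "(norm (X0 k t i))\<^sup>2 \<le> T * E (X0 k) i"
        unfolding E_def by (rule loop_norm_sq_le[OF T X0l p(3) t0 p(2)])
      also have "\<dots> \<le> T * c" using T E_le[OF p(3)] by (intro mult_left_mono) auto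
      finally show ?thesis by (simp add: p(1) F_eq real_le_rsqrt)
    qed
    moreover have "\<exists>d>0. \<forall>k p'. p' \<in> D \<and> norm (p - p') < d \<longrightarrow> norm (F k p - F k p') < e"
      if "p \<in> D" "0 < e" for p e
    proof -
      obtain t i where p: "p = (t, real i)" "t \<in> {0..T}" "i \<in> {1..n}" using \<open>p \<in> D\<close> by (auto simp: D_def)
      define d where "d = min 1 (e\<^sup>2 / (c + 1))"
      have d: "d > 0" "d \<le> 1" using \<open>0 < e\<close> c0 by (auto simp: d_def)
      have "norm (F k p - F k p') < e" if p': "p' \<in> D" "norm (p - p') < d" for k p'
      proof -
        obtain t' i' where q: "p' = (t', real i')" "t' \<in> {0..T}" "i' \<in> {1..n}" using p'(1) by (auto simp: D_def)
        have tt: "\<bar>t - t'\<bar> < d"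
          using norm_fst_le[of "t - t'" "real i - real i'"] p'(2) by (simp add: p(1) q(1))
        have "\<bar>real i - real i'\<bar> < 1"
          using norm_snd_le[of "real i - real i'" "t - t'"] p'(2) d(2) by (simp add: p(1) q(1))
        then have ii: "i' = i" by linarith
        have "(norm (X0 k t i - X0 k t' i))\<^sup>2 \<le> \<bar>t - t'\<bar> * E (X0 k) i"
          unfolding E_def by (intro L2_derivative_Holder' loop_space_weak_derivative[OF X0l] p q(2))
        also have "\<dots> \<le> d * c" using tt E_le[OF p(3)] d(1) energy_nonneg
          by (intro mult_mono) (auto simp: E_def)
        also have "\<dots> \<le> e\<^sup>2 / (c + 1) * c" using c0 by (intro mult_right_mono) (auto simp: d_def)
        also have "\<dots> < e\<^sup>2" using c0 \<open>0 < e\<close> by (simp add: field_simps)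
        finally show ?thesis using \<open>0 < e\<close> by (simp add: p(1) q(1) ii F_eq power_less_imp_less_base)
      qed
      then show ?thesis using d(1) by blast
    qed
    ultimately obtain g r where gr: "continuous_on D g" "strict_mono (r :: nat \<Rightarrow> nat)"
      "\<And>e. 0 < e \<Longrightarrow> \<exists>N. \<forall>n x. n \<ge> N \<and> x \<in> D \<longrightarrow> norm (F (r n) x - g x) < e"
      using Arzela_Ascoli[of D F "sqrt (T * c)"] by (smt (verit, best))
    define X where "X = X0 \<circ> r"
    have XS: "X k \<in> S" and Xl: "X k \<in> loop_space n T" for k using X0(1) X0l by (auto simp: X_def)
    define y where "y = (\<lambda>t i. if i \<in> {1..n} then g (t rmod T, real i) else 0)"
    have ul0: "uniform_limit {0..T} (\<lambda>k t. X k t i) (\<lambda>t. g (t, real i)) sequentially" if "i \<in> {1..n}" for i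
      unfolding uniform_limit_iff eventually_sequentially
    proof (intro allI impI)
      fix e :: real assume "e > 0"
      from gr(3)[OF this] obtain N where "\<forall>n x. n \<ge> N \<and> x \<in> D \<longrightarrow> norm (F (r n) x - g x) < e" by blast
      then have "\<forall>k\<ge>N. \<forall>t\<in>{0..T}. dist (X k t i) (g (t, real i)) < e"
        using that by (auto simp: dist_norm X_def D_def F_eq[symmetric])
      then show "\<exists>N. \<forall>k\<ge>N. \<forall>t\<in>{0..T}. dist (X k t i) (g (t, real i)) < e" by blast
    qed
    have lim: "(\<lambda>k. X k t i) \<longlonglongrightarrow> y t i" for t i
    proof (cases "i \<in> {1..n}")
      case True
      have "t rmod T \<in> {0..T}" using T rmod_nonneg[of T t] rmod_le[of T t] by auto
      from tendsto_uniform_limitI[OF ul0[OF True] this]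
      have "(\<lambda>k. X k (t rmod T) i) \<longlonglongrightarrow> y t i" using True by (simp add: y_def)
      moreover have "X k (t rmod T) = X k t" for k
        by (rule periodic_rmod[OF T]) (rule loop_space_periodic[OF Xl])
      ultimately show ?thesis by simp
    next
      case False
      then show ?thesis using loop_space_config[OF Xl, of _ t] by (auto simp: y_def config_space_def)
    qed
    \<comment> \<open>The extension \<open>y\<close> uses the value of \<open>g\<close> at time 0
      for time \<open>T\<close>. Both values are limits of the same periodic loops, so
      \<open>y\<close> and \<open>g\<close> agree on the whole closed interval.\<close>
    have ul: "uniform_limit {0..T} (\<lambda>k t. X k t i) (\<lambda>t. y t i) sequentially" if i: "i \<in> {1..n}" for i
    proof -
      have "g (t, real i) = y t i" if "t \<in> {0..T}" for t
        using LIMSEQ_unique[OF tendsto_uniform_limitI[OF ul0[OF i] that] lim] .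
      then show ?thesis using ul0[OF i] by (subst (asm) uniform_limit_cong'[where g = "\<lambda>k t. X k t i" and i = "\<lambda>t. y t i"]) auto
    qed
    have XE: "E (X k) i \<le> c" if "i \<in> {1..n}" for k i using E_le[OF that] by (simp add: X_def)
    have Xd: "has_L2_derivative T (\<lambda>t. X k t i) (weak_derivative T (\<lambda>t. X k t i))" if "i \<in> {1..n}" for k i
      by (rule loop_space_weak_derivative[OF Xl that])
    have yd: "\<exists>v. has_L2_derivative T (\<lambda>t. y t i) v" if i: "i \<in> {1..n}" for i
      using L2_derivative_lower_semicontinuous[OF less_imp_le[OF T] Xd[OF i] _ ul[OF i], of c] XE[OF i]
      by (auto simp: E_def)
    have yS: "y \<in> S" by (rule closed[OF XS lim yd])
    then have yl: "y \<in> loop_space n T" using S(1) by blast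
    \<comment> \<open>If the kinetic terms were at most \<open>u\<close> infinitely often, the
      semicontinuity theorem along that subsequence would give \<open>y\<close> a derivative of
      energy at most \<open>2 u / \<mu>\<close>, and the energy does not depend on the derivative
      chosen.\<close>
    have lsc: "ennreal (\<mu> / 2 * E y i) \<le> liminf (\<lambda>k. ennreal (\<mu> / 2 * E (X k) i))" if i: "i \<in> {1..n}" for i
      unfolding le_Liminf_iff
    proof (intro allI impI, rule ccontr)
      fix u assume u: "u < ennreal (\<mu> / 2 * E y i)"
        and "\<not> (\<forall>\<^sub>F k in sequentially. u < ennreal (\<mu> / 2 * E (X k) i))"
      then have inf: "infinite {k. ennreal (\<mu> / 2 * E (X k) i) \<le> u}"
        by (auto simp: not_eventually not_less frequently_cofinite cofinite_eq_sequentially[symmetric])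
      define s where "s = enumerate {k. ennreal (\<mu> / 2 * E (X k) i) \<le> u}"
      have s: "strict_mono s" unfolding s_def using inf by (rule strict_mono_enumerate)
      have "ennreal (\<mu> / 2 * E (X (s k)) i) \<le> u" for k
        using enumerate_in_set[OF inf, of k] by (simp add: s_def)
      moreover have "u \<noteq> \<infinity>" using u by auto
      ultimately have "E (X (s k)) i \<le> 2 / \<mu> * enn2real u" for k
      proof -
        have "ennreal (\<mu> / 2 * E (X (s k)) i) \<le> ennreal (enn2real u)"
          using \<open>ennreal (\<mu> / 2 * E (X (s k)) i) \<le> u\<close> \<open>u \<noteq> \<infinity>\<close> by (simp add: less_top)
        then have "\<mu> / 2 * E (X (s k)) i \<le> enn2real u" by simp
        then show ?thesis using \<mu> by (simp add: field_simps)
      qed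
      then have "\<exists>w. has_L2_derivative T (\<lambda>t. y t i) w \<and> energy T w \<le> 2 / \<mu> * enn2real u"
        using L2_derivative_lower_semicontinuous[OF less_imp_le[OF T] Xd[OF i], of s "2 / \<mu> * enn2real u" "\<lambda>t. y t i"]
          filterlim_compose[OF ul[OF i] filterlim_subseq[OF s]]
        by (simp add: E_def)
      then have "E y i \<le> 2 / \<mu> * enn2real u"
        using energy_unique[OF loop_space_weak_derivative[OF yl i]] by (auto simp: E_def)
      then have "\<mu> / 2 * E y i \<le> enn2real u" using \<mu> by (simp add: field_simps)
      then have "ennreal (\<mu> / 2 * E y i) \<le> ennreal (enn2real u)" by (rule ennreal_leI)
      also have "\<dots> = u" using \<open>u \<noteq> \<infinity>\<close> by (simp add: less_top)
      finally show False using u by simp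
    qed
    define P where "P = (\<lambda>x :: real \<Rightarrow> nat \<Rightarrow> complex. \<integral>\<^sup>+t\<in>{0..T}. ennreal_potential n \<mu> (x t) \<partial>lborel)"
    have A_eq: "A x = (\<Sum>i=1..n. ennreal (\<mu> / 2 * E x i)) + P x" if "x \<in> loop_space n T" for x
      unfolding A_def E_def P_def by (intro action_eq(1)[OF \<mu>] loop_space_weak_derivative[OF that])
    have P_lsc: "P y \<le> liminf (\<lambda>k. P (X k))"
    proof -
      have "P y = (\<integral>\<^sup>+t. liminf (\<lambda>k. ennreal_potential n \<mu> (X k t) * indicator {0..T} t) \<partial>lborel)"
        unfolding P_def
      proof (intro nn_integral_cong)
        fix t
        have "(\<lambda>k. ennreal_potential n \<mu> (X k t)) \<longlonglongrightarrow> ennreal_potential n \<mu> (y t)"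
          by (rule ennreal_potential_tendsto) (rule lim)
        then show "ennreal_potential n \<mu> (y t) * indicator {0..T} t =
            liminf (\<lambda>k. ennreal_potential n \<mu> (X k t) * indicator {0..T} t)"
          by (cases "t \<in> {0..T}") (auto simp: lim_imp_Liminf Liminf_const)
      qed
      also have "\<dots> \<le> liminf (\<lambda>k. P (X k))"
        unfolding P_def by (intro nn_integral_liminf action_eq(2)[OF \<mu> Xd])
      finally show ?thesis .
    qed
    \<comment> \<open>The potential takes the free index 0 next to the bodies 1 to n, so a single
      finite sum covers the whole action.\<close>
    define b where "b = (\<lambda>x i. if i = 0 then P x else ennreal (\<mu> / 2 * E x i))"
    have A_b: "A x = (\<Sum>i\<in>{0..n}. b x i)" if "x \<in> loop_space n T" for x
      unfolding A_eq[OF that] by (simp add: sum.atLeast_Suc_atMost b_def add.commute)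
    have "A y = (\<Sum>i\<in>{0..n}. b y i)" by (rule A_b[OF yl])
    also have "\<dots> \<le> (\<Sum>i\<in>{0..n}. liminf (\<lambda>k. b (X k) i))"
      using lsc P_lsc by (intro sum_mono) (auto simp: b_def)
    also have "\<dots> \<le> liminf (\<lambda>k. \<Sum>i\<in>{0..n}. b (X k) i)" by (rule sum_liminf_le) simp
    also have "\<dots> = liminf (\<lambda>k. A (X k))" using A_b[OF Xl] by simp
    also have "\<dots> \<le> liminf (\<lambda>k. m + ennreal (1 / real (Suc k)))"
    proof (intro Liminf_mono always_eventually allI)
      fix k
      have "A (X k) \<le> m + ennreal (1 / real (Suc (r k)))"
        using X0(2)[of "r k"] by (simp add: X_def less_imp_le)
      also have "\<dots> \<le> m + ennreal (1 / real (Suc k))"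
        using seq_suble[OF gr(2), of k] by (intro add_left_mono ennreal_leI frac_le) auto
      finally show "A (X k) \<le> m + ennreal (1 / real (Suc k))" .
    qed
    also have "\<dots> = m"
    proof -
      have "(\<lambda>k. m + ennreal (1 / real (Suc k))) \<longlonglongrightarrow> m + ennreal 0"
        by (intro tendsto_intros tendsto_ennrealI LIMSEQ_Suc[OF lim_1_over_n])
      then show ?thesis by (simp add: lim_imp_Liminf)
    qed
    finally have "A y \<le> m" .
    then show ?thesis
      using yS m_le unfolding minimizer_on_def A_def[symmetric] by (meson order_trans)
  qed
qed

section \<open>Loops with time-reflection symmetries\<close>

text \<open>One generator acting on time as t \<mapsto> a - t. The inverses of the loop action do
  not appear because the generators are involutions.\<close>

definition time_reflection_invariant ::
    "nat \<Rightarrow> (complex \<Rightarrow> complex) \<Rightarrow> real \<Rightarrow> (nat \<Rightarrow> nat) \<Rightarrow> (real \<Rightarrow> nat \<Rightarrow> complex) \<Rightarrow> bool" where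
  "time_reflection_invariant n A a s x \<longleftrightarrow> (\<forall>t. \<forall>i\<in>{1..n}. x t i = A (x (a - t) (s i)))"

definition symmetric_loops ::
    "nat \<Rightarrow> real \<Rightarrow> ((complex \<Rightarrow> complex) \<times> real \<times> (nat \<Rightarrow> nat)) set \<Rightarrow> (real \<Rightarrow> nat \<Rightarrow> complex) set" where
  "symmetric_loops n T Sym =
     {x \<in> loop_space n T. \<forall>(A, a, s)\<in>Sym. time_reflection_invariant n A a s x}"

definition plane_symmetries :: "nat \<Rightarrow> ((complex \<Rightarrow> complex) \<times> real \<times> (nat \<Rightarrow> nat)) set" where
  "plane_symmetries n = {(A, a, s). orthogonal_transformation A \<and> bij_betw s {1..n} {1..n}}"

lemma force_equivariant:
  assumes A: "orthogonal_transformation A" and s: "bij_betw s {1..n} {1..n}"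
    and q: "\<And>i. i \<in> {1..n} \<Longrightarrow> q i = A (q' (s i))" and i: "i \<in> {1..n}"
  shows "force n \<mu> q i = A (force n \<mu> q' (s i))"
proof -
  have lin: "linear A" and n: "norm (A u) = norm u" for u
    using A by (auto simp: orthogonal_transformation)
  have b: "bij_betw s ({1..n} - {i}) ({1..n} - {s i})"
    using s i by (auto simp: bij_betw_def inj_on_diff inj_on_image_set_diff[of s "{1..n}"])
  define g where "g = (\<lambda>j. (\<mu>\<^sup>2 / (norm (q' j - q' (s i))) ^ 3) *\<^sub>R (q' j - q' (s i)))"
  have "force n \<mu> q i = (\<Sum>j\<in>{1..n} - {i}. A (g (s j)))"
    unfolding force_def
  proof (intro sum.cong refl)
    fix j assume "j \<in> {1..n} - {i}"
    then have "q j - q i = A (q' (s j) - q' (s i))"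
      using q i by (simp add: linear_diff[OF lin])
    then show "(\<mu>\<^sup>2 / (norm (q j - q i)) ^ 3) *\<^sub>R (q j - q i) = A (g (s j))"
      by (simp add: g_def n linear_scale[OF lin])
  qed
  also have "\<dots> = A (\<Sum>j\<in>{1..n} - {i}. g (s j))"
    by (simp add: linear_sum[OF lin])
  also have "(\<Sum>j\<in>{1..n} - {i}. g (s j)) = force n \<mu> q' (s i)"
    unfolding force_def g_def using sum.reindex_bij_betw[OF b, of g] by (simp add: g_def)
  finally show ?thesis .
qed

lemma symmetric_loopsD:
  assumes "x \<in> symmetric_loops n T Sym"
  shows "x \<in> loop_space n T"
    and "(A, a, s) \<in> Sym \<Longrightarrow> i \<in> {1..n} \<Longrightarrow> x t i = A (x (a - t) (s i))"
  using assms unfolding symmetric_loops_def time_reflection_invariant_def by blast+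

lemma symmetric_loopsI:
  assumes "x \<in> loop_space n T"
    and "\<And>A a s i t. (A, a, s) \<in> Sym \<Longrightarrow> i \<in> {1..n} \<Longrightarrow> x t i = A (x (a - t) (s i))"
  shows "x \<in> symmetric_loops n T Sym"
  using assms unfolding symmetric_loops_def time_reflection_invariant_def by blast

lemma plane_symmetriesD:
  assumes "Sym \<subseteq> plane_symmetries n" "(A, a, s) \<in> Sym"
  shows "orthogonal_transformation A" "bij_betw s {1..n} {1..n}" "linear A" "bounded_linear A"
proof -
  show A: "orthogonal_transformation A" and "bij_betw s {1..n} {1..n}"
    using assms unfolding plane_symmetries_def by blast+
  from A show "linear A" by (rule orthogonal_transformation_linear)
  then show "bounded_linear A" by (simp add: linear_conv_bounded_linear)
qed

text \<open>H^1 is not closed under pointwise limits, hence the assumption on derivatives; all the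
  other conditions pass to the limit at each time separately.\<close>

lemma symmetric_loops_limit:
  assumes Sym: "Sym \<subseteq> plane_symmetries n" and X: "\<And>k. X k \<in> symmetric_loops n T Sym"
    and lim: "\<And>t i. (\<lambda>k. X k t i) \<longlonglongrightarrow> y t i"
    and d: "\<And>i. i \<in> {1..n} \<Longrightarrow> \<exists>v. has_L2_derivative T (\<lambda>t. y t i) v"
  shows "y \<in> symmetric_loops n T Sym"
proof (rule symmetric_loopsI)
  note Xl = symmetric_loopsD(1)[OF X]
  have "y t i = 0" if "i \<notin> {1..n}" for t i
  proof -
    have "X k t i = 0" for k using loop_space_config[OF Xl, of k t] that by (simp add: config_space_def)
    then show ?thesis using lim[of t i] by (simp add: LIMSEQ_const_iff)
  qed
  moreover have "(\<Sum>i=1..n. y t i) = 0" for t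
  proof -
    have "(\<lambda>k. \<Sum>i=1..n. X k t i) \<longlonglongrightarrow> (\<Sum>i=1..n. y t i)" by (intro tendsto_sum lim)
    moreover have "(\<Sum>i=1..n. X k t i) = 0" for k
      using loop_space_config[OF Xl, of k t] by (simp add: config_space_def)
    ultimately show ?thesis by (simp add: LIMSEQ_const_iff)
  qed
  moreover have "y (t + T) = y t" for t
  proof
    fix i
    have "X k (t + T) i = X k t i" for k using loop_space_periodic[OF Xl, of k t] by simp
    then show "y (t + T) i = y t i" using lim[of "t + T" i] lim[of t i] LIMSEQ_unique by simp
  qed
  ultimately show "y \<in> loop_space n T"
    unfolding loop_space_def config_space_def using d by blast
next
  fix A a s i t assume S: "(A, a, s) \<in> Sym" and i: "i \<in> {1..n}"
  have "(\<lambda>k. A (X k (a - t) (s i))) \<longlonglongrightarrow> A (y (a - t) (s i))"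
    by (rule bounded_linear.tendsto[OF plane_symmetriesD(4)[OF Sym S] lim])
  moreover have "A (X k (a - t) (s i)) = X k t i" for k
    using symmetric_loopsD(2)[OF X S i, of k t] by simp
  ultimately show "y t i = A (y (a - t) (s i))" using lim[of t i] LIMSEQ_unique by simp
qed

lemma symmetric_loops_add_scaleR:
  assumes Sym: "Sym \<subseteq> plane_symmetries n" and x: "x \<in> symmetric_loops n T Sym" and y: "y \<in> symmetric_loops n T Sym"
  shows "(\<lambda>t i. x t i + c *\<^sub>R y t i) \<in> symmetric_loops n T Sym"
proof (rule symmetric_loopsI)
  note xl = symmetric_loopsD(1)[OF x] and yl = symmetric_loopsD(1)[OF y]
  have "(\<lambda>i. x t i + c *\<^sub>R y t i) \<in> config_space n" for t
    using loop_space_config[OF xl, of t] loop_space_config[OF yl, of t]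
    by (simp add: config_space_def sum.distrib flip: scaleR_sum_right)
  moreover have "\<exists>v. has_L2_derivative T (\<lambda>t. x t i + c *\<^sub>R y t i) v" if "i \<in> {1..n}" for i
    using has_L2_derivative_add[OF loop_space_weak_derivative[OF xl that] loop_space_weak_derivative[OF yl that]]
    by blast
  ultimately show "(\<lambda>t i. x t i + c *\<^sub>R y t i) \<in> loop_space n T"
    using loop_space_periodic[OF xl] loop_space_periodic[OF yl] by (simp add: loop_space_def)
next
  fix A a s i t assume S: "(A, a, s) \<in> Sym" and i: "i \<in> {1..n}"
  show "x t i + c *\<^sub>R y t i = A (x (a - t) (s i) + c *\<^sub>R y (a - t) (s i))"
    using symmetric_loopsD(2)[OF x S i, of t] symmetric_loopsD(2)[OF y S i, of t] plane_symmetriesD(3)[OF Sym S]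
    by (simp add: linear_add linear_scale)
qed

lemma zero_symmetric_loop:
  assumes "Sym \<subseteq> plane_symmetries n"
  shows "(\<lambda>t i. 0) \<in> symmetric_loops n T Sym"
proof (rule symmetric_loopsI)
  have "has_L2_derivative T (\<lambda>t. 0) (\<lambda>t. 0)" by (rule has_L2_derivative_C1) auto
  then show "(\<lambda>t i. 0) \<in> loop_space n T" by (auto simp: loop_space_def config_space_def)
next
  fix A a s i t assume "(A, a, s) \<in> Sym"
  from plane_symmetriesD(3)[OF assms this] show "(0::complex) = A 0" by (simp add: linear_0)
qed

lemma loop_continuous:
  assumes "T > 0" "x \<in> loop_space n T"
  shows "continuous_on UNIV (\<lambda>t. x t i)"
proof (cases "i \<in> {1..n}")
  case True
  show ?thesis
    by (rule periodic_continuous[OF assms(1) L2_derivative_continuous[OF loop_space_weak_derivative[OF assms(2) True]]])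
      (simp add: loop_space_periodic[OF assms(2)])
next
  case False
  then have eq: "(\<lambda>t. x t i) = (\<lambda>t. 0)"
    using loop_space_config[OF assms(2)] by (auto simp: config_space_def)
  show ?thesis unfolding eq by (rule continuous_on_const)
qed

lemma force_continuous:
  assumes "T > 0" "x \<in> loop_space n T" "collision_free n x" "i \<in> {1..n}"
  shows "continuous_on UNIV (\<lambda>t. force n \<mu> (x t) i)"
  unfolding force_def using assms(3,4) loop_continuous[OF assms(1,2)]
  by (intro continuous_intros) (auto simp: collision_free_def)

text \<open>Time reflection leaves the integral over a period unchanged, so the mean forces obey the
  same relations as the loop, without the time argument.\<close>

lemma integral_force_equivariant:
  assumes T: "T > 0" and Sym: "Sym \<subseteq> plane_symmetries n" and x: "x \<in> symmetric_loops n T Sym"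
    and cf: "collision_free n x" and S: "(A, a, s) \<in> Sym" and i: "i \<in> {1..n}"
  shows "integral {0..T} (\<lambda>t. force n \<mu> (x t) i) = A (integral {0..T} (\<lambda>t. force n \<mu> (x t) (s i)))"
proof -
  note xl = symmetric_loopsD(1)[OF x]
  have si: "s i \<in> {1..n}" using bij_betwE[OF plane_symmetriesD(2)[OF Sym S]] i by blast
  note fc = force_continuous[OF T xl cf si, of \<mu>]
  have eq: "force n \<mu> (x t) i = A (force n \<mu> (x (a - t)) (s i))" for t
    by (rule force_equivariant[OF plane_symmetriesD(1,2)[OF Sym S] _ i]) (rule symmetric_loopsD(2)[OF x S])
  have "integral {0..T} (\<lambda>t. force n \<mu> (x t) i) = integral {0..T} (\<lambda>t. A (force n \<mu> (x (a - t)) (s i)))"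
    by (simp only: eq)
  also have "\<dots> = A (integral {0..T} (\<lambda>t. force n \<mu> (x (a - t)) (s i)))"
  proof -
    have "continuous_on {0..T} (\<lambda>t. force n \<mu> (x (a - t)) (s i))"
      by (rule continuous_on_compose2[OF fc]) (auto intro: continuous_intros)
    from integral_linear[OF integrable_continuous_real[OF this] plane_symmetriesD(4)[OF Sym S]]
    show ?thesis by (simp add: o_def)
  qed
  also have "integral {0..T} (\<lambda>t. force n \<mu> (x (a - t)) (s i)) = integral {0..T} (\<lambda>t. force n \<mu> (x t) (s i))"
    using T fc loop_space_periodic[OF xl] by (intro integral_periodic_reflect) auto
  finally show ?thesis .
qed

text \<open>The competitor is the symmetric loop \<open>z\<close> whose acceleration is the one that the forces along
  \<open>x\<close> prescribe; moving from \<open>x\<close> towards \<open>z\<close> lowers the action to first order unless \<open>x - z\<close> is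
  constant. This replaces the principle of symmetric criticality.\<close>

theorem symmetric_minimizer_newton:
  assumes T: "T > 0" and \<mu>: "\<mu> > 0" and Sym: "Sym \<subseteq> plane_symmetries n"
    and min: "minimizer_on (Lagrangian_action n T \<mu>) (symmetric_loops n T Sym) x"
    and cf: "collision_free n x"
    and mean: "\<And>i. i \<in> {1..n} \<Longrightarrow> integral {0..T} (\<lambda>t. force n \<mu> (x t) i) = 0"
  shows "newton_solution n \<mu> x"
proof -
  have x: "x \<in> symmetric_loops n T Sym" using min by (simp add: minimizer_on_def)
  note xl = symmetric_loopsD(1)[OF x]
  define f where "f = (\<lambda>i t. (1 / \<mu>) *\<^sub>R force n \<mu> (x t) i)"
  have fc: "continuous_on UNIV (f i)" if "i \<in> {1..n}" for i
    unfolding f_def by (intro continuous_intros force_continuous[OF T xl cf that])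
  have f_force: "\<mu> *\<^sub>R f i t = force n \<mu> (x t) i" for i t using \<mu> by (simp add: f_def)
  \<comment> \<open>Two periodic primitives in succession: zero mean of the forces permits the
    first, the normalization of \<open>p\<close> to mean zero permits the second.\<close>
  have "\<exists>p z. (\<forall>t. (p has_vector_derivative f i t) (at t)) \<and> (\<forall>t. p (t + T) = p t) \<and>
      (\<forall>t. (z has_vector_derivative p t) (at t)) \<and> (\<forall>t. z (t + T) = z t) \<and> integral {0..T} z = 0"
    if i: "i \<in> {1..n}" for i
  proof -
    have "integral {0..T} (f i) = 0" using mean[OF i] by (simp add: f_def)
    then obtain p where p: "\<forall>t. (p has_vector_derivative f i t) (at t)" "\<forall>t. p (t + T) = p t" "integral {0..T} p = 0"
      using periodic_primitive_exists[OF T fc[OF i]] loop_space_periodic[OF xl] by (auto simp: f_def)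
    moreover obtain z where "\<forall>t. (z has_vector_derivative p t) (at t)" "\<forall>t. z (t + T) = z t" "integral {0..T} z = 0"
      using periodic_primitive_exists[OF T vector_derivative_continuous] p by blast
    ultimately show ?thesis by blast
  qed
  then obtain P Z where
    P: "\<And>i t. i \<in> {1..n} \<Longrightarrow> (P i has_vector_derivative f i t) (at t)" and
    P_per: "\<And>i t. i \<in> {1..n} \<Longrightarrow> P i (t + T) = P i t" and
    Z: "\<And>i t. i \<in> {1..n} \<Longrightarrow> (Z i has_vector_derivative P i t) (at t)" and
    Z_per: "\<And>i t. i \<in> {1..n} \<Longrightarrow> Z i (t + T) = Z i t" and
    Z_mean: "\<And>i. i \<in> {1..n} \<Longrightarrow> integral {0..T} (Z i) = 0"
    by metis
  have Pc: "continuous_on S (P i)" if "i \<in> {1..n}" for i S using P[OF that] by (rule vector_derivative_continuous)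
  have Zc: "continuous_on S (Z i)" if "i \<in> {1..n}" for i S using Z[OF that] by (rule vector_derivative_continuous)
  define z where "z = (\<lambda>t i. if i \<in> {1..n} then Z i t else 0)"
  have z_eq: "z t i = Z i t" if "i \<in> {1..n}" for t i using that by (simp add: z_def)
  \<comment> \<open>The forces sum to zero, so the centre of mass of \<open>z\<close> has no
    acceleration and stays at the origin.\<close>
  have z_sum: "(\<Sum>i=1..n. Z i t) = 0" for t
  proof (rule periodic_second_derivative_zero[OF T])
    show "((\<lambda>t. \<Sum>i=1..n. Z i t) has_vector_derivative (\<Sum>i=1..n. P i t)) (at t)" for t
      by (intro has_vector_derivative_sum Z)
    have "(\<Sum>i=1..n. f i t) = 0" for t
      using sum_force[of n \<mu> "x t"] by (simp add: f_def flip: scaleR_sum_right)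
    then show "((\<lambda>t. \<Sum>i=1..n. P i t) has_vector_derivative 0) (at t)" for t
      using has_vector_derivative_sum[of "{1..n}" P "\<lambda>i. f i t" "at t"] P by simp
    show "(\<Sum>i=1..n. Z i (t + T)) = (\<Sum>i=1..n. Z i t)" for t
      by (intro sum.cong refl Z_per)
    have "integral {0..T} (\<lambda>t. \<Sum>i=1..n. Z i t) = (\<Sum>i=1..n. integral {0..T} (Z i))"
      by (intro integral_sum integrable_continuous_real Zc) auto
    then show "integral {0..T} (\<lambda>t. \<Sum>i=1..n. Z i t) = 0" using Z_mean by simp
  qed
  have zd: "has_L2_derivative T (\<lambda>t. z t i) (P i)" if "i \<in> {1..n}" for i
    unfolding z_eq[OF that] using Z[OF that] Pc[OF that] by (rule has_L2_derivative_C1)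
  have z: "z \<in> symmetric_loops n T Sym"
  proof (rule symmetric_loopsI)
    have "z t \<in> config_space n" for t
      using z_sum[of t] by (simp add: z_def config_space_def)
    moreover have "z (t + T) = z t" for t by (auto simp: z_def Z_per)
    ultimately show "z \<in> loop_space n T" using zd unfolding loop_space_def by blast
  next
    fix A a s i t assume S: "(A, a, s) \<in> Sym" and i: "i \<in> {1..n}"
    have si: "s i \<in> {1..n}" using bij_betwE[OF plane_symmetriesD(2)[OF Sym S]] i by blast
    note Ab = plane_symmetriesD(4)[OF Sym S] and Al = plane_symmetriesD(3)[OF Sym S]
    \<comment> \<open>The uniqueness principle applied to the defect of symmetry: equivariance of
      the forces makes its second derivative vanish.\<close>
    have "Z i t - A (Z (s i) (a - t)) = 0"
    proof (rule periodic_second_derivative_zero[OF T, where D = "\<lambda>t. Z i t - A (Z (s i) (a - t))"])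
      show "((\<lambda>t. Z i t - A (Z (s i) (a - t))) has_vector_derivative P i t + A (P (s i) (a - t))) (at t)" for t
        using has_vector_derivative_diff[OF Z[OF i]
            bounded_linear.has_vector_derivative[OF Ab vector_derivative_reflect[OF Z[OF si], of a t]]]
        by (simp add: linear_neg[OF Al])
      have "force n \<mu> (x t) i = A (force n \<mu> (x (a - t)) (s i))" for t
        by (rule force_equivariant[OF plane_symmetriesD(1,2)[OF Sym S] _ i]) (rule symmetric_loopsD(2)[OF x S])
      then have "f i t = A (f (s i) (a - t))" for t
        by (simp only: f_def linear_scale[OF Al])
      then show "((\<lambda>t. P i t + A (P (s i) (a - t))) has_vector_derivative 0) (at t)" for t
        using has_vector_derivative_add[OF P[OF i]
            bounded_linear.has_vector_derivative[OF Ab vector_derivative_reflect[OF P[OF si], of a t]]]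
        by (simp add: linear_neg[OF Al])
      have "Z (s i) (a - (t + T)) = Z (s i) (a - t)" for t
        using Z_per[OF si, of "a - (t + T)"] by simp
      then show "Z i (t + T) - A (Z (s i) (a - (t + T))) = Z i t - A (Z (s i) (a - t))" for t
        by (simp add: Z_per[OF i])
      have c: "continuous_on {0..T} (\<lambda>t. Z (s i) (a - t))"
        by (rule continuous_on_compose2[OF Zc[OF si, of UNIV]]) (auto intro: continuous_intros)
      have "integral {0..T} (\<lambda>t. A (Z (s i) (a - t))) = A (integral {0..T} (\<lambda>t. Z (s i) (a - t)))"
        using integral_linear[OF integrable_continuous_real[OF c] Ab] by (simp add: o_def)
      also have "integral {0..T} (\<lambda>t. Z (s i) (a - t)) = 0"
        using integral_periodic_reflect[of T "Z (s i)" a] T Zc[OF si] Z_per[OF si] Z_mean[OF si] by simp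
      finally have "integral {0..T} (\<lambda>t. A (Z (s i) (a - t))) = 0" by (simp add: linear_0[OF Al])
      moreover have "integral {0..T} (\<lambda>t. Z i t - A (Z (s i) (a - t))) =
          integral {0..T} (Z i) - integral {0..T} (\<lambda>t. A (Z (s i) (a - t)))"
        by (intro Henstock_Kurzweil_Integration.integral_diff integrable_continuous_real Zc i
            bounded_linear.continuous_on[OF Ab] c)
      ultimately show "integral {0..T} (\<lambda>t. Z i t - A (Z (s i) (a - t))) = 0" using Z_mean[OF i] by simp
    qed
    then show "z t i = A (z (a - t) (s i))" by (simp add: z_eq[OF i] z_eq[OF si])
  qed
  define h where "h = (\<lambda>t i. x t i + (-1) *\<^sub>R z t i)"
  have h: "h \<in> symmetric_loops n T Sym" unfolding h_def by (rule symmetric_loops_add_scaleR[OF Sym x z])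
  note hl = symmetric_loopsD(1)[OF h]
  define v where "v = (\<lambda>i. weak_derivative T (\<lambda>t. x t i))"
  define w where "w = (\<lambda>i t. v i t + (-1) *\<^sub>R P i t)"
  have xd: "has_L2_derivative T (\<lambda>t. x t i) (v i)" if "i \<in> {1..n}" for i
    unfolding v_def by (rule loop_space_weak_derivative[OF xl that])
  have hd: "has_L2_derivative T (\<lambda>t. h t i) (w i)" if "i \<in> {1..n}" for i
    unfolding h_def w_def by (rule has_L2_derivative_add[OF xd[OF that] zd[OF that]])
  have "\<mu> * (\<Sum>i=1..n. LINT t:{0..T}|lborel. v i t \<bullet> w i t)
    + (LINT t:{0..T}|lborel. (\<Sum>i=1..n. force n \<mu> (x t) i \<bullet> h t i)) \<le> 0"
  proof (rule first_variation_nonpos[OF \<mu> T xd hd])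
    show "x t i \<noteq> x t j" if "t \<in> {0..T}" "i \<in> {1..n}" "j \<in> {1..n}" "i \<noteq> j" for t i j
      using cf that unfolding collision_free_def by blast
    show "Lagrangian_action n T \<mu> x \<le> Lagrangian_action n T \<mu> (\<lambda>t i. x t i + - s *\<^sub>R h t i)" for s
      using min symmetric_loops_add_scaleR[OF Sym x h, of "- s"] unfolding minimizer_on_def by blast
  qed
  moreover have "(LINT t:{0..T}|lborel. (\<Sum>i=1..n. force n \<mu> (x t) i \<bullet> h t i))
      = (\<Sum>i=1..n. - \<mu> * (LINT t:{0..T}|lborel. P i t \<bullet> w i t))"
  proof -
    have int: "integrable lborel (\<lambda>t. indicator {0..T} t *\<^sub>R (force n \<mu> (x t) i \<bullet> h t i))" if "i \<in> {1..n}" for i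
    proof -
      have "set_integrable lborel {0..T} (\<lambda>t. force n \<mu> (x t) i \<bullet> h t i)"
        by (intro borel_integrable_atLeastAtMost' continuous_on_inner L2_derivative_continuous[OF hd[OF that]]
            continuous_on_subset[OF force_continuous[OF T xl cf that]]) simp
      then show ?thesis by (simp add: set_integrable_def)
    qed
    have "(LINT t:{0..T}|lborel. (\<Sum>i=1..n. force n \<mu> (x t) i \<bullet> h t i))
        = (\<Sum>i=1..n. LINT t:{0..T}|lborel. force n \<mu> (x t) i \<bullet> h t i)"
      unfolding set_lebesgue_integral_def scaleR_sum_right by (rule Bochner_Integration.integral_sum) (rule int)
    also have "\<dots> = (\<Sum>i=1..n. - \<mu> * (LINT t:{0..T}|lborel. P i t \<bullet> w i t))"
    proof (intro sum.cong refl)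
      fix i assume i: "i \<in> {1..n}"
      have "(LINT t:{0..T}|lborel. force n \<mu> (x t) i \<bullet> h t i) = (LINT t:{0..T}|lborel. \<mu> * (f i t \<bullet> h t i))"
        unfolding f_force[symmetric] by simp
      also have "\<dots> = \<mu> * (LINT t:{0..T}|lborel. f i t \<bullet> h t i)" by (rule set_integral_mult_right)
      \<comment> \<open>\<open>P i\<close> is at once the primitive of the scaled force and the
        velocity of \<open>z\<close>; this double role turns the first variation into a
        square.\<close>
      also have "(LINT t:{0..T}|lborel. f i t \<bullet> h t i) = - (LINT t:{0..T}|lborel. P i t \<bullet> w i t)"
        using T hd[OF i] loop_space_periodic[OF hl, of 0] P[OF i] fc[OF i] P_per[OF i, of 0]
        by (intro L2_derivative_by_parts) auto
      finally show "(LINT t:{0..T}|lborel. force n \<mu> (x t) i \<bullet> h t i) = - \<mu> * (LINT t:{0..T}|lborel. P i t \<bullet> w i t)"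
        by simp
    qed
    finally show ?thesis .
  qed
  moreover have "(\<Sum>i=1..n. energy T (w i)) =
      (\<Sum>i=1..n. (LINT t:{0..T}|lborel. v i t \<bullet> w i t) - (LINT t:{0..T}|lborel. P i t \<bullet> w i t))"
  proof (intro sum.cong refl)
    fix i assume i: "i \<in> {1..n}"
    note sv = L2_derivative_square_integrable[OF xd[OF i]] and sw = L2_derivative_square_integrable[OF hd[OF i]]
      and sp = L2_derivative_square_integrable[OF zd[OF i]]
    have "(norm (w i t))\<^sup>2 = v i t \<bullet> w i t - P i t \<bullet> w i t" for t
      unfolding power2_norm_eq_inner by (simp add: w_def inner_diff inner_commute)
    then show "energy T (w i) = (LINT t:{0..T}|lborel. v i t \<bullet> w i t) - (LINT t:{0..T}|lborel. P i t \<bullet> w i t)"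
      unfolding energy_def
      using square_integrable_inner[OF sv sw] square_integrable_inner[OF sp sw] by (simp add: set_integral_diff)
  qed
  ultimately have "\<mu> * (\<Sum>i=1..n. energy T (w i)) \<le> 0"
    by (simp add: sum_subtractf sum_distrib_left right_diff_distrib sum_negf)
  then have E0: "(\<Sum>i=1..n. energy T (w i)) \<le> 0" using \<mu> by (simp add: mult_le_0_iff)
  \<comment> \<open>Zero energy of \<open>x - z\<close> makes it constant on one period, hence
    everywhere; \<open>x\<close> is then as smooth as \<open>z\<close>.\<close>
  have x_eq: "x t i = Z i t + h 0 i" if i: "i \<in> {1..n}" for t i
  proof -
    have "energy T (w i) \<le> (\<Sum>i=1..n. energy T (w i))"
      using i by (intro member_le_sum) (auto simp: energy_nonneg)
    then have "energy T (w i) \<le> 0" using E0 by linarith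
    moreover have "t rmod T \<in> {0..T}" using T rmod_nonneg[of T t] rmod_le[of T t] by auto
    ultimately have "h (t rmod T) i = h 0 i" by (rule L2_derivative_energy_zero[OF hd[OF i]])
    moreover have "h (t rmod T) = h t" by (rule periodic_rmod[OF T]) (rule loop_space_periodic[OF hl])
    ultimately have "h t i = h 0 i" by simp
    then show ?thesis by (simp add: h_def z_eq[OF i] algebra_simps)
  qed
  have "((\<lambda>s. x s i) has_vector_derivative P i t) (at t) \<and>
      ((\<lambda>s. P i s) has_vector_derivative f i t) (at t) \<and>
      \<mu> *\<^sub>R f i t = (\<Sum>j\<in>{1..n} - {i}. (\<mu>\<^sup>2 / (norm (x t j - x t i)) ^ 3) *\<^sub>R (x t j - x t i))"
    if i: "i \<in> {1..n}" for t i
  proof (intro conjI)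
    have "((\<lambda>s. Z i s + h 0 i) has_vector_derivative P i t) (at t)"
      using has_vector_derivative_add[OF Z[OF i] has_vector_derivative_const[of "h 0 i"]] by simp
    then show "((\<lambda>s. x s i) has_vector_derivative P i t) (at t)" by (simp only: x_eq[OF i])
    show "((\<lambda>s. P i s) has_vector_derivative f i t) (at t)" by (rule P[OF i])
    show "\<mu> *\<^sub>R f i t = (\<Sum>j\<in>{1..n} - {i}. (\<mu>\<^sup>2 / (norm (x t j - x t i)) ^ 3) *\<^sub>R (x t j - x t i))"
      unfolding f_force force_def ..
  qed
  then show ?thesis
    unfolding newton_solution_def
    by (intro exI[of _ "\<lambda>t i. P i t"] exI[of _ "\<lambda>t i. f i t"]) blast
qed

section \<open>The dihedral group action\<close>

text \<open>Inversion reverses the order of the factors both in time and in the labels, which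
  matches the order of composition on loops. The intermediate time \<open>u\<close> already lies in
  \<open>{0..<T}\<close>, so its reduction modulo \<open>T\<close> changes nothing.\<close>

lemma loop_action_mult:
  assumes T: "T > 0" and G: "group G"
    and \<tau>: "group_action G {0..<T} \<tau>" and \<sigma>: "group_action G {1..n} \<sigma>"
    and \<rho>: "\<rho> \<in> hom G orthogonal_group" and gh: "g \<in> carrier G" "h \<in> carrier G"
  shows "loop_action G \<tau> \<rho> \<sigma> n T (g \<otimes>\<^bsub>G\<^esub> h) x =
    loop_action G \<tau> \<rho> \<sigma> n T g (loop_action G \<tau> \<rho> \<sigma> n T h x)"
proof (intro ext)
  fix t i
  interpret group G by (rule G)
  show "loop_action G \<tau> \<rho> \<sigma> n T (g \<otimes>\<^bsub>G\<^esub> h) x t i =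
    loop_action G \<tau> \<rho> \<sigma> n T g (loop_action G \<tau> \<rho> \<sigma> n T h x) t i"
  proof (cases "i \<in> {1..n}")
    case i: True
    have surj: "\<sigma> k ` {1..n} = {1..n}" and inj: "inj_on (\<sigma> k) {1..n}" if "k \<in> carrier G" for k
      using group_action.surj_prop[OF \<sigma> that] group_action.inj_prop[OF \<sigma> that] by auto
    define t' where "t' = t rmod T"
    have t': "t' \<in> {0..<T}" using T rmod_nonneg[of T t] rmod_less[of T t] by (simp add: t'_def)
    define u where "u = \<tau> (inv\<^bsub>G\<^esub> g) t'"
    have u: "u \<in> {0..<T}"
      unfolding u_def by (rule group_action.element_image[OF \<tau> _ t' refl]) (use gh in simp)
    then have u_mod: "u rmod T = u" by (intro rmod_idem) auto
    define j where "j = inv_into {1..n} (\<sigma> g) i"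
    have j: "j \<in> {1..n}" "\<sigma> g j = i"
      using inv_into_into[of i "\<sigma> g" "{1..n}"] f_inv_into_f[of i "\<sigma> g" "{1..n}"] surj[OF gh(1)] i
      by (auto simp: j_def)
    define k where "k = inv_into {1..n} (\<sigma> h) j"
    have k: "k \<in> {1..n}" "\<sigma> h k = j"
      using inv_into_into[of j "\<sigma> h" "{1..n}"] f_inv_into_f[of j "\<sigma> h" "{1..n}"] surj[OF gh(2)] j
      by (auto simp: k_def)
    have "\<sigma> (g \<otimes>\<^bsub>G\<^esub> h) k = i"
      using group_action.composition_rule[OF \<sigma> k(1) gh] k j by simp
    then have "inv_into {1..n} (\<sigma> (g \<otimes>\<^bsub>G\<^esub> h)) i = k"
      by (intro inv_into_f_eq inj k(1)) (use gh in simp_all)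
    moreover have "\<tau> (inv\<^bsub>G\<^esub> (g \<otimes>\<^bsub>G\<^esub> h)) t' = \<tau> (inv\<^bsub>G\<^esub> h) u"
      using group_action.composition_rule[OF \<tau> t', of "inv\<^bsub>G\<^esub> h" "inv\<^bsub>G\<^esub> g"] gh
      by (simp add: inv_mult_group u_def)
    moreover have "\<rho> (g \<otimes>\<^bsub>G\<^esub> h) = \<rho> g \<circ> \<rho> h"
      using \<rho> gh by (simp add: hom_def orthogonal_group_def)
    moreover have "loop_action G \<tau> \<rho> \<sigma> n T h x u j = \<rho> h (x (\<tau> (inv\<^bsub>G\<^esub> h) u) k)"
      by (simp only: loop_action_def j(1) if_True u_mod k_def)
    moreover have "loop_action G \<tau> \<rho> \<sigma> n T g y t i = \<rho> g (y u j)" for y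
      by (simp only: loop_action_def i if_True u_def j_def t'_def)
    moreover have "loop_action G \<tau> \<rho> \<sigma> n T (g \<otimes>\<^bsub>G\<^esub> h) x t i =
        \<rho> (g \<otimes>\<^bsub>G\<^esub> h) (x (\<tau> (inv\<^bsub>G\<^esub> (g \<otimes>\<^bsub>G\<^esub> h)) t') (inv_into {1..n} (\<sigma> (g \<otimes>\<^bsub>G\<^esub> h)) i))"
      by (simp only: loop_action_def i if_True t'_def)
    ultimately show ?thesis by (simp only: o_def)
  qed (auto simp: loop_action_def)
qed

text \<open>An involution is its own inverse, which removes both inverses from the loop action;
  periodicity of \<open>x\<close> absorbs the reductions modulo \<open>T\<close>.\<close>

lemma loop_action_involution:
  assumes T: "T > 0" and G: "group G" and h: "h \<in> carrier G" "h \<otimes>\<^bsub>G\<^esub> h = \<one>\<^bsub>G\<^esub>"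
    and \<tau>: "\<And>t. t \<in> {0..<T} \<Longrightarrow> \<tau> h t = (a - t) rmod T"
    and s: "\<And>i. i \<in> {1..n} \<Longrightarrow> \<sigma> h i = s i" "\<And>i. i \<in> {1..n} \<Longrightarrow> s i \<in> {1..n}" "\<And>i. i \<in> {1..n} \<Longrightarrow> s (s i) = i"
    and x: "x \<in> loop_space n T"
  shows "loop_action G \<tau> \<rho> \<sigma> n T h x = x \<longleftrightarrow> time_reflection_invariant n (\<rho> h) a s x"
proof -
  have inv: "inv\<^bsub>G\<^esub> h = h" using G h by (simp add: group.inv_equality)
  have "inv_into {1..n} (\<sigma> h) i = s i" if "i \<in> {1..n}" for i
  proof (rule inv_into_f_eq)
    show "inj_on (\<sigma> h) {1..n}" using s(1,3) by (metis (no_types, lifting) inj_on_def)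
  qed (use that s in auto)
  moreover have "x (\<tau> h (t rmod T)) = x (a - t)" for t
  proof -
    have "t rmod T \<in> {0..<T}" using T rmod_nonneg[of T t] rmod_less[of T t] by simp
    then have "x (\<tau> h (t rmod T)) = x ((a - t rmod T) rmod T)" by (simp add: \<tau>)
    also have "\<dots> = x (a - t rmod T)"
      by (rule periodic_rmod[OF T]) (rule loop_space_periodic[OF x])
    also have "\<dots> = x (a - t)"
    proof (rule periodic_rmod[OF T, where f = "\<lambda>t. x (a - t)"])
      show "x (a - (t + T)) = x (a - t)" for t
        using loop_space_periodic[OF x, of "a - (t + T)"] by simp
    qed
    finally show ?thesis .
  qed
  ultimately have "loop_action G \<tau> \<rho> \<sigma> n T h x t i = (if i \<in> {1..n} then \<rho> h (x (a - t) (s i)) else 0)" for t i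
    unfolding loop_action_def inv by simp
  moreover have "x t i = 0" if "i \<notin> {1..n}" for t i
    using loop_space_config[OF x, of t] that by (simp add: config_space_def)
  ultimately show ?thesis
    unfolding time_reflection_invariant_def fun_eq_iff by (metis (full_types))
qed

text \<open>Invariance propagates from the generators to the group by multiplicativity of the
  action. The identity is reached as the square of \<open>h1\<close>, and the inverse of a generator
  is the generator itself.\<close>

lemma invariant_loops_eq:
  assumes T: "T > 0" and G: "group G" and h1: "h1 \<in> carrier G" "h1 \<otimes>\<^bsub>G\<^esub> h1 = \<one>\<^bsub>G\<^esub>"
    and h2: "h2 \<in> carrier G" "h2 \<otimes>\<^bsub>G\<^esub> h2 = \<one>\<^bsub>G\<^esub>" and gen: "generate G {h1, h2} = carrier G"
    and \<tau>: "group_action G {0..<T} \<tau>" and \<sigma>: "group_action G {1..n} \<sigma>" and \<rho>: "\<rho> \<in> hom G orthogonal_group"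
    and \<tau>1: "\<And>t. t \<in> {0..<T} \<Longrightarrow> \<tau> h1 t = (a1 - t) rmod T" and \<tau>2: "\<And>t. t \<in> {0..<T} \<Longrightarrow> \<tau> h2 t = (a2 - t) rmod T"
    and s1: "\<And>i. i \<in> {1..n} \<Longrightarrow> \<sigma> h1 i = s1 i" "\<And>i. i \<in> {1..n} \<Longrightarrow> s1 i \<in> {1..n}" "\<And>i. i \<in> {1..n} \<Longrightarrow> s1 (s1 i) = i"
    and s2: "\<And>i. i \<in> {1..n} \<Longrightarrow> \<sigma> h2 i = s2 i" "\<And>i. i \<in> {1..n} \<Longrightarrow> s2 i \<in> {1..n}" "\<And>i. i \<in> {1..n} \<Longrightarrow> s2 (s2 i) = i"
  shows "invariant_loops G \<tau> \<rho> \<sigma> n T = symmetric_loops n T {(\<rho> h1, a1, s1), (\<rho> h2, a2, s2)}"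
proof -
  interpret group G by (rule G)
  let ?act = "loop_action G \<tau> \<rho> \<sigma> n T"
  note mult = loop_action_mult[OF T G \<tau> \<sigma> \<rho>]
  have "?act g x = x" if fix1: "?act h1 x = x" and fix2: "?act h2 x = x" and "g \<in> generate G {h1, h2}" for x g
    using that(3)
  proof (induction rule: generate.induct)
    case one
    have "?act (h1 \<otimes>\<^bsub>G\<^esub> h1) x = ?act h1 (?act h1 x)" by (rule mult[OF h1(1) h1(1)])
    then show ?case using fix1 h1(2) by simp
  next
    case (incl h)
    then show ?case using fix1 fix2 by auto
  next
    case (inv h)
    moreover have "inv\<^bsub>G\<^esub> h1 = h1" "inv\<^bsub>G\<^esub> h2 = h2" using h1 h2 by (auto intro: inv_equality)
    ultimately show ?case using fix1 fix2 by auto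
  next
    case (eng g h)
    then show ?case using mult[of g h] gen by simp
  qed
  then have "(\<forall>g\<in>carrier G. ?act g x = x) \<longleftrightarrow> ?act h1 x = x \<and> ?act h2 x = x" for x
    using gen h1(1) h2(1) by metis
  moreover have inv1: "?act h1 x = x \<longleftrightarrow> time_reflection_invariant n (\<rho> h1) a1 s1 x"
    if "x \<in> loop_space n T" for x
    by (rule loop_action_involution[OF T G h1 _ _ _ _ that]) (erule \<tau>1 s1)+
  moreover have inv2: "?act h2 x = x \<longleftrightarrow> time_reflection_invariant n (\<rho> h2) a2 s2 x"
    if "x \<in> loop_space n T" for x
    by (rule loop_action_involution[OF T G h2 _ _ _ _ that]) (erule \<tau>2 s2)+
  ultimately show ?thesis
    unfolding invariant_loops_def symmetric_loops_def using inv1 inv2 by auto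
qed

section \<open>Cyclic relabelling and choreographies\<close>

lemma cyclic_induct:
  assumes "P (n :: nat)" "\<And>i. i \<in> {1..n} \<Longrightarrow> P i \<Longrightarrow> P (i mod n + 1)" "i \<in> {1..n}"
  shows "P i"
proof -
  have "P (Suc k)" if "Suc k \<le> n" for k
    using that
  proof (induction k)
    case 0
    then show ?case using assms(2)[of n] assms(1) by simp
  next
    case (Suc k)
    then show ?case using assms(2)[of "Suc k"] by simp
  qed
  then show ?thesis using assms(3) by (cases i) auto
qed

text \<open>The class of 0 is represented by \<open>n\<close>, so it needs an argument of its own: a
  positive multiple of \<open>n\<close> that is at most \<open>n\<close> equals
  \<open>n\<close>.\<close>

lemma cong_eq_Icc:
  assumes "[a = b] (mod n)" "a \<in> {1..n}" "b \<in> {1..n :: nat}"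
  shows "a = b"
proof (cases "a = n \<or> b = n")
  case True
  then have "n dvd a" "n dvd b" using assms(1) by (auto simp: cong_def dvd_eq_mod_eq_0)
  then show ?thesis using assms(2,3) by (auto dest!: dvd_imp_le)
next
  case False
  then show ?thesis using assms by (auto simp: cong_def)
qed

text \<open>If advancing the time by T/n advances the label by \<open>k\<close>, the labels along
  the choreography must decrease by \<open>k\<close> at each step: \<open>\<pi> i\<close> is the
  representative of -k i in 1..n. Coprimality of \<open>k\<close> and \<open>n\<close> makes this a
  permutation.\<close>

lemma choreography_if_shift:
  assumes n: "n > 0" and k: "coprime k n"
    and f: "\<And>i. i \<in> {1..n} \<Longrightarrow> f i \<in> {1..n}" "\<And>i. i \<in> {1..n} \<Longrightarrow> [f i = i + k] (mod n)"
    and x: "\<And>t i. i \<in> {1..n} \<Longrightarrow> x t i = x (t + T / real n) (f i)"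
  shows "choreography n T x"
proof -
  define \<pi> where "\<pi> = (\<lambda>i. if i \<in> {1..n} then n - (k * i) mod n else i)"
  have \<pi>_in: "\<pi> i \<in> {1..n}" if "i \<in> {1..n}" for i
  proof -
    define r where "r = (k * i) mod n"
    have "r < n" using n by (simp add: r_def)
    moreover have "\<pi> i = n - r" using that by (simp add: \<pi>_def r_def)
    ultimately show ?thesis by simp
  qed
  have \<pi>_cong: "[\<pi> i + k * i = 0] (mod n)" if "i \<in> {1..n}" for i
  proof -
    have "[\<pi> i + k * i = \<pi> i + (k * i) mod n] (mod n)" by (simp add: cong_def mod_add_right_eq)
    also have "\<pi> i + (k * i) mod n = n" using that n by (simp add: \<pi>_def less_imp_le)
    finally show ?thesis by (simp add: cong_def)
  qed
  have inj: "inj_on \<pi> {1..n}"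
  proof (rule inj_onI)
    fix i j assume ij: "i \<in> {1..n}" "j \<in> {1..n}" "\<pi> i = \<pi> j"
    have "[\<pi> i + k * i = \<pi> i + k * j] (mod n)"
      using \<pi>_cong[OF ij(1)] \<pi>_cong[OF ij(2)] ij(3) by (metis cong_sym cong_trans)
    then have "[k * i = k * j] (mod n)" by (simp add: cong_add_lcancel_nat)
    then have "[i = j] (mod n)" using k by (simp add: cong_mult_lcancel_nat)
    then show "i = j" using ij by (intro cong_eq_Icc)
  qed
  have "\<pi> ` {1..n} = {1..n}"
    by (rule endo_inj_surj[OF _ _ inj]) (use \<pi>_in in blast)+
  then have "bij_betw \<pi> {1..n} {1..n}" using inj by (simp add: bij_betw_def)
  then have "\<pi> permutes {1..n}" by (rule bij_imp_permutes) (auto simp: \<pi>_def)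
  moreover have "x t (\<pi> (i mod n + 1)) = x (t + T / real n) (\<pi> i)" if i: "i \<in> {1..n}" for i t
  proof -
    define j where "j = i mod n + 1"
    have j: "j \<in> {1..n}" using n by (simp add: j_def Suc_leI)
    have "[f (\<pi> j) + k * i = (\<pi> j + k) + k * i] (mod n)"
      by (intro cong_add f(2) \<pi>_in j) simp
    also have "[(\<pi> j + k) + k * i = \<pi> j + k * (i + 1)] (mod n)" by (simp add: algebra_simps)
    also have "[\<pi> j + k * (i + 1) = \<pi> j + k * j] (mod n)"
      by (intro cong_add cong_mult) (simp_all add: j_def cong_def mod_Suc_eq)
    also have "[\<pi> j + k * j = \<pi> i + k * i] (mod n)"
      using \<pi>_cong[OF j] \<pi>_cong[OF i] by (metis cong_sym cong_trans)
    finally have "[f (\<pi> j) = \<pi> i] (mod n)" by (simp add: cong_add_rcancel_nat)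
    then have "f (\<pi> j) = \<pi> i" by (rule cong_eq_Icc) (intro f(1) \<pi>_in i j)+
    then show ?thesis using x[OF \<pi>_in[OF j], of t] by (simp add: j_def)
  qed
  ultimately show ?thesis unfolding choreography_def by blast
qed

section \<open>Minimizers for the two dihedral actions\<close>

theorem mainTheorem10:
  fixes n L :: nat and T \<mu> :: real
    and G :: "'g monoid" and h1 h2 :: 'g
    and \<tau> :: "'g \<Rightarrow> real \<Rightarrow> real"
    and \<rho> :: "'g \<Rightarrow> complex \<Rightarrow> complex"
    and \<sigma> :: "'g \<Rightarrow> nat \<Rightarrow> nat"
  defines "\<Lambda>G \<equiv> invariant_loops G \<tau> \<rho> \<sigma> n T"
    and "\<A> \<equiv> Lagrangian_action n T \<mu>"
  assumes "n > 3" and "odd n" and "T > 0" and "\<mu> > 0"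
    and "dihedral_group L G h1 h2"
    and "group_action G {0..<T} \<tau>"
    and "\<And>t. t \<in> {0..<T} \<Longrightarrow> \<tau> h1 t = (- t) rmod T"
    and "\<And>t. t \<in> {0..<T} \<Longrightarrow> \<tau> h2 t = (T / real L - t) rmod T"
    and "group_action G {1..n} \<sigma>"
    and "\<And>i. i \<in> {1..n} \<Longrightarrow> [\<sigma> h1 i = n - i] (mod n)"
    and "\<And>i. i \<in> {1..n} \<Longrightarrow> [\<sigma> h2 i = n - i + 1] (mod n)"
    and "\<rho> \<in> hom G orthogonal_group"
    and "L = n \<and> \<rho> h1 = rotation pi \<and> \<rho> h2 = rotation pi \<or>
         L = 2 * n \<and> \<rho> h1 = rotation pi \<and> is_reflection (\<rho> h2)"
    and "\<And>x. local_minimizer_on n T \<A> \<Lambda>G x \<Longrightarrow> collision_free n x"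
  shows "coercive_on n T \<A> \<Lambda>G \<and>
         (\<exists>x. minimizer_on \<A> \<Lambda>G x) \<and>
         (\<forall>x. minimizer_on \<A> \<Lambda>G x \<longrightarrow>
            collision_free n x \<and> (\<forall>t. x (t + T) = x t) \<and> newton_solution n \<mu> x \<and>
            choreography n T x \<and> \<not> homographic n x)"
proof -
  note T = \<open>T > 0\<close> and \<mu> = \<open>\<mu> > 0\<close>
  note \<tau> = \<open>group_action G {0..<T} \<tau>\<close> and \<sigma> = \<open>group_action G {1..n} \<sigma>\<close>
  note \<rho> = \<open>\<rho> \<in> hom G orthogonal_group\<close>
  note \<tau>h = \<open>\<And>t. t \<in> {0..<T} \<Longrightarrow> \<tau> h1 t = (- t) rmod T\<close>
    \<open>\<And>t. t \<in> {0..<T} \<Longrightarrow> \<tau> h2 t = (T / real L - t) rmod T\<close>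
  note \<sigma>h = \<open>\<And>i. i \<in> {1..n} \<Longrightarrow> [\<sigma> h1 i = n - i] (mod n)\<close>
    \<open>\<And>i. i \<in> {1..n} \<Longrightarrow> [\<sigma> h2 i = n - i + 1] (mod n)\<close>
  note cases = \<open>L = n \<and> \<rho> h1 = rotation pi \<and> \<rho> h2 = rotation pi \<or>
         L = 2 * n \<and> \<rho> h1 = rotation pi \<and> is_reflection (\<rho> h2)\<close>
  note cf_local = \<open>\<And>x. local_minimizer_on n T \<A> \<Lambda>G x \<Longrightarrow> collision_free n x\<close>
  have n: "n > 3" and n0: "n > 0" and nn: "n \<in> {1..n}" using \<open>n > 3\<close> by auto
  have G: "group G" and h: "h1 \<in> carrier G" "h1 \<otimes>\<^bsub>G\<^esub> h1 = \<one>\<^bsub>G\<^esub>" "h2 \<in> carrier G" "h2 \<otimes>\<^bsub>G\<^esub> h2 = \<one>\<^bsub>G\<^esub>"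
    and gen: "generate G {h1, h2} = carrier G"
    using \<open>dihedral_group L G h1 h2\<close> by (auto simp: dihedral_group_def)
  define R where "R = \<rho> h2"
  define c where "c = T / real L"
  have rot: "rotation pi = uminus" by (auto simp: rotation_def)
  have \<rho>1: "\<rho> h1 = uminus" using cases rot by auto
  have orth: "orthogonal_transformation (\<rho> g)" if "g \<in> carrier G" for g
    using \<rho> that by (auto simp: hom_def orthogonal_group_def)
  have R_orth: "orthogonal_transformation R" unfolding R_def by (rule orth[OF h(3)])
  have R_lin: "linear R" using R_orth by (rule orthogonal_transformation_linear)
  have R_zero: "R z = 0 \<longleftrightarrow> z = 0" for z
    using R_orth by (metis norm_eq_zero orthogonal_transformation)
  \<comment> \<open>The value of \<open>\<rho>\<close> at the identity is read off from
    \<open>h1\<close>: since \<open>\<rho> h1\<close> is the half turn, its square is the identity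
    map. Hence \<open>R\<close> is an involution.\<close>
  have R_R: "R (R z) = z" for z
  proof -
    have "\<rho> h2 \<circ> \<rho> h2 = \<rho> h1 \<circ> \<rho> h1"
      using hom_mult[OF \<rho> h(1) h(1)] hom_mult[OF \<rho> h(3) h(3)] h by (simp add: orthogonal_group_def)
    then show ?thesis unfolding R_def by (simp add: fun_eq_iff \<rho>1)
  qed
  \<comment> \<open>Representatives in 1..n: \<open>n - i\<close> would give 0 at
    \<open>i = n\<close>, while \<open>n - i + 1\<close> never leaves the range.\<close>
  define s1 where "s1 = (\<lambda>i. if i = n then n else n - i)"
  define s2 where "s2 = (\<lambda>i. n - i + 1)"
  have s1: "s1 i \<in> {1..n}" "s1 (s1 i) = i" and s2: "s2 i \<in> {1..n}" "s2 (s2 i) = i"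
    and s21: "s2 (s1 i) = i mod n + 1" if "i \<in> {1..n}" for i
    using that n0 by (auto simp: s1_def s2_def)
  have \<sigma>1: "\<sigma> h1 i = s1 i" and \<sigma>2: "\<sigma> h2 i = s2 i" if i: "i \<in> {1..n}" for i
  proof -
    have "\<sigma> h1 i \<in> {1..n}" "\<sigma> h2 i \<in> {1..n}"
      using group_action.element_image[OF \<sigma> _ i refl] h by blast+
    moreover have "[\<sigma> h1 i = s1 i] (mod n)" "[\<sigma> h2 i = s2 i] (mod n)"
      using \<sigma>h[OF i] by (auto simp: s1_def s2_def cong_def)
    ultimately show "\<sigma> h1 i = s1 i" "\<sigma> h2 i = s2 i" using s1(1)[OF i] s2(1)[OF i] by (auto intro: cong_eq_Icc)
  qed
  define Sym where "Sym = {(uminus, 0, s1), (R, c, s2)}"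
  have Sym: "Sym \<subseteq> plane_symmetries n"
  proof -
    have "bij_betw s1 {1..n} {1..n}"
      using s1 by (intro bij_betw_byWitness[where f' = s1]) auto
    moreover have "bij_betw s2 {1..n} {1..n}"
      using s2 by (intro bij_betw_byWitness[where f' = s2]) auto
    ultimately show ?thesis
      using R_orth orth[OF h(1)] by (simp add: Sym_def plane_symmetries_def \<rho>1)
  qed
  have \<Lambda>: "\<Lambda>G = symmetric_loops n T Sym"
  proof -
    have "invariant_loops G \<tau> \<rho> \<sigma> n T = symmetric_loops n T {(\<rho> h1, 0, s1), (\<rho> h2, c, s2)}"
    proof (rule invariant_loops_eq[OF T G h gen \<tau> \<sigma> \<rho>])
      show "\<tau> h1 t = (0 - t) rmod T" if "t \<in> {0..<T}" for t using \<tau>h(1)[OF that] by simp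
      show "\<tau> h2 t = (c - t) rmod T" if "t \<in> {0..<T}" for t using \<tau>h(2)[OF that] by (simp add: c_def)
    qed (fact \<sigma>1 s1 \<sigma>2 s2)+
    then show ?thesis by (simp add: \<Lambda>G_def Sym_def R_def \<rho>1)
  qed
  have in_Sym: "(uminus, 0, s1) \<in> Sym" "(R, c, s2) \<in> Sym" by (auto simp: Sym_def)
  \<comment> \<open>\<open>h1\<close> is used at time t and \<open>h2\<close> at time -t: the two
    reflections compose to a translation by \<open>c\<close>, and \<open>s2\<close> after
    \<open>s1\<close> is the cyclic successor.\<close>
  have shift: "x t i = - R (x (t + c) (i mod n + 1))" if x: "x \<in> \<Lambda>G" and i: "i \<in> {1..n}" for x t i
    using symmetric_loopsD(2)[OF x[unfolded \<Lambda>] in_Sym(1) i, of t]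
      symmetric_loopsD(2)[OF x[unfolded \<Lambda>] in_Sym(2) s1(1)[OF i], of "- t"] s21[OF i]
    by (simp add: add.commute)
  \<comment> \<open>The index \<open>n\<close> is fixed by \<open>s1\<close> and the time 0 by t
    \<mapsto> -t, so the half turn must fix x_n(0).\<close>
  have xn0: "x 0 n = 0" if x: "x \<in> \<Lambda>G" for x
  proof -
    have "x 0 n = - x 0 n"
      using symmetric_loopsD(2)[OF x[unfolded \<Lambda>] in_Sym(1) nn, of 0] by (simp add: s1_def)
    then show ?thesis by simp
  qed
  have \<Lambda>_loop: "x \<in> loop_space n T" if "x \<in> \<Lambda>G" for x
    using symmetric_loopsD(1) that unfolding \<Lambda> .
  have zeros: "\<exists>t\<in>{0..T}. x t i = 0" if x: "x \<in> \<Lambda>G" and i: "i \<in> {1..n}" for x i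
  proof -
    have "\<exists>t. x t i = 0"
    proof (rule cyclic_induct[OF _ _ i])
      show "\<exists>t. x t n = 0" using xn0[OF x] by blast
      fix j assume j: "j \<in> {1..n}" "\<exists>t. x t j = 0"
      then obtain t where "x t j = 0" by blast
      then have "x (t + c) (j mod n + 1) = 0" using shift[OF x j(1), of t] R_zero by simp
      then show "\<exists>t. x t (j mod n + 1) = 0" by blast
    qed
    then obtain t where "x t i = 0" by blast
    moreover have "x (t rmod T) = x t"
      by (rule periodic_rmod[OF T]) (rule loop_space_periodic[OF \<Lambda>_loop[OF x]])
    moreover have "t rmod T \<in> {0..T}" using T rmod_nonneg[of T t] rmod_le[of T t] by simp
    ultimately show ?thesis by metis
  qed
  have \<Lambda>_sub: "\<Lambda>G \<subseteq> loop_space n T" using \<Lambda>_loop by blast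
  have "coercive_on n T \<A> \<Lambda>G"
    unfolding \<A>_def by (rule coercive_on_if_zeros[OF T \<mu> \<Lambda>_sub]) (rule zeros)
  moreover have "\<exists>x. minimizer_on \<A> \<Lambda>G x"
    unfolding \<A>_def
  proof (rule action_minimizer_exists[OF T \<mu> \<Lambda>_sub])
    \<comment> \<open>The zero loop is a permanent total collision of infinite action; it serves
      only as a witness of nonemptiness.\<close>
    show "\<Lambda>G \<noteq> {}" using zero_symmetric_loop[OF Sym] unfolding \<Lambda> by blast
    show "\<exists>t\<in>{0..T}. x t i = 0" if "x \<in> \<Lambda>G" "i \<in> {1..n}" for x i using that by (rule zeros)
    show "y \<in> \<Lambda>G"
      if "\<And>k. X k \<in> \<Lambda>G" "\<And>t i. (\<lambda>k. X k t i) \<longlonglongrightarrow> y t i"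
        "\<And>i. i \<in> {1..n} \<Longrightarrow> \<exists>v. has_L2_derivative T (\<lambda>t. y t i) v" for X y
      using that unfolding \<Lambda> by (rule symmetric_loops_limit[OF Sym])
  qed
  moreover have "collision_free n x \<and> (\<forall>t. x (t + T) = x t) \<and> newton_solution n \<mu> x \<and>
            choreography n T x \<and> \<not> homographic n x" if min: "minimizer_on \<A> \<Lambda>G x" for x
  proof (intro conjI allI)
    have x: "x \<in> \<Lambda>G" using min by (simp add: minimizer_on_def)
    \<comment> \<open>A global minimizer is a local one for any radius, so the assumption on
      collisions applies to it.\<close>
    have "local_minimizer_on n T \<A> \<Lambda>G x"
      using min by (auto simp: minimizer_on_def local_minimizer_on_def intro: exI[of _ 1])
    then show cf: "collision_free n x" by (rule cf_local)
    show "x (t + T) = x t" for t by (rule loop_space_periodic[OF \<Lambda>_loop[OF x]])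
    define m where "m = (\<lambda>i. integral {0..T} (\<lambda>t. force n \<mu> (x t) i))"
    have m_eq: "m i = A (m (s i))" if "(A, a, s) \<in> Sym" "i \<in> {1..n}" for A a s i
      unfolding m_def by (rule integral_force_equivariant[OF T Sym x[unfolded \<Lambda>] cf that])
    \<comment> \<open>The argument used for the zeros of the bodies, now for the mean forces: body
      \<open>n\<close> starts with \<open>m n = - m n\<close>, and the cyclic relation carries zero
      around.\<close>
    have m0: "m i = 0" if i: "i \<in> {1..n}" for i
    proof (rule cyclic_induct[OF _ _ i])
      have "m n = - m n" using m_eq[OF in_Sym(1) nn] by (simp add: s1_def)
      then show "m n = 0" by simp
      fix j assume j: "j \<in> {1..n}" "m j = 0"
      have "m j = - R (m (j mod n + 1))"
        using m_eq[OF in_Sym(1) j(1)] m_eq[OF in_Sym(2) s1(1)[OF j(1)]] s21[OF j(1)] by simp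
      then show "m (j mod n + 1) = 0" using j(2) R_zero by simp
    qed
    show "newton_solution n \<mu> x"
      by (rule symmetric_minimizer_newton[OF T \<mu> Sym min[unfolded \<A>_def \<Lambda>] cf m0[unfolded m_def]])
    show "choreography n T x"
      using cases
    proof
      \<comment> \<open>Here \<open>R\<close> is the half turn as well, so \<open>- R\<close> is the
        identity and \<open>c = T / n\<close> is already the choreographic shift.\<close>
      assume case1: "L = n \<and> \<rho> h1 = rotation pi \<and> \<rho> h2 = rotation pi"
      show ?thesis
      proof (rule choreography_if_shift[where k = 1 and f = "\<lambda>i. i mod n + 1", OF n0])
        show "i mod n + 1 \<in> {1..n}" for i using n0 by (simp add: Suc_leI)
        show "[i mod n + 1 = i + 1] (mod n)" for i by (simp add: cong_def mod_Suc_eq)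
        show "x t i = x (t + T / real n) (i mod n + 1)" if "i \<in> {1..n}" for t i
          using shift[OF x that, of t] case1 by (simp add: R_def rot c_def)
      qed simp
    next
      \<comment> \<open>Now \<open>- R\<close> is a reflection; applying the relation twice cancels
        it and doubles \<open>c = T / (2 n)\<close> to \<open>T / n\<close>. The labels then advance
        by 2, which reaches all residues because \<open>n\<close> is odd.\<close>
      assume case2: "L = 2 * n \<and> \<rho> h1 = rotation pi \<and> is_reflection (\<rho> h2)"
      show ?thesis
      proof (rule choreography_if_shift[where k = 2 and f = "\<lambda>i. (i mod n + 1) mod n + 1", OF n0])
        show "coprime 2 n" using \<open>odd n\<close> by simp
        show "(i mod n + 1) mod n + 1 \<in> {1..n}" for i using n0 by (simp add: Suc_leI)
        show "[(i mod n + 1) mod n + 1 = i + 2] (mod n)" for i by (simp add: cong_def mod_Suc_eq)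
        show "x t i = x (t + T / real n) ((i mod n + 1) mod n + 1)" if i: "i \<in> {1..n}" for t i
        proof -
          have i': "i mod n + 1 \<in> {1..n}" using n0 by (simp add: Suc_leI)
          have "x t i = - R (- R (x (t + c + c) ((i mod n + 1) mod n + 1)))"
            using shift[OF x i, of t] shift[OF x i', of "t + c"] by simp
          also have "\<dots> = x (t + c + c) ((i mod n + 1) mod n + 1)"
            by (simp add: linear_neg[OF R_lin] R_R)
          also have "t + c + c = t + T / real n" using case2 by (simp add: c_def)
          finally show ?thesis .
        qed
      qed
    qed
    show "\<not> homographic n x"
    proof
      assume "homographic n x"
      then obtain s where s: "\<And>t i. i \<in> {1..n} \<Longrightarrow> x t i = s t * x 0 i"
        unfolding homographic_def by blast
      have all0: "\<forall>t. x t i = 0" if i: "i \<in> {1..n}" for i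
      proof (rule cyclic_induct[OF _ _ i])
        show "\<forall>t. x t n = 0" using s[OF nn] xn0[OF x] by simp
        fix j assume j: "j \<in> {1..n}" "\<forall>t. x t j = 0"
        have "x t (j mod n + 1) = 0" for t
          using shift[OF x j(1), of "t - c"] j(2) R_zero by simp
        then show "\<forall>t. x t (j mod n + 1) = 0" by blast
      qed
      have "1 \<in> {1..n}" "2 \<in> {1..n}" using n by auto
      then have "x 0 1 = x 0 2" using all0 by simp
      moreover have "x 0 1 \<noteq> x 0 2" using cf n unfolding collision_free_def by auto
      ultimately show False by blast
    qed
  qed
  ultimately show ?thesis by blast
qed

end
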